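(* There is an absolute constant $C_0$ such that for all real $u>0$ and $T\ge0$, $$\tfrac12N_u(T)=\frac{T}{2\pi}\log\frac{T}{2\pi}-\frac{T}{2\pi}+\frac78+S_u(T),\qquad |S_u(T)|\le C_0(u+1)\log(T+u+2),$$ where $N_u(T)$ is the number of zeros $\rho$ of $s\mapsto\xi_{\mathbb Q}(u,s)$, counted with multiplicity, with $|\Im(\rho)|\le T$.
   Context: $\theta(t)=\sum_{n\in\mathbb Z}e^{-\pi n^2t}$ for $t>0$. $Z_{\mathbb Q}(w,s)=\int_0^\infty\theta(t^2)^s\theta(1/t^2)^{w-s}\frac{dt}{t}$ for $\Re(w)<\Re(s)<0$, continued meromorphically to $\mathbb C^2$; $\xi_{\mathbb Q}(w,s)=\frac{s(s-w)}{2w}Z_{\mathbb Q}(w,s)$ extends to an entire function on $\mathbb C^2$, denoted $\xi_{\mathbb Q}$. The term $T\log\frac{T}{2\pi}$ is interpreted as $0$ at $T=0$. *)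

theory Defs
  imports "HOL-Complex_Analysis.Complex_Analysis"
begin

definition theta :: "real \<Rightarrow> real" where
  "theta t = (\<Sum>\<^sub>\<infinity>n\<in>(UNIV :: int set). exp (- pi * (of_int n)\<^sup>2 * t))"

text \<open>The integral defining $Z_{\mathbb Q}(w,s)$. It converges absolutely for
  $\Re w < \Re s < 0$, and it is only used there. The bases of the powers are positive reals,
  so \<^const>\<open>powr\<close> is unambiguous.\<close>

definition Z_integral :: "complex \<Rightarrow> complex \<Rightarrow> complex" where
  "Z_integral w s =
     (LINT t:{0<..}|lborel.
        complex_of_real (theta (t\<^sup>2)) powr s * complex_of_real (theta (1 / t\<^sup>2)) powr (w - s)
          / complex_of_real t)"

text \<open>Holomorphy on all of $\mathbb C^2$: a complex-linear Frechet derivative at every point.\<close>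

definition entire2 :: "(complex \<Rightarrow> complex \<Rightarrow> complex) \<Rightarrow> bool" where
  "entire2 F \<longleftrightarrow>
     (\<forall>w s. \<exists>a b. ((\<lambda>(x, y). F x y) has_derivative (\<lambda>(h, k). a * h + b * k)) (at (w, s)))"

text \<open>The entire function on $\mathbb C^2$ extending $\frac{s(s-w)}{2w} Z_{\mathbb Q}(w,s)$.
  By the identity theorem there is only one such function, and it agrees with
  $\frac{s(s-w)}{2w}$ times the meromorphic continuation of $Z_{\mathbb Q}$ wherever the
  latter is defined.\<close>

definition xi_Q :: "complex \<Rightarrow> complex \<Rightarrow> complex" where
  "xi_Q = (THE F. entire2 F \<and>
     (\<forall>w s. Re w < Re s \<and> Re s < 0 \<longrightarrow> F w s = s * (s - w) / (2 * w) * Z_integral w s))"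

definition xi_zeros :: "real \<Rightarrow> real \<Rightarrow> complex set" where
  "xi_zeros u T = {\<rho>. xi_Q (complex_of_real u) \<rho> = 0 \<and> \<bar>Im \<rho>\<bar> \<le> T}"

text \<open>The sum is $0$ by convention if \<^term>\<open>xi_zeros u T\<close> is infinite, so this is the number of
  zeros only together with finiteness of that set.\<close>

definition N_zeros :: "real \<Rightarrow> real \<Rightarrow> nat" where
  "N_zeros u T = (\<Sum>\<rho>\<in>xi_zeros u T. nat (zorder (xi_Q (complex_of_real u)) \<rho>))"

end

(*
  Put Phi(y) = theta(exp(2y)), so that Phi(-y) = exp(y) Phi(y). In the variable y = log t the integral Z_Q
  becomes a Mellin integral over the half line y >= 0, which yields the explicit entire continuation Xi
  of xi_Q, its functional equation s -> u - s and polynomial growth in vertical strips.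
  Because theta(q) = 1 + 2 q + 2 q^4 + ... has no zero in the unit disc (Gauss's product), theta^u has a
  power series in q; Cauchy's estimates and Borel-Caratheodory bound the coefficients of (theta^u - 1) / u
  uniformly in u, and so Xi(u, s) is s (s - u) / 4 * pi^(-s/2) * Gamma(s/2) times a Dirichlet series in
  n^(-s/2) that stays within distance 1 of 2 once Re s >= 4 u + 24.
  The zeros are counted by the argument principle on a rectangle symmetric under s -> u - s. Stirling's
  formula gives the vertical edges. On the horizontal edges the variation of the argument is at most a
  constant times log (max |Xi| / |Xi(s0)|) on a disc of radius O(u + 1) around the right end point s0, and
  Phragmen-Lindelof, comparing Xi with Gamma(s/2 + k), bounds this by O((u + 1) log(T + u + 2)).
*)
theory Submission
  imports Defs "HOL-Real_Asymp.Real_Asymp"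
begin

section \<open>The transformation law of theta\<close>

text \<open>Everything has to be uniform in \<open>u\<close>, also for \<open>u\<close> near 0 and
  for \<open>u\<close> that is not an integer. For non-integral \<open>u\<close> the power series of
  theta^u converges in the whole unit disc only because theta has no zero there; a zero would make
  the coefficients grow exponentially and leave no half plane where the Dirichlet series converges.
  Near \<open>u\<close> = 0 the factor 1/u has to cancel, which is why log theta itself, and not
  just theta^u, is bounded on circles. The n-th coefficient is then at most a constant times
  n^(2u+2), so the first term dominates once Re s is about 4u. This leads to rectangles of width
  comparable to u + 1, and that width is the source of the factor u + 1 in the error. To the left of
  that half plane only the symmetry and a growth bound with an uncontrolled dependence on
  \<open>u\<close> are available; Phragmen-Lindelof removes this unknown constant. Since log(T + u +
  2) is at least 1/2, the error absorbs the term 7/8 as well as the passage from \<open>T\<close> to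
  a nearby height free of zeros.\<close>

lemma sum_gauss_summable:
  assumes "t > 0"
  shows "summable (\<lambda>k. exp (- pi * (real (Suc k))\<^sup>2 * t))"
proof (rule summable_comparison_test')
  show "summable (\<lambda>k. exp (- pi * t) ^ k)"
    using assms by (intro summable_geometric) auto
  fix k :: nat
  have "real k \<le> (real (Suc k))\<^sup>2" by (simp add: power2_eq_square algebra_simps)
  hence "pi * t * real k \<le> pi * t * (real (Suc k))\<^sup>2"
    using assms by (intro mult_left_mono) auto
  hence "exp (- pi * (real (Suc k))\<^sup>2 * t) \<le> exp (real k * (- pi * t))"
    by (simp add: algebra_simps del: of_nat_Suc)
  thus "norm (exp (- pi * (real (Suc k))\<^sup>2 * t)) \<le> exp (- pi * t) ^ k"
    by (simp only: exp_of_nat_mult) simp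
qed

lemma theta_eq_suminf:
  assumes "t > 0"
  shows "theta t = 1 + 2 * (\<Sum>k. exp (- pi * (real (Suc k))\<^sup>2 * t))"
proof -
  let ?g = "\<lambda>n::int. exp (- pi * (of_int n)\<^sup>2 * t)"
  let ?f = "\<lambda>k. exp (- pi * (real (Suc k))\<^sup>2 * t)"
  have s: "summable (\<lambda>k. norm (?f k))"
    using sum_gauss_summable[OF assms] by simp
  have f: "(?f has_sum suminf ?f) UNIV"
    by (rule norm_summable_imp_has_sum[OF s]) (use sum_gauss_summable[OF assms] in \<open>simp add: summable_sums\<close>)
  have P: "(?g has_sum suminf ?f) {0<..}"
    by (rule iffD1[OF has_sum_reindex_bij_witness[of _ "\<lambda>n. nat n - 1" "\<lambda>k. int (Suc k)"] f]) auto
  have N: "(?g has_sum suminf ?f) {..<0}"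
    by (rule iffD1[OF has_sum_reindex_bij_witness[of _ "\<lambda>n. nat (-n) - 1" "\<lambda>k. - int (Suc k)"] f])
       (auto simp: power2_eq_square algebra_simps)
  have Z: "(?g has_sum 1) {0}" by (rule has_sum_finiteI) auto
  have "(?g has_sum (suminf ?f + 1)) ({0<..} \<union> {0})"
    by (rule has_sum_Un_disjoint[OF P Z]) auto
  hence "(?g has_sum ((suminf ?f + 1) + suminf ?f)) (({0<..} \<union> {0}) \<union> {..<0})"
    by (rule has_sum_Un_disjoint[OF _ N]) auto
  also have "({0<..} \<union> {0}) \<union> {..<0} = (UNIV :: int set)" by auto
  finally have "infsum ?g UNIV = (suminf ?f + 1) + suminf ?f" by (rule infsumI)
  thus ?thesis unfolding theta_def by simp
qed

(* Polya's proof of the transformation law: evaluate the sum of (2 cos (pi k / l))^(2 m) over k mod l in two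
   ways and let l, m tend to infinity with m / l^2 -> c; the two sides tend to theta values at pi c and
   1 / (pi c). *)
lemma root_of_unity_filter:
  assumes "l > 0"
  shows "(\<Sum>k<l. cis (2 * pi * real k * of_int d / real l)) = (if int l dvd d then of_nat l else 0)"
proof -
  define z where "z = cis (2 * pi * of_int d / real l)"
  have "(\<Sum>k<l. cis (2 * pi * real k * of_int d / real l)) = (\<Sum>k<l. z ^ k)"
    unfolding z_def by (intro sum.cong refl, subst Complex.DeMoivre) (auto simp: mult_ac)
  moreover have "z ^ l = 1"
  proof -
    have "real l * (2 * pi * of_int d / real l) = 2 * pi * of_int d" using assms by simp
    thus ?thesis unfolding z_def by (simp only: Complex.DeMoivre) (metis Ints_of_int cis_multiple_2pi)
  qed
  moreover have "z = 1 \<longleftrightarrow> int l dvd d"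
  proof
    assume "z = 1"
    hence "cos (2 * pi * of_int d / real l) = 1"
      unfolding z_def by (metis cis.sel(1) one_complex.sel(1))
    then obtain n :: int where "2 * pi * of_int d / real l = of_int n * 2 * pi"
      unfolding cos_one_2pi_int by blast
    hence "of_int d = of_int n * (of_int (int l) :: real)" using assms by (simp add: field_simps)
    hence "d = n * int l" by (metis of_int_eq_iff of_int_mult)
    thus "int l dvd d" by simp
  next
    assume "int l dvd d"
    then obtain n where "d = int l * n" by blast
    hence "2 * pi * of_int d / real l = 2 * pi * of_int n" using assms by simp
    thus "z = 1" unfolding z_def by (metis Ints_of_int cis_multiple_2pi)
  qed
  ultimately show ?thesis
    by (cases "z = 1") (auto simp: geometric_sum)
qed

text \<open>Here 2 cos x = cis x + cis (-x); the binomial theorem turns the power into exponentials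
  of frequency j - m, and summation over k mod l keeps those frequencies that are divisible by
  l.\<close>

lemma sum_cos_power:
  assumes "l > 0"
  shows "(\<Sum>k<l. (2 * cos (pi * real k / real l)) ^ (2*m)) =
           real l * (\<Sum>j | j \<le> 2*m \<and> int l dvd (int j - int m). real ((2*m) choose j))"
proof -
  have 1: "complex_of_real ((2 * cos x) ^ (2*m)) =
          (\<Sum>j\<le>2*m. of_nat ((2*m) choose j) * cis (2 * x * of_int (int j - int m)))" for x
  proof -
    have "complex_of_real (2 * cos x) = cis x + cis (-x)" by (simp add: complex_eq_iff)
    hence "complex_of_real ((2 * cos x) ^ (2*m)) = (cis x + cis (-x)) ^ (2*m)"
      by (metis of_real_power)
    also have "\<dots> = (\<Sum>j\<le>2*m. of_nat ((2*m) choose j) * cis x ^ j * cis (-x) ^ (2*m-j))"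
      by (rule binomial_ring)
    also have "\<dots> = (\<Sum>j\<le>2*m. of_nat ((2*m) choose j) * cis (2 * x * of_int (int j - int m)))"
    proof (intro sum.cong refl)
      fix j assume "j \<in> {..2*m}"
      hence "real (2*m - j) = 2 * real m - real j" by (simp add: of_nat_diff)
      hence "cis x ^ j * cis (-x) ^ (2*m-j) = cis (2 * x * of_int (int j - int m))"
        unfolding Complex.DeMoivre cis_mult by (simp add: algebra_simps)
      thus "of_nat ((2*m) choose j) * cis x ^ j * cis (-x) ^ (2*m-j) =
            of_nat ((2*m) choose j) * cis (2 * x * of_int (int j - int m))"
        by (simp only: mult.assoc)
    qed
    finally show ?thesis .
  qed
  have "complex_of_real (\<Sum>k<l. (2 * cos (pi * real k / real l)) ^ (2*m)) =
        (\<Sum>k<l. \<Sum>j\<le>2*m. of_nat ((2*m) choose j) * cis (2 * pi * real k * of_int (int j - int m) / real l))"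
    by (simp only: of_real_sum 1) (simp add: mult_ac)
  also have "\<dots> = (\<Sum>j\<le>2*m. of_nat ((2*m) choose j) * (if int l dvd (int j - int m) then of_nat l else 0))"
    by (subst sum.swap) (simp only: sum_distrib_left[symmetric] root_of_unity_filter[OF assms])
  also have "\<dots> = (\<Sum>j\<in>{..2*m} \<inter> {j. int l dvd (int j - int m)}. of_nat l * of_nat ((2*m) choose j))"
    by (rule sum.mono_neutral_cong_right) auto
  also have "{..2*m} \<inter> {j. int l dvd (int j - int m)} = {j. j \<le> 2*m \<and> int l dvd (int j - int m)}" by auto
  finally show ?thesis
    by (simp only: sum_distrib_left of_real_eq_iff[symmetric, where ?'a = complex] of_real_sum of_real_mult of_real_of_nat_eq)
qed

text \<open>As \<open>l\<close> is odd, k and l - k pair off without a middle term. Afterwards every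
  angle lies in [0, pi/2], where the decay estimate for cosine powers applies.\<close>

lemma sum_cos_power_half:
  assumes "l = 2*p+1"
  shows "(\<Sum>k<l. (2 * cos (pi * real k / real l)) ^ (2*m)) =
           4 ^ m * (1 + 2 * (\<Sum>k<p. cos (pi * real (Suc k) / real l) ^ (2*m)))"
proof -
  let ?c = "\<lambda>k. (2 * cos (pi * real k / real l)) ^ (2*m)"
  have *: "{..<l} = insert 0 (Suc ` {..<p} \<union> (\<lambda>k. l - Suc k) ` {..<p})"
  proof (intro equalityI subsetI)
    fix x assume x: "x \<in> {..<l}"
    consider "x = 0" | "0 < x" "x \<le> p" | "p < x" by linarith
    thus "x \<in> insert 0 (Suc ` {..<p} \<union> (\<lambda>k. l - Suc k) ` {..<p})"
    proof cases
      case 2 hence "x = Suc (x - 1)" "x - 1 \<in> {..<p}" by auto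
      thus ?thesis by blast
    next
      case 3 hence "x = l - Suc (l - Suc x)" "l - Suc x \<in> {..<p}" using x assms by auto
      thus ?thesis by blast
    qed auto
  qed (auto simp: assms)
  have "sum ?c {..<l} = ?c 0 + (sum ?c (Suc ` {..<p}) + sum ?c ((\<lambda>k. l - Suc k) ` {..<p}))"
    unfolding * by (subst sum.insert) (auto simp: assms intro!: sum.union_disjoint)
  also have "sum ?c (Suc ` {..<p}) = (\<Sum>k<p. ?c (Suc k))"
    by (subst sum.reindex) auto
  also have "sum ?c ((\<lambda>k. l - Suc k) ` {..<p}) = (\<Sum>k<p. ?c (l - Suc k))"
    by (subst sum.reindex) (auto simp: assms inj_on_def)
  also have "\<dots> = (\<Sum>k<p. ?c (Suc k))"
  proof (intro sum.cong refl)
    fix k assume "k \<in> {..<p}"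
    hence "real (l - Suc k) = real l - real (Suc k)" by (simp add: of_nat_diff assms)
    hence "pi * real (l - Suc k) / real l = pi - pi * real (Suc k) / real l"
      by (simp add: assms field_simps)
    thus "?c (l - Suc k) = ?c (Suc k)" by (simp add: power_mult)
  qed
  moreover have "?c k = 4 ^ m * cos (pi * real k / real l) ^ (2*m)" for k
    unfolding power_mult_distrib by (simp add: power_mult)
  ultimately show ?thesis
    by (simp only: sum_distrib_left[symmetric]) (simp add: distrib_left)
qed

text \<open>The indices are m plus or minus multiples of l, paired by the symmetry of the binomial
  coefficients. The range r < m is generous: coefficients with index beyond 2m vanish.\<close>

lemma sum_binomial_arith:
  assumes "l > 0"
  shows "(\<Sum>j | j \<le> 2*m \<and> int l dvd (int j - int m). real ((2*m) choose j)) =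
           real ((2*m) choose m) + 2 * (\<Sum>r<m. real ((2*m) choose (m + l * Suc r)))"
proof -
  let ?R = "{r. r < m \<and> l * Suc r \<le> m}"
  let ?b = "\<lambda>j. real ((2*m) choose j)"
  have "{j. j \<le> 2*m \<and> int l dvd (int j - int m)} =
        insert m ((\<lambda>r. m + l * Suc r) ` ?R \<union> (\<lambda>r. m - l * Suc r) ` ?R)"
  proof (intro equalityI subsetI)
    fix j assume "j \<in> {j. j \<le> 2*m \<and> int l dvd (int j - int m)}"
    then obtain d where j: "j \<le> 2*m" "int j - int m = int l * d" by (auto elim: dvdE)
    have le: "r < m" if "l * Suc r \<le> m" for r
    proof -
      have "Suc r \<le> l * Suc r" using assms by (cases l) auto
      thus ?thesis using that by linarith
    qed
    consider "d = 0" | "d > 0" | "d < 0" by linarith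
    thus "j \<in> insert m ((\<lambda>r. m + l * Suc r) ` ?R \<union> (\<lambda>r. m - l * Suc r) ` ?R)"
    proof cases
      case 1 thus ?thesis using j by simp
    next
      case 2
      define r where "r = nat d - 1"
      have d: "d = int (Suc r)" using 2 by (simp add: r_def)
      have "int j = int (m + l * Suc r)" using j(2) unfolding d of_nat_add of_nat_mult by linarith
      hence jj: "j = m + l * Suc r" by (simp only: of_nat_eq_iff)
      moreover have "l * Suc r \<le> m" using j(1) jj by linarith
      ultimately show ?thesis using le by blast
    next
      case 3
      define r where "r = nat (-d) - 1"
      have d: "d = - int (Suc r)" using 3 by (simp add: r_def)
      have "int m = int (j + l * Suc r)" using j(2) unfolding d of_nat_add of_nat_mult mult_minus_right by linarith
      hence "m = j + l * Suc r" by (simp only: of_nat_eq_iff)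
      hence "j = m - l * Suc r" "l * Suc r \<le> m" by linarith+
      thus ?thesis using le by blast
    qed
  qed (auto simp: of_nat_diff)
  hence "(\<Sum>j | j \<le> 2*m \<and> int l dvd (int j - int m). ?b j) =
          sum ?b (insert m ((\<lambda>r. m + l * Suc r) ` ?R \<union> (\<lambda>r. m - l * Suc r) ` ?R))"
    by (rule arg_cong)
  also have "\<dots> = ?b m + (sum ?b ((\<lambda>r. m + l * Suc r) ` ?R) + sum ?b ((\<lambda>r. m - l * Suc r) ` ?R))"
  proof -
    have nz: "l * Suc r > 0" for r using assms by simp
    have "m \<notin> (\<lambda>r. m + l * Suc r) ` ?R \<union> (\<lambda>r. m - l * Suc r) ` ?R"
    proof
      assume "m \<in> (\<lambda>r. m + l * Suc r) ` ?R \<union> (\<lambda>r. m - l * Suc r) ` ?R"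
      then obtain r where "m = m + l * Suc r \<or> m = m - l * Suc r" "l * Suc r \<le> m" by blast
      thus False using nz[of r] by linarith
    qed
    moreover have "(\<lambda>r. m + l * Suc r) ` ?R \<inter> (\<lambda>r. m - l * Suc r) ` ?R = {}"
    proof -
      have "m + l * Suc r \<noteq> m - l * Suc r'" for r r' using nz[of r] by linarith
      thus ?thesis by blast
    qed
    ultimately show ?thesis
      by (subst sum.insert) (simp_all add: sum.union_disjoint)
  qed
  also have "sum ?b ((\<lambda>r. m + l * Suc r) ` ?R) = (\<Sum>r\<in>?R. ?b (m + l * Suc r))"
    by (rule sum.reindex_cong[of "\<lambda>r. m + l * Suc r"]) (use assms in \<open>simp_all add: inj_on_def del: mult_Suc_right\<close>)
  also have "sum ?b ((\<lambda>r. m - l * Suc r) ` ?R) = (\<Sum>r\<in>?R. ?b (m + l * Suc r))"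
  proof (rule sum.reindex_cong[of "\<lambda>r. m - l * Suc r"])
    show "inj_on (\<lambda>r. m - l * Suc r) ?R"
    proof (rule inj_onI)
      fix x y assume "x \<in> ?R" "y \<in> ?R" and e: "m - l * Suc x = m - l * Suc y"
      hence "l * Suc x \<le> m" "l * Suc y \<le> m" by blast+
      with e have "l * Suc x = l * Suc y" by linarith
      thus "x = y" using assms by (simp only: mult_cancel1) simp
    qed
  next
    fix r assume "r \<in> ?R"
    hence *: "l * Suc r \<le> m" by blast
    hence "2*m - (m - l * Suc r) = m + l * Suc r" "m - l * Suc r \<le> 2 * m" by linarith+
    thus "?b (m - l * Suc r) = ?b (m + l * Suc r)"
      using binomial_symmetric[of "m - l * Suc r" "2*m"] by simp
  qed simp
  also have "(\<Sum>r\<in>?R. ?b (m + l * Suc r)) = (\<Sum>r<m. ?b (m + l * Suc r))"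
    by (rule sum.mono_neutral_left) (auto simp: not_le intro!: binomial_eq_0)
  finally show ?thesis by simp
qed

text \<open>The quotient of neighbouring coefficients is 1 - (2i+1)/(m+i+1) \<le>
  exp(-(2i+1)/(m+K)), and the odd numbers below 2R add up to R^2. The parameter \<open>K\<close>
  keeps the denominator fixed during the induction; it is later taken as \<open>R\<close> for a
  limit and as \<open>m\<close> for a uniform bound.\<close>

lemma central_binomial_ratio_le:
  "R \<le> m \<Longrightarrow> R \<le> K \<Longrightarrow>
     real ((2*m) choose (m+R)) \<le> real ((2*m) choose m) * exp (- (real R)\<^sup>2 / real (m + K))"
proof (induction R)
  case (Suc i)
  have "Suc (m+i) * ((2*m) choose Suc (m+i)) = (2*m - (m+i)) * ((2*m) choose (m+i))"
    using Suc.prems by (metis binomial_absorb_comp binomial_absorption mult.commute)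
  hence "real (Suc (m+i)) * real ((2*m) choose Suc (m+i)) = (real m - real i) * real ((2*m) choose (m+i))"
    using Suc.prems by (simp only: of_nat_mult[symmetric]) (simp add: of_nat_diff)
  hence "real ((2*m) choose (m + Suc i)) = (1 - (2 * real i + 1) / real (m+i+1)) * real ((2*m) choose (m+i))"
    by (simp add: field_simps)
  also have "\<dots> \<le> exp (- (2 * real i + 1) / real (m+K)) * (real ((2*m) choose m) * exp (- (real i)\<^sup>2 / real (m + K)))"
  proof (intro mult_mono)
    have "(2 * real i + 1) / real (m+K) \<le> (2 * real i + 1) / real (m+i+1)"
      using Suc.prems by (intro divide_left_mono) auto
    thus "1 - (2 * real i + 1) / real (m+i+1) \<le> exp (- (2 * real i + 1) / real (m+K))"
      using exp_ge_add_one_self[of "- (2 * real i + 1) / real (m+K)"]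
      unfolding minus_divide_left[symmetric] by linarith
  qed (use Suc in auto)
  also have "\<dots> = real ((2*m) choose m) * exp (- (real (Suc i))\<^sup>2 / real (m + K))"
    using Suc.prems by (simp add: mult.left_commute exp_add[symmetric] add_divide_distrib[symmetric] power2_eq_square algebra_simps diff_divide_distrib[symmetric])
  finally show ?case .
qed auto

text \<open>The same telescoping product, now with the reciprocal quotient 1 + (2i+1)/(m-i) bounded
  by an exponential; i < K gives m - i \<ge> m + 1 - K.\<close>

lemma central_binomial_ratio_ge:
  "R \<le> K \<Longrightarrow> K \<le> m \<Longrightarrow>
     real ((2*m) choose (m+R)) \<ge> real ((2*m) choose m) * exp (- (real R)\<^sup>2 / real (m + 1 - K))"
proof (induction R)
  case (Suc i)
  have "Suc (m+i) * ((2*m) choose Suc (m+i)) = (2*m - (m+i)) * ((2*m) choose (m+i))"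
    using Suc.prems by (metis binomial_absorb_comp binomial_absorption mult.commute)
  hence "real (Suc (m+i)) * real ((2*m) choose Suc (m+i)) = (real m - real i) * real ((2*m) choose (m+i))"
    using Suc.prems by (simp only: of_nat_mult[symmetric]) (simp add: of_nat_diff)
  hence eq: "real ((2*m) choose (m + Suc i)) = (real m - real i) / real (m+i+1) * real ((2*m) choose (m+i))"
    by (simp add: field_simps)
  have "real ((2*m) choose m) * exp (- (real (Suc i))\<^sup>2 / real (m + 1 - K)) =
      exp (- (2 * real i + 1) / real (m+1-K)) * (real ((2*m) choose m) * exp (- (real i)\<^sup>2 / real (m + 1 - K)))"
    by (simp add: mult.left_commute exp_add[symmetric] add_divide_distrib[symmetric] power2_eq_square algebra_simps diff_divide_distrib[symmetric])
  also have "\<dots> \<le> (real m - real i) / real (m+i+1) * real ((2*m) choose (m+i))"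
  proof (intro mult_mono)
    have pos: "real m - real i > 0" using Suc.prems by simp
    have "(2 * real i + 1) / (real m - real i) \<le> (2 * real i + 1) / real (m+1-K)"
      using Suc.prems pos by (intro divide_left_mono) (auto simp: of_nat_diff)
    moreover have "real (m+i+1) / (real m - real i) \<le> exp ((2 * real i + 1) / (real m - real i))"
      using exp_ge_add_one_self[of "(2 * real i + 1) / (real m - real i)"] pos by (simp add: field_simps)
    ultimately have "real (m+i+1) / (real m - real i) \<le> exp ((2 * real i + 1) / real (m+1-K))"
      by (meson exp_le_cancel_iff order_trans)
    hence "inverse (exp ((2 * real i + 1) / real (m+1-K))) \<le> inverse (real (m+i+1) / (real m - real i))"
      using pos by (intro le_imp_inverse_le) auto
    thus "exp (- (2 * real i + 1) / real (m+1-K)) \<le> (real m - real i) / real (m+i+1)"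
      unfolding minus_divide_left[symmetric] exp_minus by (simp only: inverse_divide)
  qed (use Suc in auto)
  finally show ?case unfolding eq .
qed auto

text \<open>The square of the m-th term is the reciprocal of a partial Wallis product.\<close>

lemma central_binomial_asymp:
  "(\<lambda>m. sqrt (2 * real m + 1) * real ((2*m) choose m) / 4 ^ m) \<longlonglongrightarrow> sqrt (2 / pi)"
proof -
  let ?P = "\<lambda>n. (\<Prod>k=1..n. (4*real k^2) / (4*real k^2 - 1))"
  have eq: "sqrt (2 * real m + 1) * real ((2*m) choose m) / 4 ^ m = sqrt (1 / ?P m)" for m
  proof -
    have "?P m * ((2 * real m + 1) * (real ((2*m) choose m))\<^sup>2) = 16 ^ m"
    proof (induction m)
      case (Suc m)
      have "Suc m * ((2 * Suc m) choose Suc m) = 2 * (Suc m * (Suc (2*m) choose m))"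
        using Suc_times_binomial_eq[of "Suc (2*m)" m] by (simp add: mult.commute)
      also have "Suc m * (Suc (2*m) choose m) = Suc (2*m) * ((2*m) choose m)"
        using binomial_absorb_comp[of "Suc (2*m)" m] by simp
      finally have "Suc m * ((2 * Suc m) choose Suc m) = 2 * (2 * m + 1) * ((2*m) choose m)"
        by (simp only: mult.assoc) simp
      hence "real (Suc m) * real ((2 * Suc m) choose Suc m) = 2 * (2 * real m + 1) * real ((2*m) choose m)"
        by (metis (no_types, lifting) of_nat_1 of_nat_add of_nat_mult of_nat_numeral)
      hence e: "real ((2 * Suc m) choose Suc m) = 2 * (2 * real m + 1) * real ((2*m) choose m) / real (Suc m)"
        by (simp add: field_simps)
      have nz: "4 * (real (Suc m))\<^sup>2 - 1 \<noteq> 0" 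
        by (simp add: power2_eq_square algebra_simps) (smt (verit) of_nat_0_le_iff mult_nonneg_nonneg)
      have "?P (Suc m) * ((2 * real (Suc m) + 1) * (real ((2 * Suc m) choose Suc m))\<^sup>2) =
        16 * (?P m * ((2 * real m + 1) * (real ((2*m) choose m))\<^sup>2))
          * (((2 * real (Suc m) + 1) * (2 * real m + 1)) / (4 * (real (Suc m))\<^sup>2 - 1))"
      proof -
        have gen: "P * (4 * S\<^sup>2 / D) * (z * (2 * y * x / S)\<^sup>2) = 16 * (P * (y * x\<^sup>2)) * ((z * y) / D)"
          if "S \<noteq> 0" "D \<noteq> 0" for P S D x y z :: real
          using that by (simp add: power2_eq_square field_simps)
        have PS: "?P (Suc m) = ?P m * (4 * (real (Suc m))\<^sup>2 / (4 * (real (Suc m))\<^sup>2 - 1))" by simp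
        show ?thesis unfolding e PS by (rule gen[OF _ nz]) simp
      qed
      also have "((2 * real (Suc m) + 1) * (2 * real m + 1)) / (4 * (real (Suc m))\<^sup>2 - 1) = 1"
        using nz by (simp add: power2_eq_square algebra_simps)
      finally show ?case using Suc by simp
    qed auto
    moreover have "?P m > 0"
    proof (intro prod_pos ballI)
      fix k assume "k \<in> {1..m}"
      hence "real k \<ge> 1" by simp
      hence "(real k)\<^sup>2 \<ge> 1" by simp
      hence "4 * (real k)\<^sup>2 > 0" "4 * (real k)\<^sup>2 - 1 > 0" by linarith+
      thus "4 * (real k)\<^sup>2 / (4 * (real k)\<^sup>2 - 1) > 0" by (rule divide_pos_pos)
    qed
    moreover have "1 / P = X / Y" if "P * X = Y" "P > 0" "Y \<noteq> 0" for P X Y :: real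
      using that by (simp add: field_simps)
    ultimately have "1 / ?P m = (2 * real m + 1) * (real ((2*m) choose m))\<^sup>2 / 16 ^ m"
      by (metis (no_types, lifting) power_not_zero zero_neq_numeral)
    also have "(16::real) ^ m = (4 ^ m)\<^sup>2" by (simp add: power2_eq_square power_mult_distrib[symmetric])
    finally show ?thesis by (simp add: real_sqrt_mult real_sqrt_divide)
  qed
  have "(\<lambda>m. sqrt (1 / ?P m)) \<longlonglongrightarrow> sqrt (1 / (pi/2))"
    by (intro tendsto_intros wallis) simp
  thus ?thesis unfolding eq by simp
qed

text \<open>From x cos x \<le> sin x follows (cos x)^2 (1 + x^2) \<le> 1, and Bernoulli's inequality
  handles the \<open>m\<close>-th power. For x = pi k / l and m about c l^2 this gives a bound of
  order 1/k^2 that is uniform in l.\<close>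

lemma cos_power_even_le:
  assumes "0 \<le> x" "x \<le> pi / 2"
  shows "cos x ^ (2*m) \<le> 1 / (1 + real m * x\<^sup>2)"
proof -
  have "sin 0 - 0 * cos 0 \<le> sin x - x * cos x"
  proof (rule DERIV_nonneg_imp_nondecreasing[OF assms(1)])
    fix y assume "0 \<le> y" "y \<le> x"
    hence "y * sin y \<ge> 0" using assms by (intro mult_nonneg_nonneg sin_ge_zero) auto
    moreover have "((\<lambda>y. sin y - y * cos y) has_real_derivative y * sin y) (at y)"
      by (auto intro!: derivative_eq_intros)
    ultimately show "\<exists>d. ((\<lambda>y. sin y - y * cos y) has_real_derivative d) (at y) \<and> 0 \<le> d" by blast
  qed
  hence "x * cos x \<le> sin x" by simp
  moreover have "0 \<le> x * cos x" using assms by (intro mult_nonneg_nonneg cos_ge_zero) auto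
  ultimately have "(x * cos x)\<^sup>2 \<le> (sin x)\<^sup>2" by (intro power_mono)
  hence "(cos x)\<^sup>2 * (1 + x\<^sup>2) \<le> 1" by (simp add: power_mult_distrib sin_squared_eq algebra_simps)
  hence "((cos x)\<^sup>2 * (1 + x\<^sup>2)) ^ m \<le> 1" by (intro power_le_one) auto
  hence "cos x ^ (2*m) * (1 + x\<^sup>2) ^ m \<le> 1" by (simp add: power_mult power_mult_distrib)
  moreover have "cos x ^ (2*m) * (1 + real m * x\<^sup>2) \<le> cos x ^ (2*m) * (1 + x\<^sup>2) ^ m"
  proof (rule mult_left_mono)
    have "- 1 \<le> x\<^sup>2" by (rule order_trans[of _ 0]) auto
    thus "1 + real m * x\<^sup>2 \<le> (1 + x\<^sup>2) ^ m" by (rule Bernoulli_inequality)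
  qed (simp add: power_mult)
  ultimately have "cos x ^ (2*m) * (1 + real m * x\<^sup>2) \<le> 1" by linarith
  moreover have "1 + real m * x\<^sup>2 > 0" by (simp add: add_pos_nonneg)
  ultimately show ?thesis by (simp add: field_simps)
qed

lemma theta_functional_equation_aux:
  assumes c: "c > 0"
  shows "theta (pi * c) = 1 / sqrt (pi * c) * theta (1 / (pi * c))"
proof -
  define l where "l p = 2 * p + 1" for p :: nat
  \<comment> \<open>With m / l^2 tending to c, both cos(pi k / l)^(2m) and the binomial quotient at
    distance l r from the centre have non-trivial limits, namely exp(-pi^2 k^2 c) and exp(-r^2 /
    c).\<close>
  define m where "m p = nat \<lfloor>c * (real (l p))\<^sup>2\<rfloor>" for p
  define C where "C p = real ((2 * m p) choose m p)" for p
  define a where "a k p = (if k < p then cos (pi * real (Suc k) / real (l p)) ^ (2 * m p) else 0)" for k p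
  define b where "b r p = real ((2 * m p) choose (m p + l p * Suc r)) / C p" for r p
  define q where "q p = real (m p) / (real (l p))\<^sup>2" for p
  have lpos: "real (l p) > 0" for p by (simp add: l_def)
  have Cpos: "C p > 0" for p by (simp add: C_def)
  have m_le: "real (m p) \<le> c * (real (l p))\<^sup>2" for p
    unfolding m_def using c by (simp add: of_nat_nat)
  have m_ge: "real (m p) \<ge> c * (real (l p))\<^sup>2 - 1" for p
    unfolding m_def using c by (simp add: of_nat_nat)
  have l_lim: "(\<lambda>p. 1 / real (l p)) \<longlonglongrightarrow> 0" unfolding l_def by real_asymp
  hence l2_lim: "(\<lambda>p. 1 / (real (l p))\<^sup>2) \<longlonglongrightarrow> 0"
    using tendsto_power[of "\<lambda>p. 1 / real (l p)" 0 sequentially 2] by (simp add: power_divide)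
  have q_le: "q p \<le> c" for p using m_le[of p] lpos[of p] by (simp add: q_def field_simps)
  have q_lim: "q \<longlonglongrightarrow> c"
  proof (rule tendsto_sandwich)
    show "(\<lambda>p. c - 1 / (real (l p))\<^sup>2) \<longlonglongrightarrow> c"
      using tendsto_diff[OF tendsto_const l2_lim, of c] by simp
    show "\<forall>\<^sub>F p in sequentially. c - 1 / (real (l p))\<^sup>2 \<le> q p"
    proof (intro always_eventually allI)
      fix p
      have "c - 1 / (real (l p))\<^sup>2 = (c * (real (l p))\<^sup>2 - 1) / (real (l p))\<^sup>2"
        using lpos[of p] by (simp add: field_simps)
      also have "\<dots> \<le> q p" unfolding q_def by (intro divide_right_mono m_ge) auto
      finally show "c - 1 / (real (l p))\<^sup>2 \<le> q p" .
    qed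
  qed (use q_le in auto)
  have m_lim: "filterlim m at_top sequentially"
  proof -
    have "filterlim (\<lambda>p. c * (real (l p))\<^sup>2 - 1) at_top sequentially"
      unfolding l_def using c by real_asymp
    hence "filterlim (\<lambda>p. real (m p)) at_top sequentially"
      by (rule filterlim_at_top_mono) (use m_ge in auto)
    thus ?thesis by (simp add: filterlim_sequentially_iff_filterlim_real)
  qed
  have sq: "summable (\<lambda>k. 1 / (real (Suc k))\<^sup>2)"
    using inverse_power_summable[of 2, where ?'a = real] 
    by (subst summable_Suc_iff) (simp add: inverse_eq_divide)

  \<comment> \<open>Tannery's theorem: termwise limits together with a summable bound valid for all
    large p.\<close>
  have a_lim: "(\<lambda>p. suminf (\<lambda>k. a k p)) \<longlonglongrightarrow> (\<Sum>k. exp (- pi * (real (Suc k))\<^sup>2 * (pi * c)))"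
  proof (rule conjunct2[OF conjunct2[OF tannerys_theorem]])
    fix k
    have "(\<lambda>p. (real (l p))\<^sup>2 * ln (cos (pi * real (Suc k) / real (l p)))) \<longlonglongrightarrow> - (pi * real (Suc k))\<^sup>2 / 2"
      unfolding l_def by real_asymp (simp add: power2_eq_square)
    hence "(\<lambda>p. exp (2 * (q p * ((real (l p))\<^sup>2 * ln (cos (pi * real (Suc k) / real (l p)))))))
             \<longlonglongrightarrow> exp (2 * (c * (- (pi * real (Suc k))\<^sup>2 / 2)))"
      by (intro tendsto_intros q_lim)
    also have "exp (2 * (c * (- (pi * real (Suc k))\<^sup>2 / 2))) = exp (- pi * (real (Suc k))\<^sup>2 * (pi * c))"
      by (simp add: power_mult_distrib power2_eq_square mult_ac del: of_nat_Suc)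
    finally show "(\<lambda>p. a k p) \<longlonglongrightarrow> exp (- pi * (real (Suc k))\<^sup>2 * (pi * c))"
    proof (rule Lim_transform_eventually)
      show "\<forall>\<^sub>F p in sequentially. exp (2 * (q p * ((real (l p))\<^sup>2 * ln (cos (pi * real (Suc k) / real (l p)))))) = a k p"
        using eventually_gt_at_top[of k]
      proof eventually_elim
        case (elim p)
        have "cos (pi * real (Suc k) / real (l p)) > 0"
        proof (rule cos_gt_zero_pi)
          have "real (Suc k) / real (l p) < 1 / 2" using elim by (simp add: l_def field_simps)
          hence "pi * (real (Suc k) / real (l p)) < pi * (1/2)" by (intro mult_strict_left_mono) auto
          thus "pi * real (Suc k) / real (l p) < pi / 2" by simp
          have "0 \<le> pi * real (Suc k) / real (l p)" by simp
          thus "- (pi / 2) < pi * real (Suc k) / real (l p)" using pi_gt_zero by linarith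
        qed
        hence "cos (pi * real (Suc k) / real (l p)) ^ (2 * m p) =
           exp (real (2 * m p) * ln (cos (pi * real (Suc k) / real (l p))))"
          by (simp only: exp_of_nat_mult exp_ln)
        also have "real (2 * m p) = 2 * (q p * (real (l p))\<^sup>2)"
          using lpos[of p] by (simp add: q_def)
        finally show ?case using elim by (simp add: a_def mult.assoc)
      qed
    qed
  next
    have "\<forall>\<^sub>F p in sequentially. q p > c / 2"
      using order_tendstoD(1)[OF q_lim, of "c/2"] c by simp
    hence "\<forall>\<^sub>F p in sequentially. \<forall>k. norm (a k p) \<le> 2 / (c * pi\<^sup>2) * (1 / (real (Suc k))\<^sup>2)"
    proof eventually_elim
      case (elim p)
      show ?case
      proof (intro allI)
        fix k
        show "norm (a k p) \<le> 2 / (c * pi\<^sup>2) * (1 / (real (Suc k))\<^sup>2)"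
        proof (cases "k < p")
          case True
          define x where "x = pi * real (Suc k) / real (l p)"
          have x: "0 < x" unfolding x_def by (intro divide_pos_pos mult_pos_pos lpos) auto
          have "real (Suc k) / real (l p) \<le> 1 / 2" using True by (simp add: l_def field_simps)
          hence "pi * (real (Suc k) / real (l p)) \<le> pi * (1/2)" by (intro mult_left_mono) auto
          hence "x \<le> pi / 2" by (simp add: x_def)
          hence "cos x ^ (2 * m p) \<le> 1 / (1 + real (m p) * x\<^sup>2)"
            using x by (intro cos_power_even_le) auto
          also have "real (m p) * x\<^sup>2 = q p * (pi * real (Suc k))\<^sup>2"
            by (simp add: q_def x_def power_divide)
          also have "1 / (1 + q p * (pi * real (Suc k))\<^sup>2) \<le> 1 / (c / 2 * (pi * real (Suc k))\<^sup>2)"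
          proof (rule divide_left_mono)
            have "c / 2 * (pi * real (Suc k))\<^sup>2 \<le> q p * (pi * real (Suc k))\<^sup>2"
              using elim by (intro mult_right_mono) auto
            thus "c / 2 * (pi * real (Suc k))\<^sup>2 \<le> 1 + q p * (pi * real (Suc k))\<^sup>2" by linarith
            have "0 < c / 2 * (pi * real (Suc k))\<^sup>2" using c by simp
            moreover have "0 < 1 + q p * (pi * real (Suc k))\<^sup>2"
              using elim c by (intro add_pos_nonneg mult_nonneg_nonneg) auto
            ultimately show "0 < (1 + q p * (pi * real (Suc k))\<^sup>2) * (c / 2 * (pi * real (Suc k))\<^sup>2)"
              by (rule mult_pos_pos[rotated])
          qed auto
          also have "\<dots> = 2 / (c * pi\<^sup>2) * (1 / (real (Suc k))\<^sup>2)"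
            by (simp add: power_mult_distrib)
          finally show ?thesis using True by (simp add: a_def x_def power_mult)
        qed (use c in \<open>simp add: a_def\<close>)
      qed
    qed
    thus "\<forall>\<^sub>F (k, p) in at_top \<times>\<^sub>F sequentially. norm (a k p) \<le> 2 / (c * pi\<^sup>2) * (1 / (real (Suc k))\<^sup>2)"
      by (subst eventually_prod_filter) (rule exI[of _ "\<lambda>_. True"], auto)
  qed (rule summable_mult[OF sq], simp)

  have b_lim: "(\<lambda>p. suminf (\<lambda>r. b r p)) \<longlonglongrightarrow> (\<Sum>r. exp (- pi * (real (Suc r))\<^sup>2 * (1 / (pi * c))))"
  proof (rule conjunct2[OF conjunct2[OF tannerys_theorem]])
    fix r
    define R where "R p = l p * Suc r" for p
    define v where "v = real (Suc r)"
    have Rv: "real (R p) = real (l p) * v" for p by (simp only: R_def v_def of_nat_mult)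
    have "(\<lambda>p. q p - v * (1 / real (l p))) \<longlonglongrightarrow> c - v * 0"
      by (intro tendsto_intros q_lim l_lim)
    hence "\<forall>\<^sub>F p in sequentially. q p - v * (1 / real (l p)) > 0"
      using c order_tendstoD(1) by fastforce
    hence ev: "\<forall>\<^sub>F p in sequentially. R p < m p"
    proof eventually_elim
      case (elim p)
      hence "0 < (q p - v * (1 / real (l p))) * (real (l p))\<^sup>2"
        using lpos[of p] by (intro mult_pos_pos) auto
      also have "\<dots> = real (m p) - real (R p)"
        using lpos[of p] by (simp add: q_def Rv field_simps power2_eq_square)
      finally show ?case by simp
    qed
    have lim1: "(\<lambda>p. exp (- v\<^sup>2 / (q p + 1 / (real (l p))\<^sup>2 - v * (1 / real (l p))))) \<longlonglongrightarrow> exp (- v\<^sup>2 / (c + 0 - v * 0))"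
      using c by (intro tendsto_intros q_lim l_lim l2_lim) auto
    have lim2: "(\<lambda>p. exp (- v\<^sup>2 / (q p + v * (1 / real (l p))))) \<longlonglongrightarrow> exp (- v\<^sup>2 / (c + v * 0))"
      using c by (intro tendsto_intros q_lim l_lim) auto
    have "(\<lambda>p. b r p) \<longlonglongrightarrow> exp (- v\<^sup>2 / c)"
    proof (rule tendsto_sandwich)
      show "(\<lambda>p. exp (- v\<^sup>2 / (q p + 1 / (real (l p))\<^sup>2 - v * (1 / real (l p))))) \<longlonglongrightarrow> exp (- v\<^sup>2 / c)"
        using lim1 by simp
      show "(\<lambda>p. exp (- v\<^sup>2 / (q p + v * (1 / real (l p))))) \<longlonglongrightarrow> exp (- v\<^sup>2 / c)"
        using lim2 by simp
      show "\<forall>\<^sub>F p in sequentially. exp (- v\<^sup>2 / (q p + 1 / (real (l p))\<^sup>2 - v * (1 / real (l p)))) \<le> b r p"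
        using ev
      proof eventually_elim
        case (elim p)
        have "- (real (R p))\<^sup>2 / real (m p + 1 - R p) = - v\<^sup>2 / (real (m p + 1 - R p) / (real (l p))\<^sup>2)"
          using lpos[of p] by (simp add: Rv power_mult_distrib)
        also have "real (m p + 1 - R p) / (real (l p))\<^sup>2 = q p + 1 / (real (l p))\<^sup>2 - v * (1 / real (l p))"
          using lpos[of p] elim by (simp add: q_def Rv of_nat_diff field_simps power2_eq_square)
        finally have "C p * exp (- v\<^sup>2 / (q p + 1 / (real (l p))\<^sup>2 - v * (1 / real (l p)))) \<le> real ((2 * m p) choose (m p + R p))"
          using central_binomial_ratio_ge[of "R p" "R p" "m p"] elim by (simp add: C_def)
        thus ?case using Cpos[of p] by (simp only: b_def R_def[symmetric]) (simp add: field_simps)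
      qed
      show "\<forall>\<^sub>F p in sequentially. b r p \<le> exp (- v\<^sup>2 / (q p + v * (1 / real (l p))))"
        using ev
      proof eventually_elim
        case (elim p)
        have "- (real (R p))\<^sup>2 / real (m p + R p) = - v\<^sup>2 / (real (m p + R p) / (real (l p))\<^sup>2)"
          using lpos[of p] by (simp add: Rv power_mult_distrib)
        also have "real (m p + R p) / (real (l p))\<^sup>2 = q p + v * (1 / real (l p))"
          using lpos[of p] by (simp add: q_def Rv field_simps power2_eq_square)
        finally have "real ((2 * m p) choose (m p + R p)) \<le> C p * exp (- v\<^sup>2 / (q p + v * (1 / real (l p))))"
          using central_binomial_ratio_le[of "R p" "m p" "R p"] elim by (simp add: C_def)
        thus ?case using Cpos[of p] by (simp only: b_def R_def[symmetric]) (simp add: field_simps)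
      qed
    qed
    thus "(\<lambda>p. b r p) \<longlonglongrightarrow> exp (- pi * (real (Suc r))\<^sup>2 * (1 / (pi * c)))"
      using c by (simp add: v_def)
  next
    have bb: "norm (b r p) \<le> 2 * c * (1 / (real (Suc r))\<^sup>2)" for r p
    proof (cases "l p * Suc r \<le> m p")
      case True
      have mpos: "real (m p) > 0"
        using True lpos[of p] by (cases "m p") auto
      \<comment> \<open>Here \<open>K\<close> is m: the resulting exp(-R^2/(2m)) \<le> 2m/R^2 covers
        all R up to m, not only those far below m.\<close>
      have "real ((2 * m p) choose (m p + l p * Suc r)) \<le> C p * exp (- (real (l p * Suc r))\<^sup>2 / real (m p + m p))"
        unfolding C_def using True by (intro central_binomial_ratio_le) auto
      hence "b r p \<le> exp (- (real (l p * Suc r))\<^sup>2 / real (m p + m p))"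
        using Cpos[of p] by (simp add: b_def field_simps)
      also have "\<dots> = inverse (exp ((real (l p * Suc r))\<^sup>2 / real (m p + m p)))"
        by (simp only: exp_minus[symmetric] minus_divide_left)
      also have "\<dots> \<le> inverse ((real (l p * Suc r))\<^sup>2 / real (m p + m p))"
      proof (rule le_imp_inverse_le)
        show "(real (l p * Suc r))\<^sup>2 / real (m p + m p) \<le> exp ((real (l p * Suc r))\<^sup>2 / real (m p + m p))"
          using exp_ge_add_one_self[of "(real (l p * Suc r))\<^sup>2 / real (m p + m p)"] by linarith
        have "real (l p * Suc r) > 0" unfolding of_nat_mult by (intro mult_pos_pos lpos) auto
        thus "(real (l p * Suc r))\<^sup>2 / real (m p + m p) > 0"
          using mpos by (intro divide_pos_pos zero_less_power) auto
      qed
      also have "\<dots> = 2 * q p * (1 / (real (Suc r))\<^sup>2)"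
        unfolding of_nat_mult power_mult_distrib q_def by (simp add: field_simps del: of_nat_Suc)
      also have "\<dots> \<le> 2 * c * (1 / (real (Suc r))\<^sup>2)"
        using q_le[of p] by (intro mult_right_mono) auto
      finally show ?thesis using Cpos[of p] by (simp add: b_def)
    next
      case False
      hence "b r p = 0" by (simp add: b_def binomial_eq_0)
      thus ?thesis using c by simp
    qed
    show "\<forall>\<^sub>F (r, p) in at_top \<times>\<^sub>F sequentially. norm (b r p) \<le> 2 * c * (1 / (real (Suc r))\<^sup>2)"
      using bb by (intro always_eventually) auto
  qed (rule summable_mult[OF sq], simp)

  \<comment> \<open>The two evaluations of the cosine sum. The factor l C / 4^m is rewritten with l
    = sqrt(2m+1) / sqrt(2q + 1/l^2), so that the central binomial asymptotics apply.\<close>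
  have eq: "1 + 2 * suminf (\<lambda>k. a k p) =
      1 / sqrt (2 * q p + 1 / (real (l p))\<^sup>2) * (sqrt (2 * real (m p) + 1) * C p / 4 ^ m p) * (1 + 2 * suminf (\<lambda>r. b r p))" for p
  proof -
    have sa: "suminf (\<lambda>k. a k p) = (\<Sum>k<p. cos (pi * real (Suc k) / real (l p)) ^ (2 * m p))"
      by (subst suminf_finite[of "{..<p}"]) (auto simp: a_def)
    have "b r p = 0" if "r \<ge> m p" for r
    proof -
      have "Suc r \<le> l p * Suc r" by (simp add: l_def)
      hence "m p < l p * Suc r" using that by linarith
      thus ?thesis by (simp add: b_def binomial_eq_0)
    qed
    hence sb: "suminf (\<lambda>r. b r p) = (\<Sum>r<m p. real ((2 * m p) choose (m p + l p * Suc r))) / C p"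
      by (subst suminf_finite[of "{..<m p}"]) (auto simp: b_def sum_divide_distrib not_less)
    have "4 ^ m p * (1 + 2 * suminf (\<lambda>k. a k p)) = (\<Sum>k<l p. (2 * cos (pi * real k / real (l p))) ^ (2*m p))"
      unfolding sa by (rule sum_cos_power_half[symmetric]) (simp add: l_def)
    also have "\<dots> = real (l p) * (C p + 2 * (\<Sum>r<m p. real ((2 * m p) choose (m p + l p * Suc r))))"
      by (subst sum_cos_power, simp add: l_def, subst sum_binomial_arith) (auto simp: l_def C_def)
    also have "\<dots> = real (l p) * C p * (1 + 2 * suminf (\<lambda>r. b r p))"
      using Cpos[of p] by (simp add: sb field_simps)
    finally have "1 + 2 * suminf (\<lambda>k. a k p) = real (l p) * C p / 4 ^ m p * (1 + 2 * suminf (\<lambda>r. b r p))"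
      by (simp add: field_simps)
    moreover have "1 / sqrt (2 * q p + 1 / (real (l p))\<^sup>2) * sqrt (2 * real (m p) + 1) = real (l p)"
    proof -
      have "2 * q p + 1 / (real (l p))\<^sup>2 = (2 * real (m p) + 1) / (real (l p))\<^sup>2"
        unfolding q_def by (simp only: add_divide_distrib times_divide_eq_right)
      thus ?thesis using lpos[of p] by (simp add: real_sqrt_divide)
    qed
    ultimately show ?thesis by (simp add: mult.assoc[symmetric])
  qed
  have "(\<lambda>p. 1 + 2 * suminf (\<lambda>k. a k p)) \<longlonglongrightarrow> theta (pi * c)"
    using c by (subst theta_eq_suminf, simp) (intro tendsto_intros a_lim)
  moreover have "(\<lambda>p. 1 + 2 * suminf (\<lambda>k. a k p)) \<longlonglongrightarrow> 1 / sqrt (2 * c + 0) * sqrt (2 / pi) * theta (1 / (pi * c))"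
    unfolding eq
  proof (intro tendsto_mult)
    show "(\<lambda>p. 1 / sqrt (2 * q p + 1 / (real (l p))\<^sup>2)) \<longlonglongrightarrow> 1 / sqrt (2 * c + 0)"
      using c by (intro tendsto_intros q_lim l2_lim) auto
    show "(\<lambda>p. sqrt (2 * real (m p) + 1) * C p / 4 ^ m p) \<longlonglongrightarrow> sqrt (2 / pi)"
      unfolding C_def by (rule filterlim_compose[OF central_binomial_asymp m_lim])
    show "(\<lambda>p. 1 + 2 * suminf (\<lambda>r. b r p)) \<longlonglongrightarrow> theta (1 / (pi * c))"
      using c by (subst theta_eq_suminf, simp) (intro tendsto_intros b_lim)
  qed
  ultimately have "theta (pi * c) = 1 / sqrt (2 * c + 0) * sqrt (2 / pi) * theta (1 / (pi * c))"
    using LIMSEQ_unique by blast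
  thus ?thesis using c by (simp add: real_sqrt_mult real_sqrt_divide field_simps)
qed

theorem theta_functional_equation:
  assumes "t > 0"
  shows "theta (1 / t) = sqrt t * theta t"
  using theta_functional_equation_aux[of "t / pi"] assms by (simp add: field_simps)

section \<open>Theta has no zeros in the unit disc\<close>

definition qpoch :: "complex \<Rightarrow> nat \<Rightarrow> complex" where
  "qpoch p n = (\<Prod>k<n. 1 - p ^ Suc k)"

text \<open>Gaussian binomial coefficients, given by the q-Pascal rule instead of a quotient of
  \<open>qpoch\<close> values: nothing is divided, and the next identities hold for every
  \<open>p\<close>.\<close>

fun qbinom :: "complex \<Rightarrow> nat \<Rightarrow> nat \<Rightarrow> complex" where
  "qbinom p n 0 = 1"
| "qbinom p 0 (Suc k) = 0"
| "qbinom p (Suc n) (Suc k) = qbinom p n k + p ^ Suc k * qbinom p n (Suc k)"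

lemma qbinom_eq_0: "n < k \<Longrightarrow> qbinom p n k = 0"
  by (induction p n k rule: qbinom.induct) auto

text \<open>The product formula in cross-multiplied form. The two summands of the q-Pascal rule
  recombine because p^(k+1) p^(n-k) = p^(n+1).\<close>

lemma qbinom_qpoch: "k \<le> n \<Longrightarrow> qbinom p n k * qpoch p k * qpoch p (n - k) = qpoch p n"
proof (induction p n k rule: qbinom.induct)
  case (3 p n k)
  show ?case
  proof (cases "k = n")
    case True
    have "qbinom p n n * qpoch p n = qpoch p n" using 3(1) True by (simp add: qpoch_def)
    thus ?thesis using True by (auto simp: qbinom_eq_0 qpoch_def)
  next
    case False
    with 3 have k: "Suc k \<le> n" by simp
    have e: "n - k = Suc (n - Suc k)" using k by simp
    have "Suc k + (n - k) = Suc n" using k by simp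
    hence pw: "p ^ Suc k * p ^ (n - k) = p ^ Suc n" by (metis power_add)
    have s1: "qpoch p (Suc k) = qpoch p k * (1 - p ^ Suc k)" by (simp add: qpoch_def)
    have s2: "qpoch p (n - k) = qpoch p (n - Suc k) * (1 - p ^ (n - k))"
      unfolding e by (simp add: qpoch_def)
    have "qbinom p (Suc n) (Suc k) * qpoch p (Suc k) * qpoch p (Suc n - Suc k) =
       (qbinom p n k * qpoch p k * qpoch p (n - k)) * (1 - p ^ Suc k) +
       p ^ Suc k * (qbinom p n (Suc k) * qpoch p (Suc k) * qpoch p (n - Suc k)) * (1 - p ^ (n - k))"
      by (simp add: s1 s2 algebra_simps)
    also have "\<dots> = qpoch p n * (1 - p ^ Suc k) + p ^ Suc k * qpoch p n * (1 - p ^ (n - k))"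
      using 3 k by simp
    also have "\<dots> = qpoch p n * (1 - p ^ Suc k * p ^ (n - k))"
      by (simp add: algebra_simps)
    also have "\<dots> = qpoch p (Suc n)" unfolding pw by (simp add: qpoch_def)
    finally show ?thesis .
  qed
qed (auto simp: qpoch_def)

text \<open>The factor k = 0 splits off, and what remains is the same product at z p. Homogeneity in
  \<open>y\<close> and \<open>z\<close> lets \<open>y\<close> be a power of q later, without
  negative exponents.\<close>

lemma qbinomial_theorem:
  "(\<Prod>k<n. y + z * p ^ k) = (\<Sum>k\<le>n. p ^ (k choose 2) * qbinom p n k * z ^ k * y ^ (n - k))"
proof (induction n arbitrary: z)
  case (Suc n)
  let ?t = "\<lambda>n k. p ^ (k choose 2) * qbinom p n k * z ^ k * y ^ (n - k)"
  have "(\<Prod>k<Suc n. y + z * p ^ k) = (y + z) * (\<Prod>k<n. y + (z * p) * p ^ k)"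
    by (subst prod.lessThan_Suc_shift) (simp add: mult_ac)
  also have "\<dots> = (y + z) * (\<Sum>k\<le>n. p ^ (k choose 2) * qbinom p n k * (z * p) ^ k * y ^ (n - k))"
    by (simp only: Suc)
  also have "\<dots> = (\<Sum>k\<le>n. y * (p ^ (k choose 2) * qbinom p n k * (z * p) ^ k * y ^ (n - k))) +
                  (\<Sum>k\<le>n. z * (p ^ (k choose 2) * qbinom p n k * (z * p) ^ k * y ^ (n - k)))"
    by (simp only: distrib_right sum_distrib_left sum.distrib)
  also have "(\<Sum>k\<le>n. y * (p ^ (k choose 2) * qbinom p n k * (z * p) ^ k * y ^ (n - k))) =
     (\<Sum>k\<le>Suc n. p ^ (k choose 2) * p ^ k * qbinom p n k * z ^ k * y ^ (Suc n - k))"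
    by (simp add: qbinom_eq_0) (intro sum.cong, auto simp: Suc_diff_le power_mult_distrib)
  also have "\<dots> = y ^ Suc n + (\<Sum>k\<le>n. p ^ (Suc k choose 2) * p ^ Suc k * qbinom p n (Suc k) * z ^ Suc k * y ^ (n - k))"
    by (subst sum.atMost_Suc_shift) (simp add: numeral_2_eq_2)
  also have "(\<Sum>k\<le>n. z * (p ^ (k choose 2) * qbinom p n k * (z * p) ^ k * y ^ (n - k))) =
     (\<Sum>k\<le>n. p ^ (Suc k choose 2) * qbinom p n k * z ^ Suc k * y ^ (n - k))"
    by (intro sum.cong refl) (simp add: numeral_2_eq_2 power_add power_mult_distrib)
  also have "y ^ Suc n + (\<Sum>k\<le>n. p ^ (Suc k choose 2) * p ^ Suc k * qbinom p n (Suc k) * z ^ Suc k * y ^ (n - k)) +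
      (\<Sum>k\<le>n. p ^ (Suc k choose 2) * qbinom p n k * z ^ Suc k * y ^ (n - k)) =
      y ^ Suc n + (\<Sum>k\<le>n. ?t (Suc n) (Suc k))"
    by (simp add: sum.distrib[symmetric] algebra_simps)
  also have "\<dots> = (\<Sum>k\<le>Suc n. ?t (Suc n) k)"
    by (subst sum.atMost_Suc_shift) (simp add: numeral_2_eq_2)
  finally show ?case .
qed (simp add: numeral_2_eq_2)

text \<open>A finite form of the Jacobi triple product. In the q-binomial theorem with base q^2, y =
  q^(2N-1) and z = 1, the factors with k < N and those with k \<ge> N each give the odd product
  times a power of q. Comparing exponents completes the square and leaves (k-N)^2.\<close>

lemma gauss_finite_identity:
  assumes "q \<noteq> 0"
  shows "(\<Prod>k<N. 1 + q ^ (2*k+1))\<^sup>2 =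
           (\<Sum>k\<le>2*N. q ^ (nat ((int k - int N)\<^sup>2)) * qbinom (q\<^sup>2) (2*N) k)"
proof (cases "N = 0")
  case False
  define A where "A = (\<Prod>k<N. 1 + q ^ (2*k+1))"
  \<comment> \<open>The total exponent N(N-1) + N(2N-1) of the powers of q extracted from the two
    halves.\<close>
  define e where "e = 3*N^2 - 2*N"
  have c2: "2 * (k choose 2) = k * (k - 1)" for k :: nat
  proof -
    have "even (k * (k - 1))" by (cases k) auto
    thus ?thesis by (simp add: choose_two)
  qed
  have NN: "2 * N \<le> 3 * N^2" using False by (simp add: power2_eq_square)
  have "(\<Prod>k<2*N. q ^ (2*N-1) + 1 * (q\<^sup>2) ^ k) = (\<Prod>k<N. q ^ (2*N-1) + (q\<^sup>2) ^ k) * (\<Prod>k=N..<2*N. q ^ (2*N-1) + (q\<^sup>2) ^ k)"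
  proof -
    have "{..<2*N} = {..<N} \<union> {N..<2*N}" by auto
    thus ?thesis by (simp add: prod.union_disjoint ivl_disj_int)
  qed
  also have "(\<Prod>k<N. q ^ (2*N-1) + (q\<^sup>2) ^ k) = (\<Prod>k<N. q ^ (2*k) * (1 + q ^ (2*(N-Suc k)+1)))"
  proof (intro prod.cong refl)
    fix k assume "k \<in> {..<N}"
    hence "2*N - 1 = 2*k + (2*(N-Suc k)+1)" by auto
    hence "q ^ (2*N - 1) = q ^ (2*k) * q ^ (2*(N-Suc k)+1)" by (metis power_add)
    thus "q ^ (2*N-1) + (q\<^sup>2) ^ k = q ^ (2*k) * (1 + q ^ (2*(N-Suc k)+1))"
      unfolding power_mult[symmetric] distrib_left by simp
  qed
  also have "\<dots> = (\<Prod>k<N. q ^ (2*k)) * A"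
    unfolding A_def prod.distrib by (subst (2) prod.nat_diff_reindex[symmetric]) simp
  also have "(\<Prod>k<N. q ^ (2*k)) = q ^ (N * (N - 1))"
  proof -
    have "(\<Prod>k<N. q ^ (2*k)) = q ^ (\<Sum>k<N. 2*k)" by (simp add: power_sum)
    also have "(\<Sum>k<N. 2*k) = N * (N - 1)" by (induction N) (auto simp: algebra_simps)
    finally show ?thesis .
  qed
  also have "(\<Prod>k=N..<2*N. q ^ (2*N-1) + (q\<^sup>2) ^ k) = (\<Prod>k<N. q ^ (2*N-1) * (1 + q ^ (2*k+1)))"
  proof (rule prod.reindex_bij_witness[of _ "\<lambda>k. k + N" "\<lambda>k. k - N"])
    fix k assume "k \<in> {N..<2*N}"
    hence "2 * k = 2*N - 1 + (2*(k-N)+1)" by auto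
    hence "(q\<^sup>2) ^ k = q ^ (2*N - 1) * q ^ (2*(k-N)+1)" by (metis power_add power_mult)
    thus "q ^ (2*N-1) * (1 + q ^ (2*(k-N)+1)) = q ^ (2*N-1) + (q\<^sup>2) ^ k"
      by (simp add: algebra_simps)
  qed auto
  also have "\<dots> = q ^ (N * (2*N-1)) * A"
    unfolding prod.distrib A_def by (simp add: power_mult[symmetric] mult.commute)
  finally have "(\<Prod>k<2*N. q ^ (2*N-1) + 1 * (q\<^sup>2) ^ k) = q ^ (N*(N-1) + N*(2*N-1)) * A\<^sup>2"
    by (simp add: power_add power2_eq_square)
  also have "N*(N-1) + N*(2*N-1) = e"
    unfolding e_def by (simp add: power2_eq_square algebra_simps)
  finally have "q ^ e * A\<^sup>2 = (\<Sum>k\<le>2*N. (q\<^sup>2) ^ (k choose 2) * qbinom (q\<^sup>2) (2*N) k * 1 ^ k * (q ^ (2*N-1)) ^ (2*N - k))"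
    using qbinomial_theorem[of "q ^ (2*N-1)" 1 "q\<^sup>2" "2*N"] by simp
  also have "\<dots> = (\<Sum>k\<le>2*N. q ^ e * (q ^ (nat ((int k - int N)\<^sup>2)) * qbinom (q\<^sup>2) (2*N) k))"
  proof (intro sum.cong refl)
    fix k assume "k \<in> {..2*N}"
    hence k: "k \<le> 2*N" by simp
    have i1: "int (k * (k - 1)) = int k * (int k - 1)" by (cases k) (auto simp: algebra_simps)
    have i2: "int (2*N-1) = 2 * int N - 1" using False by (simp add: of_nat_diff)
    have i3: "int (2*N-k) = 2 * int N - int k" using k by (simp add: of_nat_diff)
    have i4: "int e = 3 * (int N)\<^sup>2 - 2 * int N" unfolding e_def using NN by (simp add: of_nat_diff)
    have i5: "int (nat ((int k - int N)\<^sup>2)) = (int k - int N)\<^sup>2" by simp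
    have "int (2 * (k choose 2) + (2*N-1) * (2*N-k)) = int (e + nat ((int k - int N)\<^sup>2))"
      unfolding c2 of_nat_add of_nat_mult i1[unfolded of_nat_mult] i2 i3 i4 i5
      by (simp add: power2_eq_square algebra_simps)
    hence "2 * (k choose 2) + (2*N-1) * (2*N-k) = e + nat ((int k - int N)\<^sup>2)" by linarith
    hence "(q\<^sup>2) ^ (k choose 2) * (q ^ (2*N-1)) ^ (2*N - k) = q ^ e * q ^ (nat ((int k - int N)\<^sup>2))"
      by (metis power_add power_mult)
    thus "(q\<^sup>2) ^ (k choose 2) * qbinom (q\<^sup>2) (2*N) k * 1 ^ k * (q ^ (2*N-1)) ^ (2*N - k) =
       q ^ e * (q ^ (nat ((int k - int N)\<^sup>2)) * qbinom (q\<^sup>2) (2*N) k)"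
      by (simp add: mult_ac)
  qed
  finally show ?thesis
    using assms by (simp add: sum_distrib_left[symmetric] A_def)
qed simp

lemma qpoch_nonzero:
  assumes "norm p < 1"
  shows "qpoch p n \<noteq> 0"
proof -
  have "p ^ Suc k \<noteq> 1" for k
  proof
    assume "p ^ Suc k = 1"
    hence "norm p ^ Suc k = 1" by (metis norm_one norm_power)
    moreover have "norm p ^ Suc k \<le> norm p ^ 1" using assms by (intro power_decreasing) auto
    ultimately show False using assms by simp
  qed
  thus ?thesis by (auto simp: qpoch_def)
qed

text \<open>The Gaussian coefficients are symmetric about the centre k = N; recentring there gives
  the shape of the theta series.\<close>

lemma gauss_finite_identity':
  assumes "q \<noteq> 0" "norm q < 1"
  shows "(\<Prod>k<N. 1 + q ^ (2*k+1))\<^sup>2 =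
           qbinom (q\<^sup>2) (2*N) N + 2 * (\<Sum>j<N. q ^ ((Suc j)\<^sup>2) * qbinom (q\<^sup>2) (2*N) (N + Suc j))"
proof -
  let ?p = "q\<^sup>2" and ?t = "\<lambda>k. q ^ (nat ((int k - int N)\<^sup>2)) * qbinom (q\<^sup>2) (2*N) k"
  have p: "norm ?p < 1" using assms by (simp add: norm_power power_less_one_iff)
  have sym: "qbinom ?p (2*N) (N - Suc j) = qbinom ?p (2*N) (N + Suc j)" if "j < N" for j
  proof -
    have a: "2*N - (N - Suc j) = N + Suc j" "2*N - (N + Suc j) = N - Suc j" using that by auto
    have "qbinom ?p (2*N) (N - Suc j) * qpoch ?p (N - Suc j) * qpoch ?p (N + Suc j) = qpoch ?p (2*N)"
      using qbinom_qpoch[of "N - Suc j" "2*N" ?p] unfolding a by simp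
    moreover have "qbinom ?p (2*N) (N + Suc j) * qpoch ?p (N + Suc j) * qpoch ?p (N - Suc j) = qpoch ?p (2*N)"
      using qbinom_qpoch[of "N + Suc j" "2*N" ?p] that unfolding a by simp
    ultimately have "(qbinom ?p (2*N) (N - Suc j) - qbinom ?p (2*N) (N + Suc j)) * (qpoch ?p (N - Suc j) * qpoch ?p (N + Suc j)) = 0"
      by (simp add: algebra_simps)
    thus ?thesis using qpoch_nonzero[OF p] by simp
  qed
  have "{..2*N} = {..<N} \<union> ({N} \<union> {N<..2*N})" by auto
  hence "sum ?t {..2*N} = sum ?t ({..<N} \<union> ({N} \<union> {N<..2*N}))" by simp
  also have "\<dots> = sum ?t {..<N} + (?t N + sum ?t {N<..2*N})"
    by (subst sum.union_disjoint) auto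
  also have "sum ?t {..<N} = (\<Sum>j<N. q ^ ((Suc j)\<^sup>2) * qbinom ?p (2*N) (N + Suc j))"
  proof (rule sum.reindex_bij_witness[of _ "\<lambda>j. N - Suc j" "\<lambda>k. N - Suc k"])
    fix k assume k: "k \<in> {..<N}"
    have e: "int k - int N = - int (Suc (N - Suc k))" using k by (simp add: of_nat_diff)
    have "(int k - int N)\<^sup>2 = int ((Suc (N - Suc k))\<^sup>2)"
      unfolding e of_nat_power by (rule power2_minus)
    hence "nat ((int k - int N)\<^sup>2) = (Suc (N - Suc k))\<^sup>2" by (metis nat_int)
    moreover have "N - Suc (N - Suc k) = k" using k by auto
    ultimately show "q ^ ((Suc (N - Suc k))\<^sup>2) * qbinom ?p (2*N) (N + Suc (N - Suc k)) = ?t k"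
      using sym[of "N - Suc k"] k by simp
  qed auto
  also have "sum ?t {N<..2*N} = (\<Sum>j<N. q ^ ((Suc j)\<^sup>2) * qbinom ?p (2*N) (N + Suc j))"
  proof (rule sum.reindex_bij_witness[of _ "\<lambda>j. N + Suc j" "\<lambda>k. k - Suc N"])
    fix k assume k: "k \<in> {N<..2*N}"
    have e: "int k - int N = int (Suc (k - Suc N))" using k by (simp add: of_nat_diff)
    have "(int k - int N)\<^sup>2 = int ((Suc (k - Suc N))\<^sup>2)"
      unfolding e of_nat_power by (rule refl)
    hence "nat ((int k - int N)\<^sup>2) = (Suc (k - Suc N))\<^sup>2" by (metis nat_int)
    moreover have "N + Suc (k - Suc N) = k" using k by auto
    ultimately show "q ^ ((Suc (k - Suc N))\<^sup>2) * qbinom ?p (2*N) (N + Suc (k - Suc N)) = ?t k"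
      by simp
  qed auto
  finally show ?thesis
    using gauss_finite_identity[OF assms(1)] by (simp add: algebra_simps)
qed

(* Theta as a function of the nome: theta t = jtheta (exp (- pi t)). *)
definition jtheta :: "complex \<Rightarrow> complex" where
  "jtheta q = 1 + 2 * (\<Sum>k. q ^ ((Suc k)\<^sup>2))"

lemma power_square_summable:
  assumes "norm (q :: complex) < 1"
  shows "summable (\<lambda>k. norm (q ^ ((Suc k)\<^sup>2)))"
proof (rule summable_comparison_test')
  show "summable (\<lambda>k. norm q ^ k)" using assms by simp
  fix k :: nat
  have "k \<le> (Suc k)\<^sup>2" by (simp add: power2_eq_square)
  thus "norm (norm (q ^ ((Suc k)\<^sup>2))) \<le> norm q ^ k"
    using assms by (simp add: norm_power power_decreasing)
qed

lemma qpoch_tendsto: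
  assumes "norm p < 1"
  obtains P where "P \<noteq> 0" "qpoch p \<longlonglongrightarrow> P"
proof -
  let ?f = "\<lambda>k. 1 - p ^ Suc k"
  have "summable (\<lambda>k. norm (?f k - 1))"
    using assms by (simp add: norm_mult norm_power summable_mult)
  hence c: "convergent_prod ?f"
    by (intro abs_convergent_prod_imp_convergent_prod summable_imp_abs_convergent_prod)
  have "?f k \<noteq> 0" for k using qpoch_nonzero[OF assms, of "Suc k"] by (simp add: qpoch_def)
  hence "prodinf ?f \<noteq> 0" by (intro prodinf_nonzero c)
  moreover have "qpoch p \<longlonglongrightarrow> prodinf ?f"
    unfolding qpoch_def by (intro has_prod_imp_tendsto' convergent_prod_has_prod c)
  ultimately show ?thesis using that by blast
qed

text \<open>As N grows, the Gaussian coefficients near the centre tend to 1/P, where P is the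
  infinite product of 1 - q^(2k) over k \<ge> 1. The finite identity becomes jtheta q / P = Q^2 with
  Q the product of 1 + q^(2k+1), and Q is not 0 because the product converges absolutely and has no
  zero factor.\<close>

lemma jtheta_nonzero:
  assumes "norm q < 1"
  shows "jtheta q \<noteq> 0"
proof (cases "q = 0")
  case True thus ?thesis by (simp add: jtheta_def zero_power)
next
  case False
  define p where "p = q\<^sup>2"
  have p: "norm p < 1" using assms by (simp add: p_def norm_power power_less_one_iff)
  obtain P where P: "P \<noteq> 0" "qpoch p \<longlonglongrightarrow> P" using qpoch_tendsto[OF p] .
  have Qlim: "\<exists>Q. Q \<noteq> 0 \<and> (\<lambda>N. \<Prod>k<N. 1 + q ^ (2*k+1)) \<longlonglongrightarrow> Q"
  proof -
    let ?f = "\<lambda>k. 1 + q ^ (2*k+1)"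
    have "summable (\<lambda>k. norm (?f k - 1))"
      using p by (simp add: norm_mult norm_power summable_mult p_def power_mult)
    hence c: "convergent_prod ?f"
      by (intro abs_convergent_prod_imp_convergent_prod summable_imp_abs_convergent_prod)
    have "?f k \<noteq> 0" for k
    proof
      assume "?f k = 0"
      hence "norm (q ^ (2*k+1)) = 1" by (metis add_eq_0_iff norm_minus_cancel norm_one)
      moreover have "norm q ^ (Suc (2*k)) \<le> norm q ^ 1" using assms by (intro power_decreasing) auto
      ultimately show False using assms by (simp add: norm_mult norm_power)
    qed
    hence "prodinf ?f \<noteq> 0" by (intro prodinf_nonzero c)
    moreover have "(\<lambda>N. \<Prod>k<N. 1 + q ^ (2*k+1)) \<longlonglongrightarrow> prodinf ?f"
      by (intro has_prod_imp_tendsto' convergent_prod_has_prod c)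
    ultimately show ?thesis by blast
  qed
  then obtain Q where Q: "Q \<noteq> 0" "(\<lambda>N. \<Prod>k<N. 1 + q ^ (2*k+1)) \<longlonglongrightarrow> Q" by blast
  have qb: "qbinom p (2*N) (N + j) = qpoch p (2*N) / (qpoch p (N + j) * qpoch p (N - j))" if "j \<le> N" for N j
    using qbinom_qpoch[of "N+j" "2*N" p] that qpoch_nonzero[OF p] by (simp add: field_simps)
  have lim: "(\<lambda>N. qbinom p (2*N) (N + j)) \<longlonglongrightarrow> P / (P * P)" for j
  proof (rule Lim_transform_eventually)
    have "filterlim (\<lambda>N::nat. 2 * N) at_top sequentially"
      "filterlim (\<lambda>N::nat. N + j) at_top sequentially" "filterlim (\<lambda>N::nat. N - j) at_top sequentially"
      by (auto simp: filterlim_at_top eventually_at_top_linorder intro: exI[of _ "_ + j"])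
         (metis le_add_diff_inverse2 le_diff_conv2 add_leD2 add.commute le_trans nat_le_iff_add trans_le_add1 mult_2)+
    thus "(\<lambda>N. qpoch p (2*N) / (qpoch p (N + j) * qpoch p (N - j))) \<longlonglongrightarrow> P / (P * P)"
      using P(1) by (intro tendsto_intros filterlim_compose[OF P(2)]) auto
    show "\<forall>\<^sub>F N in sequentially. qpoch p (2*N) / (qpoch p (N + j) * qpoch p (N - j)) = qbinom p (2*N) (N + j)"
      using eventually_ge_at_top[of j] by eventually_elim (simp add: qb)
  qed
  obtain B where B: "norm (qpoch p n) \<le> B" "B > 0" for n
    using P(2) by (meson Bseq_def convergentI convergent_imp_Bseq)
  have "(\<lambda>n. inverse (qpoch p n)) \<longlonglongrightarrow> inverse P" by (intro tendsto_inverse P)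
  then obtain B' where B': "norm (inverse (qpoch p n)) \<le> B'" "B' > 0" for n
    by (meson Bseq_def convergentI convergent_imp_Bseq)
  \<comment> \<open>Extended by 0 beyond j < N, so that the finite sums become series over a fixed
    index set; boundedness of \<open>qpoch\<close> and of its reciprocal gives a majorant
    independent of N.\<close>
  define a where "a j N = (if j < N then q ^ ((Suc j)\<^sup>2) * qbinom p (2*N) (N + Suc j) else 0)" for j N
  have bound: "norm (a j N) \<le> (B * B' * B') * norm (q ^ ((Suc j)\<^sup>2))" for j N
  proof (cases "j < N")
    case True
    hence "norm (qbinom p (2*N) (N + Suc j)) = norm (qpoch p (2*N)) * norm (inverse (qpoch p (N + Suc j))) * norm (inverse (qpoch p (N - Suc j)))"
      by (subst qb) (auto simp: norm_divide norm_mult norm_inverse field_simps)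
    also have "\<dots> \<le> B * B' * B'"
      using B B' less_imp_le[OF B(2)] less_imp_le[OF B'(2)]
      by (intro mult_mono mult_nonneg_nonneg) auto
    finally have "norm (q ^ ((Suc j)\<^sup>2)) * norm (qbinom p (2*N) (N + Suc j)) \<le> norm (q ^ ((Suc j)\<^sup>2)) * (B * B' * B')"
      by (intro mult_left_mono) auto
    thus ?thesis using True by (simp add: a_def norm_mult mult.commute)
  qed (use B(2) B'(2) in \<open>auto simp: a_def intro!: mult_nonneg_nonneg less_imp_le\<close>)
  have alim: "(\<lambda>N. suminf (\<lambda>j. a j N)) \<longlonglongrightarrow> (\<Sum>j. q ^ ((Suc j)\<^sup>2) * (P / (P * P)))"
  proof (rule conjunct2[OF conjunct2[OF tannerys_theorem]])
    show "(\<lambda>N. a j N) \<longlonglongrightarrow> q ^ ((Suc j)\<^sup>2) * (P / (P * P))" for j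
    proof (rule Lim_transform_eventually)
      show "(\<lambda>N. q ^ ((Suc j)\<^sup>2) * qbinom p (2*N) (N + Suc j)) \<longlonglongrightarrow> q ^ ((Suc j)\<^sup>2) * (P / (P * P))"
        by (intro tendsto_intros lim)
      show "\<forall>\<^sub>F N in sequentially. q ^ ((Suc j)\<^sup>2) * qbinom p (2*N) (N + Suc j) = a j N"
        using eventually_gt_at_top[of j] by eventually_elim (simp add: a_def)
    qed
    show "\<forall>\<^sub>F (j, N) in at_top \<times>\<^sub>F sequentially. norm (a j N) \<le> (B * B' * B') * norm (q ^ ((Suc j)\<^sup>2))"
      using bound by (intro always_eventually) auto
  qed (rule summable_mult[OF power_square_summable[OF assms]], simp)
  have "(\<lambda>N. qbinom p (2*N) (N + 0) + 2 * suminf (\<lambda>j. a j N)) \<longlonglongrightarrow>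
          P / (P * P) + 2 * (\<Sum>j. q ^ ((Suc j)\<^sup>2) * (P / (P * P)))"
    by (intro tendsto_intros alim lim)
  also have "(\<lambda>N. qbinom p (2*N) (N + 0) + 2 * suminf (\<lambda>j. a j N)) = (\<lambda>N. (\<Prod>k<N. 1 + q ^ (2*k+1))\<^sup>2)"
  proof
    fix N
    have "suminf (\<lambda>j. a j N) = (\<Sum>j<N. q ^ ((Suc j)\<^sup>2) * qbinom p (2*N) (N + Suc j))"
      by (subst suminf_finite[of "{..<N}"]) (auto simp: a_def)
    thus "qbinom p (2*N) (N + 0) + 2 * suminf (\<lambda>j. a j N) = (\<Prod>k<N. 1 + q ^ (2*k+1))\<^sup>2"
      unfolding gauss_finite_identity'[OF False assms] p_def by simp
  qed
  finally have "P / (P * P) + 2 * (\<Sum>j. q ^ ((Suc j)\<^sup>2) * (P / (P * P))) = Q\<^sup>2"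
    using tendsto_power[OF Q(2), of 2] LIMSEQ_unique by blast
  moreover have "(\<Sum>j. q ^ ((Suc j)\<^sup>2) * (P / (P * P))) = (\<Sum>j. q ^ ((Suc j)\<^sup>2)) * (P / (P * P))"
    by (rule suminf_mult2[symmetric, OF summable_norm_cancel[OF power_square_summable[OF assms]]])
  ultimately have "P / (P * P) * jtheta q = Q\<^sup>2" by (simp add: jtheta_def algebra_simps)
  thus ?thesis using Q(1) by auto
qed

section \<open>Power series of powers of theta\<close>

lemma jtheta_power_series:
  assumes "norm q < 1"
  shows "(\<lambda>n. (if n = 0 then 1 else if n \<in> range (\<lambda>k. (Suc k)\<^sup>2) then 2 else 0) * (q - 0) ^ n) sums jtheta q"
proof -
  let ?c = "\<lambda>n::nat. (if n \<in> range (\<lambda>k. (Suc k)\<^sup>2) then 2 * q ^ n else 0)"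
  have "(\<lambda>k. q ^ ((Suc k)\<^sup>2)) sums (\<Sum>k. q ^ ((Suc k)\<^sup>2))"
    by (intro summable_sums summable_norm_cancel[OF power_square_summable[OF assms]])
  hence "(\<lambda>k. 2 * q ^ ((Suc k)\<^sup>2)) sums (2 * (\<Sum>k. q ^ ((Suc k)\<^sup>2)))" by (rule sums_mult)
  hence "(\<lambda>k. ?c ((Suc k)\<^sup>2)) sums (2 * (\<Sum>k. q ^ ((Suc k)\<^sup>2)))" by simp
  moreover have "strict_mono (\<lambda>k. (Suc k)\<^sup>2)"
    by (intro strict_monoI power_strict_mono) auto
  ultimately have "?c sums (2 * (\<Sum>k. q ^ ((Suc k)\<^sup>2)))"
    by (subst (asm) sums_mono_reindex) auto
  moreover have "(\<lambda>n. if n = 0 then 1 else 0) sums (1::complex)"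
    using sums_single[of 0 "\<lambda>_. 1::complex"] by simp
  ultimately have "(\<lambda>n. (if n = 0 then 1 else 0) + ?c n) sums jtheta q"
    unfolding jtheta_def by (intro sums_add)
  also have "(\<lambda>n. (if n = 0 then 1 else 0) + ?c n) =
     (\<lambda>n. (if n = 0 then 1 else if n \<in> range (\<lambda>k. (Suc k)\<^sup>2) then 2 else 0) * (q - 0) ^ n)"
    by (auto simp: fun_eq_iff)
  finally show ?thesis .
qed

lemma jtheta_holomorphic: "jtheta holomorphic_on ball 0 1"
  by (rule power_series_holomorphic, rule jtheta_power_series) auto

text \<open>This becomes the coefficient 2 of q in (theta^u - 1)/u: the leading coefficient of the
  Dirichlet series does not depend on u.\<close>

lemma deriv_jtheta_0: "deriv jtheta 0 = 2"
proof -
  let ?c = "\<lambda>n::nat. (if n = 0 then 1 else if n \<in> range (\<lambda>k. (Suc k)\<^sup>2) then 2 else 0) :: complex"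
  have "(jtheta has_field_derivative (\<Sum>n. diffs ?c n * 0 ^ n)) (at 0)"
  proof -
    have "((\<lambda>q. \<Sum>n. ?c n * q ^ n) has_field_derivative (\<Sum>n. diffs ?c n * 0 ^ n)) (at 0)"
    proof (rule termdiffs_strong')
      show "summable (\<lambda>n. ?c n * q ^ n)" if "norm q < 1" for q
        using jtheta_power_series[OF that] by (auto simp: sums_iff)
    qed auto
    moreover have "eventually (\<lambda>q. q \<in> ball 0 1) (nhds (0::complex))"
      by (intro eventually_nhds_in_open) auto
    hence "eventually (\<lambda>q. (\<Sum>n. ?c n * q ^ n) = jtheta q) (nhds 0)"
      by eventually_elim (use jtheta_power_series in \<open>auto simp: sums_iff\<close>)
    ultimately show ?thesis by (subst (asm) DERIV_cong_ev[OF refl _ refl]) auto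
  qed
  moreover have "(\<Sum>n. diffs ?c n * 0 ^ n) = diffs ?c 0" by (rule powser_zero)
  moreover have "Suc 0 \<in> range (\<lambda>k. (Suc k)\<^sup>2)" by (rule image_eqI[of _ _ 0]) auto
  hence "diffs ?c 0 = 2" by (simp add: diffs_def)
  ultimately show ?thesis by (simp add: DERIV_imp_deriv)
qed

section \<open>Size of theta and of its logarithm inside the unit disc\<close>

lemma jtheta_norm_less:
  assumes "norm q \<le> r" "r < 1"
  shows "norm (jtheta q) < 2 / (1 - r)"
proof -
  have r: "0 \<le> r" using assms(1) norm_ge_zero order_trans by blast
  have s: "summable (\<lambda>k. norm (q ^ ((Suc k)\<^sup>2)))" using assms by (intro power_square_summable) auto
  have g: "summable (\<lambda>k. r ^ Suc k)" using assms r by (simp add: summable_mult)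
  have "norm (\<Sum>k. q ^ ((Suc k)\<^sup>2)) \<le> (\<Sum>k. norm (q ^ ((Suc k)\<^sup>2)))" by (rule summable_norm[OF s])
  also have "\<dots> \<le> (\<Sum>k. r ^ Suc k)"
  proof (rule suminf_le[OF _ s g])
    fix k
    have "norm q ^ ((Suc k)\<^sup>2) \<le> r ^ ((Suc k)\<^sup>2)" using assms by (intro power_mono) auto
    also have "\<dots> \<le> r ^ Suc k" using assms r by (intro power_decreasing) (auto simp: power2_eq_square)
    finally show "norm (q ^ ((Suc k)\<^sup>2)) \<le> r ^ Suc k" by (simp add: norm_power)
  qed
  also have "\<dots> = r / (1 - r)" using suminf_mult[of "\<lambda>k. r ^ k" r] suminf_geometric[of r] assms r by simp
  finally have "norm (\<Sum>k. q ^ ((Suc k)\<^sup>2)) \<le> r / (1 - r)" .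
  hence "norm (jtheta q) \<le> 1 + 2 * (r / (1 - r))"
    unfolding jtheta_def by (intro norm_triangle_le) (simp add: norm_mult)
  also have "\<dots> = (1 + r) / (1 - r)" using assms by (simp add: field_simps)
  also have "\<dots> < 2 / (1 - r)" using assms by (intro divide_strict_right_mono) auto
  finally show ?thesis .
qed

text \<open>The map v / (2M - v) sends the half plane Re v < M into the unit disc and fixes 0, so
  Schwarz's lemma applies to its composition with \<open>f\<close>, rescaled to the unit
  disc.\<close>

lemma Borel_Caratheodory:
  assumes holo: "f holomorphic_on ball 0 R" and f0: "f 0 = 0"
    and Re: "\<And>z. norm z < R \<Longrightarrow> Re (f z) < M" and w: "norm w < R"
  shows "norm (f w) \<le> 2 * norm w * M / (R - norm w)"
proof -
  have R: "R > 0" using w norm_ge_zero le_less_trans by blast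
  have M: "M > 0" using Re[of 0] f0 R by simp
  define g where "g z = f (of_real R * z) / (2 * of_real M - f (of_real R * z))" for z
  have in_ball: "norm (of_real R * z) < R" if "norm z < 1" for z :: complex
    using that R by (simp add: norm_mult)
  have lt: "norm (f z) < norm (2 * of_real M - f z)" if "norm z < R" for z
  proof -
    have "(norm (2 * of_real M - f z))\<^sup>2 - (norm (f z))\<^sup>2 = 4 * M * (M - Re (f z))"
      unfolding cmod_power2 by (simp add: power2_eq_square algebra_simps)
    also have "\<dots> > 0" using M Re[OF that] by simp
    finally show ?thesis using power2_less_imp_less[OF _ norm_ge_zero] by simp
  qed
  have g: "norm (g (w / of_real R)) \<le> norm (w / of_real R)"
  proof (rule Schwarz_Lemma(1))
    show "g holomorphic_on ball 0 1"
      unfolding g_def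
    proof (intro holomorphic_intros)
      have "(f \<circ> (\<lambda>z. of_real R * z)) holomorphic_on ball 0 1"
        by (rule holomorphic_on_compose_gen[OF _ holo]) (auto intro!: holomorphic_intros simp: in_ball)
      thus "(\<lambda>z. f (of_real R * z)) holomorphic_on ball 0 1" "(\<lambda>z. f (of_real R * z)) holomorphic_on ball 0 1"
        by (simp_all add: o_def)
      show "2 * of_real M - f (of_real R * z) \<noteq> 0" if "z \<in> ball 0 1" for z
        using lt[OF in_ball[of z]] that by (auto simp: norm_minus_commute)
    qed
    show "norm (g z) < 1" if "norm z < 1" for z
      using lt[OF in_ball[OF that]] le_less_trans[OF norm_ge_zero lt[OF in_ball[OF that]]]
      by (simp add: g_def norm_divide)
    show "norm (w / of_real R) < 1" using w R by (simp add: norm_divide)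
  qed (simp add: g_def f0)
  have p: "norm (2 * of_real M - f w) > 0" using le_less_trans[OF norm_ge_zero lt[OF w]] .
  have "norm (f w) / norm (2 * of_real M - f w) \<le> norm w / R"
    using g R by (simp add: g_def norm_divide)
  hence "R * norm (f w) \<le> norm w * norm (2 * of_real M - f w)"
    using p R by (simp add: field_simps)
  also have "\<dots> \<le> norm w * (2 * M + norm (f w))"
    using M norm_triangle_ineq4[of "2 * complex_of_real M" "f w"] by (intro mult_left_mono) (auto simp: norm_mult)
  finally have "(R - norm w) * norm (f w) \<le> 2 * norm w * M" by (simp add: algebra_simps)
  thus ?thesis using w by (simp add: field_simps)
qed

text \<open>Mean value inequality along the segment from 0 to z. The factor \<open>norm z\<close> is
  the point: with z = u L it cancels the division by u.\<close>

lemma norm_exp_minus_1_le: "norm (exp z - 1) \<le> norm z * max 1 (exp (Re z))" for z :: complex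
proof -
  have "norm (exp z - exp 0) \<le> max 1 (exp (Re z)) * norm (z - 0)"
  proof (rule field_differentiable_bound[of "closed_segment 0 z" exp exp])
    fix x assume "x \<in> closed_segment 0 z"
    then obtain t where t: "0 \<le> t" "t \<le> 1" "x = of_real t * z"
      by (auto simp: in_segment scaleR_conv_of_real)
    have "t * Re z \<le> max 0 (Re z)"
      using t mult_left_le_one_le[of "Re z" t] mult_nonneg_nonpos[of t "Re z"]
      by (cases "Re z \<ge> 0") (auto simp: max_def mult.commute)
    hence "exp (t * Re z) \<le> exp (max 0 (Re z))" by simp
    also have "\<dots> = max 1 (exp (Re z))" by (simp add: max_def)
    finally show "norm (exp x) \<le> max 1 (exp (Re z))" using t by simp
  qed (auto intro: DERIV_subset DERIV_exp)
  thus ?thesis by (simp add: mult.commute)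
qed

text \<open>A branch of log theta as a function of the nome. That it is real on [0,1) identifies
  exp(u L) there with the real power theta^u also when u is not an integer. The reason: on [0,1) its
  imaginary part is continuous, has values in 2 pi Z and vanishes at 0.\<close>

lemma jtheta_log:
  obtains L where "L holomorphic_on ball 0 1" "\<And>q. norm q < 1 \<Longrightarrow> exp (L q) = jtheta q" "L 0 = 0"
    "\<And>r. 0 \<le> r \<Longrightarrow> r < 1 \<Longrightarrow> L (of_real r) = of_real (ln (1 + 2 * (\<Sum>k. r ^ ((Suc k)\<^sup>2))))"
proof -
  have jt: "jtheta holomorphic_on ball 0 1" "\<And>q. q \<in> ball 0 1 \<Longrightarrow> jtheta q \<noteq> 0"
    using jtheta_holomorphic jtheta_nonzero by auto
  obtain g where g: "g holomorphic_on ball 0 1" "\<And>q. q \<in> ball 0 1 \<Longrightarrow> exp (g q) = jtheta q"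
    using holomorphic_logarithm_exists[OF convex_ball open_ball jt, of 0] by auto
  define L where "L q = g q - g 0" for q
  have j0: "jtheta 0 = 1" by (simp add: jtheta_def zero_power)
  have L: "L holomorphic_on ball 0 1" unfolding L_def by (intro holomorphic_intros g)
  have eL: "exp (L q) = jtheta q" if "norm q < 1" for q
    using g(2)[of q] g(2)[of 0] that j0 by (simp add: L_def exp_diff)
  define v where "v r = 1 + 2 * (\<Sum>k. r ^ ((Suc k)\<^sup>2))" for r :: real
  have jv: "jtheta (of_real r) = of_real (v r)" if "0 \<le> r" "r < 1" for r
  proof -
    have "summable (\<lambda>k. norm (complex_of_real r ^ ((Suc k)\<^sup>2)))"
      using that by (intro power_square_summable) auto
    hence "summable (\<lambda>k. r ^ ((Suc k)\<^sup>2))" using that by (simp add: norm_power)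
    hence "(\<lambda>k. r ^ ((Suc k)\<^sup>2)) sums (\<Sum>k. r ^ ((Suc k)\<^sup>2))" by (rule summable_sums)
    hence "(\<lambda>k. complex_of_real (r ^ ((Suc k)\<^sup>2))) sums of_real (\<Sum>k. r ^ ((Suc k)\<^sup>2))" by (rule sums_of_real)
    thus ?thesis by (simp add: jtheta_def v_def sums_iff)
  qed
  have vpos: "v r > 0" if "0 \<le> r" "r < 1" for r
  proof -
    have "summable (\<lambda>k. norm (complex_of_real r ^ ((Suc k)\<^sup>2)))"
      using that by (intro power_square_summable) auto
    hence "summable (\<lambda>k. r ^ ((Suc k)\<^sup>2))" using that by (simp add: norm_power)
    hence "(\<Sum>k. r ^ ((Suc k)\<^sup>2)) \<ge> 0" using that by (intro suminf_nonneg) auto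
    thus ?thesis by (simp add: v_def)
  qed
  have Im0: "Im (L (of_real r)) = 0" if r: "0 \<le> r" "r < 1" for r
  proof -
    have int: "\<exists>n::int. Im (L (of_real x)) = 2 * pi * of_int n" if "0 \<le> x" "x < 1" for x
    proof -
      have "exp (L (of_real x)) = exp (of_real (ln (v x)))"
        using eL[of "of_real x"] jv[OF that] vpos[OF that] that by (simp add: exp_of_real)
      then obtain n :: int where "L (of_real x) = of_real (ln (v x)) + (of_int (2 * n) * pi) * \<i>"
        unfolding exp_eq by blast
      hence "Im (L (of_real x)) = 2 * pi * of_int n" by simp
      thus ?thesis by blast
    qed
    have cont: "continuous_on {0..r} (\<lambda>x. Im (L (of_real x)))"
      by (intro continuous_intros continuous_on_compose2[OF holomorphic_on_imp_continuous_on[OF L]])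
         (use r in auto)
    show ?thesis
    proof (rule ccontr)
      assume nz: "Im (L (of_real r)) \<noteq> 0"
      obtain n :: int where n: "Im (L (of_real r)) = 2 * pi * of_int n" using int r by blast
      have n0: "n \<noteq> 0" using n nz by auto
      have L0: "Im (L (of_real 0)) = 0" by (simp add: L_def)
      \<comment> \<open>A non-zero value 2 pi n forces, by continuity, the intermediate value pi or
        -pi, which is no multiple of 2 pi.\<close>
      have "\<exists>x. 0 \<le> x \<and> x \<le> r \<and> Im (L (of_real x)) = pi * of_int (sgn n)"
      proof (cases "n > 0")
        case True
        hence "pi * 1 \<le> pi * (2 * of_int n)" by (intro mult_left_mono) auto
        thus ?thesis using True n L0 r cont
          by (intro IVT') (auto simp: mult_ac)
      next
        case False
        hence "pi * (2 * of_int n) \<le> pi * (-1)" using n0 by (intro mult_left_mono) auto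
        thus ?thesis using False n n0 L0 r cont
          by (intro IVT2') (auto simp: mult_ac)
      qed
      then obtain x where x: "0 \<le> x" "x \<le> r" "Im (L (of_real x)) = pi * of_int (sgn n)" by blast
      then obtain m :: int where "pi * of_int (sgn n) = 2 * pi * of_int m" using int[of x] r by auto
      hence "(of_int (sgn n) :: real) = of_int (2 * m)" by simp
      hence "sgn n = 2 * m" by linarith
      thus False using n0 by (auto simp: sgn_if split: if_splits) presburger+
    qed
  qed
  have "L (of_real r) = of_real (ln (v r))" if r: "0 \<le> r" "r < 1" for r
  proof -
    have e: "L (of_real r) = of_real (Re (L (of_real r)))" using Im0[OF r] by (simp add: complex_eq_iff)
    hence "complex_of_real (exp (Re (L (of_real r)))) = of_real (v r)"
      using eL[of "of_real r"] jv[OF r] r by (metis abs_of_nonneg exp_of_real norm_of_real)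
    hence "exp (Re (L (of_real r))) = v r" by (simp only: of_real_eq_iff)
    hence "Re (L (of_real r)) = ln (v r)" by (metis ln_exp)
    thus ?thesis using e by simp
  qed
  thus ?thesis using that[OF L eL] by (simp add: L_def v_def)
qed

text \<open>Cauchy's inequality for (theta^u - 1)/u on the circle of radius 1 - 1/n. There theta is
  at most 2n in modulus, log theta at most 16 n^2, and the loss (1 - 1/n)^(-n) is at most exp 2
  \<le> 9, whence 144 = 16 times 9. No factor 1/u survives.\<close>

lemma theta_power_coeffs:
  assumes u: "u > 0"
  obtains a :: "nat \<Rightarrow> complex" where "a 0 = 0" "a 1 = 2"
    "\<And>n. n \<ge> 2 \<Longrightarrow> norm (a n) \<le> 144 * real n ^ 2 * (2 * real n) powr u"
    "\<And>r. 0 \<le> r \<Longrightarrow> r < 1 \<Longrightarrow> (\<lambda>n. a n * of_real r ^ n) sums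
        of_real (((1 + 2 * (\<Sum>k. r ^ ((Suc k)\<^sup>2))) powr u - 1) / u)"
proof -
  obtain L where L: "L holomorphic_on ball 0 1" "\<And>q. norm q < 1 \<Longrightarrow> exp (L q) = jtheta q" "L 0 = 0"
    "\<And>r. 0 \<le> r \<Longrightarrow> r < 1 \<Longrightarrow> L (of_real r) = of_real (ln (1 + 2 * (\<Sum>k. r ^ ((Suc k)\<^sup>2))))"
    using jtheta_log by blast
  define G where "G q = (exp (of_real u * L q) - 1) / of_real u" for q
  have G: "G holomorphic_on ball 0 1" unfolding G_def using u by (intro holomorphic_intros L) auto
  define a where "a n = (deriv ^^ n) G 0 / fact n" for n
  have sums: "(\<lambda>n. a n * q ^ n) sums G q" if "norm q < 1" for q
    using holomorphic_power_series[OF G, of q] that by (simp add: a_def)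
  have dL: "(L has_field_derivative 2) (at 0)"
  proof -
    have d: "(L has_field_derivative deriv L 0) (at 0)"
      using L(1) by (auto intro: holomorphic_derivI[OF _ open_ball])
    hence "((\<lambda>q. exp (L q)) has_field_derivative deriv L 0) (at 0)"
      using L(3) by (auto intro!: derivative_eq_intros)
    moreover have "eventually (\<lambda>q. q \<in> ball 0 1) (nhds (0::complex))"
      by (intro eventually_nhds_in_open) auto
    hence "eventually (\<lambda>q. exp (L q) = jtheta q) (nhds 0)"
      by eventually_elim (use L(2) in auto)
    ultimately have "(jtheta has_field_derivative deriv L 0) (at 0)"
      by (subst (asm) DERIV_cong_ev[OF refl _ refl]) auto
    hence "deriv L 0 = 2" using deriv_jtheta_0 DERIV_imp_deriv by metis
    thus ?thesis using d by simp
  qed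
  have dG: "(G has_field_derivative 2) (at 0)"
    unfolding G_def using u dL L(3) by (auto intro!: derivative_eq_intros)
  have reL: "exp (Re (L q)) = norm (jtheta q)" if "norm q < 1" for q
    using L(2)[OF that] by (metis norm_exp_eq_Re)
  have bound: "norm (a n) \<le> 144 * real n ^ 2 * (2 * real n) powr u" if n: "n \<ge> 2" for n
  proof -
    \<comment> \<open>At this radius 1/r^n stays bounded while theta is only of size n.
      \<open>R\<close> is half way between \<open>r\<close> and 1, to leave room for
      \<open>Borel_Caratheodory\<close>.\<close>
    define r where "r = 1 - 1 / real n"
    define R where "R = 1 - 1 / (2 * real n)"
    have rR: "0 < r" "r < R" "R < 1" "R - r = 1 / (2 * real n)"
      using n by (auto simp: r_def R_def field_simps)
    have Lb: "norm (L q) \<le> 16 * real n ^ 2" if q: "norm q = r" for q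
    proof -
      have "norm (L q) \<le> 2 * norm q * (4 * real n) / (R - norm q)"
      proof (rule Borel_Caratheodory)
        show "L holomorphic_on ball 0 R" using L(1) by (rule holomorphic_on_subset) (use rR in auto)
        fix z :: complex assume z: "norm z < R"
        have "exp (Re (L z)) < 2 / (1 - R)"
          using reL[of z] jtheta_norm_less[of z R] z rR by auto
        also have "2 / (1 - R) = 4 * real n" using n by (simp add: R_def)
        \<comment> \<open>This trades ln(4n) for the cruder 4n as a bound of Re L; any fixed power
          of n is good enough here.\<close>
        also have "\<dots> < exp (4 * real n)" by (rule less_le_trans[OF _ exp_ge_add_one_self]) simp
        finally show "Re (L z) < 4 * real n" by simp
      qed (use q rR L(3) in auto)
      also have "\<dots> = r * (16 * real n ^ 2)" using q rR n by (simp add: power2_eq_square)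
      also have "\<dots> \<le> 1 * (16 * real n ^ 2)" using rR by (intro mult_right_mono) auto
      finally show ?thesis by simp
    qed
    have Gb: "norm (G q) \<le> 16 * real n ^ 2 * (2 * real n) powr u" if q: "norm q = r" for q
    proof -
      have "norm (exp (of_real u * L q) - 1) \<le> norm (of_real u * L q) * max 1 (exp (Re (of_real u * L q)))"
        by (rule norm_exp_minus_1_le)
      also have "\<dots> \<le> (u * (16 * real n ^ 2)) * (2 * real n) powr u"
      proof (intro mult_mono)
        show "norm (of_real u * L q) \<le> u * (16 * real n ^ 2)"
          using Lb[OF q] u by (simp add: norm_mult)
        have "exp (Re (L q)) \<le> 2 / (1 - r)"
          using reL[of q] jtheta_norm_less[of q r] q rR by auto
        also have "\<dots> = 2 * real n" using n by (simp add: r_def)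
        finally have "exp (Re (L q)) powr u \<le> (2 * real n) powr u" using u by (intro powr_mono2) auto
        hence "exp (Re (of_real u * L q)) \<le> (2 * real n) powr u"
          by (simp add: powr_def mult.commute)
        moreover have "1 \<le> (2 * real n) powr u" using n u by (intro ge_one_powr_ge_zero) auto
        ultimately show "max 1 (exp (Re (of_real u * L q))) \<le> (2 * real n) powr u" by simp
      qed (use u in auto)
      finally show ?thesis using u by (simp add: G_def norm_divide field_simps)
    qed
    have "norm ((deriv ^^ n) G 0) \<le> fact n * (16 * real n ^ 2 * (2 * real n) powr u) / r ^ n"
    proof (rule Cauchy_inequality)
      show "G holomorphic_on ball 0 r" using G by (rule holomorphic_on_subset) (use rR in auto)
      show "continuous_on (cball 0 r) G"
        by (rule holomorphic_on_imp_continuous_on, rule holomorphic_on_subset[OF G]) (use rR in auto)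
    qed (use rR Gb in auto)
    hence "norm (a n) \<le> (16 * real n ^ 2 * (2 * real n) powr u) * (1 / r ^ n)"
      by (simp add: a_def norm_divide field_simps)
    also have "\<dots> \<le> (16 * real n ^ 2 * (2 * real n) powr u) * 9"
    proof (rule mult_left_mono)
      have "1 / r = 1 + 1 / (real n - 1)" using n by (simp add: r_def field_simps)
      also have "\<dots> \<le> exp (1 / (real n - 1))" by simp
      finally have "(1 / r) ^ n \<le> exp (1 / (real n - 1)) ^ n" using rR by (intro power_mono) auto
      also have "\<dots> = exp (real n * (1 / (real n - 1)))" by (rule exp_of_nat_mult[symmetric])
      also have "\<dots> \<le> exp 2" using n by (simp add: field_simps)
      also have "exp 2 = exp 1 * exp (1::real)" by (simp add: exp_add[symmetric])
      also have "\<dots> \<le> 3 * 3" using exp_le by (intro mult_mono) auto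
      finally show "1 / r ^ n \<le> 9" by (simp add: power_one_over)
    qed auto
    finally show ?thesis by simp
  qed
  have "a 0 = 0" by (simp add: a_def G_def L(3))
  moreover have "a 1 = 2" using DERIV_imp_deriv[OF dG] by (simp add: a_def)
  moreover have "(\<lambda>n. a n * of_real r ^ n) sums
        of_real (((1 + 2 * (\<Sum>k. r ^ ((Suc k)\<^sup>2))) powr u - 1) / u)" if r: "0 \<le> r" "r < 1" for r
  proof -
    have "summable (\<lambda>k. norm (complex_of_real r ^ ((Suc k)\<^sup>2)))"
      using r by (intro power_square_summable) auto
    hence "summable (\<lambda>k. r ^ ((Suc k)\<^sup>2))" using r by (simp add: norm_power)
    hence "(\<Sum>k. r ^ ((Suc k)\<^sup>2)) \<ge> 0" using r by (intro suminf_nonneg) auto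
    hence pos: "1 + 2 * (\<Sum>k. r ^ ((Suc k)\<^sup>2)) > 0" by linarith
    have "G (of_real r) = of_real (((1 + 2 * (\<Sum>k. r ^ ((Suc k)\<^sup>2))) powr u - 1) / u)"
      using pos by (simp add: G_def L(4)[OF r] powr_def exp_of_real[symmetric] del: exp_of_real)
    thus ?thesis using sums[of "of_real r"] r by simp
  qed
  ultimately show ?thesis using that bound by blast
qed

section \<open>Mellin integrals in logarithmic coordinates\<close>

text \<open>The change of variables t = exp y, an identity of integrals over the completed measure;
  Borel measurability of \<open>f\<close> carries it over to \<open>lborel\<close>.\<close>

lemma exp_substitution:
  fixes f :: "real \<Rightarrow> complex"
  assumes [measurable]: "f \<in> borel_measurable borel"
  shows "set_integrable lborel {0<..} f \<longleftrightarrow> integrable lborel (\<lambda>y. exp y *\<^sub>R f (exp y))"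
    and "set_integrable lborel {0<..} f \<Longrightarrow>
           (LINT t:{0<..}|lborel. f t) = (LINT y|lborel. exp y *\<^sub>R f (exp y))"
proof -
  have m1: "(\<lambda>x. indicator {0<..} x *\<^sub>R f x) \<in> borel_measurable lborel" by measurable
  have m2: "(\<lambda>y. exp y *\<^sub>R f (exp y)) \<in> borel_measurable lborel" by measurable
  have im: "range (exp :: real \<Rightarrow> real) = {0<..}" by (auto simp: image_iff) (metis exp_ln)
  have der: "(exp has_field_derivative exp x) (at x within UNIV)" for x :: real by (rule DERIV_exp)
  have inj: "inj_on exp (UNIV :: real set)" by (simp add: inj_on_def)
  note ch = has_absolute_integral_change_of_variables_real[OF _ der inj, of f, unfolded im]
  note ai = absolutely_integrable_change_of_variables_real[OF _ der inj, of f, unfolded im]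
  have A: "set_integrable lborel {0<..} f \<longleftrightarrow> f absolutely_integrable_on {0<..}"
    unfolding set_integrable_def using integrable_completion[OF m1] by simp
  have B: "integrable lborel (\<lambda>y. exp y *\<^sub>R f (exp y)) \<longleftrightarrow> (\<lambda>y. exp y *\<^sub>R f (exp y)) absolutely_integrable_on UNIV"
    unfolding set_integrable_def using integrable_completion[OF m2] by simp
  show AB: "set_integrable lborel {0<..} f \<longleftrightarrow> integrable lborel (\<lambda>y. exp y *\<^sub>R f (exp y))"
    unfolding A B using ai by simp
  assume i: "set_integrable lborel {0<..} f"
  have "(LINT t:{0<..}|lborel. f t) = (LINT t:{0<..}|lebesgue. f t)"
    unfolding set_lebesgue_integral_def by (rule integral_completion[OF m1, symmetric])
  also have "\<dots> = integral {0<..} f"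
    by (rule set_lebesgue_integral_eq_integral(2)) (use i A in simp)
  also have "\<dots> = integral UNIV (\<lambda>y. exp y *\<^sub>R f (exp y))"
    using ch[of "integral {0<..} f"] i A by simp
  also have "\<dots> = (LINT y:UNIV|lebesgue. exp y *\<^sub>R f (exp y))"
    by (rule set_lebesgue_integral_eq_integral(2)[symmetric]) (use i AB B in simp)
  also have "\<dots> = (LINT y|lborel. exp y *\<^sub>R f (exp y))"
    unfolding set_lebesgue_integral_def using integral_completion[OF m2] by simp
  finally show "(LINT t:{0<..}|lborel. f t) = (LINT y|lborel. exp y *\<^sub>R f (exp y))" .
qed

lemma Gamma_integral_exp:
  assumes z: "Re z > 0"
  shows "integrable lborel (\<lambda>x. exp (z * of_real x - of_real (exp x)))"
    and "(LINT x|lborel. exp (z * of_real x - of_real (exp x))) = Gamma z"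
proof -
  let ?f = "\<lambda>t. complex_of_real t powr (z - 1) / of_real (exp t)"
  have m: "?f \<in> borel_measurable borel" 
    by (simp only: powr_def) measurable
  have e: "(\<lambda>y. exp y *\<^sub>R ?f (exp y)) = (\<lambda>x. exp (z * of_real x - of_real (exp x)))"
  proof
    fix y :: real
    have "exp y *\<^sub>R ?f (exp y) = exp (of_real y) * exp ((z - 1) * of_real y) / exp (of_real (exp y))"
      by (simp add: powr_def scaleR_conv_of_real Ln_of_real' exp_of_real)
    also have "\<dots> = exp (of_real y + (z - 1) * of_real y - of_real (exp y))"
      by (simp only: exp_add exp_diff)
    also have "of_real y + (z - 1) * of_real y = z * of_real y" by (simp add: algebra_simps)
    finally show "exp y *\<^sub>R ?f (exp y) = exp (z * of_real y - of_real (exp y))" .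
  qed
  have a: "?f absolutely_integrable_on {0<..}" by (rule absolutely_integrable_Gamma_integral'[OF z])
  have m1: "(\<lambda>x. indicator {0<..} x *\<^sub>R ?f x) \<in> borel_measurable lborel"
    using m by measurable
  have i: "set_integrable lborel {0<..} ?f"
    using a unfolding set_integrable_def using integrable_completion[OF m1] by simp
  show "integrable lborel (\<lambda>x. exp (z * of_real x - of_real (exp x)))"
    using exp_substitution(1)[OF m] i unfolding e by simp
  have "(LINT x|lborel. exp (z * of_real x - of_real (exp x))) = (LINT t:{0<..}|lborel. ?f t)"
    using exp_substitution(2)[OF m i] unfolding e by simp
  also have "\<dots> = (LINT t:{0<..}|lebesgue. ?f t)"
    unfolding set_lebesgue_integral_def by (rule integral_completion[OF m1, symmetric])
  also have "\<dots> = integral {0<..} ?f"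
    by (rule set_lebesgue_integral_eq_integral(2)[OF a])
  also have "\<dots> = Gamma z" by (rule integral_unique[OF Gamma_integral_complex'[OF z]])
  finally show "(LINT x|lborel. exp (z * of_real x - of_real (exp x))) = Gamma z" .
qed

text \<open>Euler's integral after x = ln c + 2y. For c = pi n this produces half of pi^(-s/2)
  Gamma(s/2) n^(-s/2), the general term of the later Dirichlet series.\<close>

lemma Mellin_gaussian:
  assumes s: "Re s > 0" and c: "c > 0"
  shows "integrable lborel (\<lambda>y. exp (s * of_real y - of_real (c * exp (2*y))))"
    and "(LINT y|lborel. exp (s * of_real y - of_real (c * exp (2*y)))) =
           Gamma (s/2) / 2 * exp (- s / 2 * of_real (ln c))"
proof -
  let ?h = "\<lambda>x. exp ((s/2) * of_real x - of_real (exp x))"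
  have z: "Re (s/2) > 0" using s by simp
  have e: "exp (s * of_real y - of_real (c * exp (2*y))) = exp (- s / 2 * of_real (ln c)) * ?h (ln c + 2 * y)" for y
    using c by (simp add: exp_add[symmetric] exp_add algebra_simps of_real_exp[symmetric] del: of_real_exp)
  have i: "integrable lborel (\<lambda>y. ?h (ln c + 2 * y))"
    by (rule lborel_integrable_real_affine[OF Gamma_integral_exp(1)[OF z]]) simp
  show "integrable lborel (\<lambda>y. exp (s * of_real y - of_real (c * exp (2*y))))"
    unfolding e using i by simp
  have "(LINT x|lborel. ?h x) = \<bar>2\<bar> *\<^sub>R (LINT y|lborel. ?h (ln c + 2 * y))"
    by (rule lborel_integral_real_affine) simp
  hence "(LINT y|lborel. ?h (ln c + 2 * y)) = Gamma (s/2) / 2"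
    unfolding Gamma_integral_exp(2)[OF z] by (simp add: scaleR_conv_of_real)
  thus "(LINT y|lborel. exp (s * of_real y - of_real (c * exp (2*y)))) =
           Gamma (s/2) / 2 * exp (- s / 2 * of_real (ln c))"
    unfolding e by simp
qed

lemma exp_half_line_integral:
  assumes "Re c < 0"
  shows "set_integrable lborel {0..} (\<lambda>y. exp (c * of_real y))"
    and "(LINT y:{0..}|lborel. exp (c * of_real y)) = - 1 / c"
proof -
  have c: "c \<noteq> 0" using assms by auto
  have "(\<lambda>y. exp (- (- Re c) * y)) integrable_on {0..}"
    using assms by (intro integrable_on_exp_minus_to_infinity) auto
  hence "(\<lambda>y. exp (Re c * y)) absolutely_integrable_on {0..}"
    by (intro nonnegative_absolutely_integrable_1) auto
  hence r: "set_integrable lborel {0..} (\<lambda>y. exp (Re c * y))"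
    unfolding set_integrable_def by (subst (asm) integrable_completion) auto
  show i: "set_integrable lborel {0..} (\<lambda>y. exp (c * of_real y))"
    unfolding set_integrable_def
    by (rule Bochner_Integration.integrable_bound[OF r[unfolded set_integrable_def]])
       (auto simp: norm_mult mult.commute indicator_def)
  have i': "set_integrable lborel {0<..} (\<lambda>y. exp (c * of_real y))"
    by (rule set_integrable_subset[OF i]) auto
  have e: "einterval (ereal 0) \<infinity> = {0<..}" by (auto simp: einterval_def)
  have "(LBINT y=ereal 0..\<infinity>. exp (c * of_real y)) = 0 - 1 / c"
  proof (rule interval_integral_FTC_integrable)
    show "((\<lambda>y. exp (c * of_real y) / c) has_vector_derivative exp (c * of_real x)) (at x)" for x
      using c by (auto intro!: derivative_eq_intros has_vector_derivative_real_field)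
    show "((((\<lambda>y. exp (c * of_real y) / c) \<circ> real_of_ereal)) \<longlongrightarrow> 1 / c) (at_right (ereal 0))"
      unfolding ereal_tendsto_simps using c
      by (auto intro!: tendsto_eq_intros filterlim_ident)
    show "((((\<lambda>y. exp (c * of_real y) / c) \<circ> real_of_ereal)) \<longlongrightarrow> 0) (at_left \<infinity>)"
      unfolding ereal_tendsto_simps
    proof (rule tendsto_norm_zero_cancel)
      have "filterlim (\<lambda>y. Re c * y) at_bot at_top"
        using assms by (intro filterlim_tendsto_neg_mult_at_bot[OF tendsto_const] filterlim_ident)
      hence "((\<lambda>y. exp (Re c * y) / norm c) \<longlongrightarrow> 0 / norm c) at_top"
        using c by (intro tendsto_divide tendsto_const filterlim_compose[OF exp_at_bot]) auto
      thus "((\<lambda>y. norm (exp (c * of_real y) / c)) \<longlongrightarrow> 0) at_top"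
        by (simp add: norm_divide)
    qed
  qed (use i' e in auto)
  moreover have "(LBINT y=ereal 0..\<infinity>. exp (c * of_real y)) = (LINT y:{0<..}|lborel. exp (c * of_real y))"
    unfolding interval_lebesgue_integral_def e by simp
  moreover have "(LINT y:{0<..}|lborel. exp (c * of_real y)) = (LINT y:{0..}|lborel. exp (c * of_real y))"
    unfolding set_lebesgue_integral_def
    by (rule integral_cong_AE) (auto simp: indicator_def intro!: AE_I[of _ _ "{0}"])
  ultimately show "(LINT y:{0..}|lborel. exp (c * of_real y)) = - 1 / c" by simp
qed

lemma integral_split_reflect:
  fixes h :: "real \<Rightarrow> complex"
  assumes "set_integrable lborel {0..} h" "set_integrable lborel {0..} (\<lambda>y. h (- y))"
  shows "integrable lborel h"
    and "(LINT y|lborel. h y) = (LINT y:{0..}|lborel. h y) + (LINT y:{0..}|lborel. h (- y))"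
proof -
  have i1: "integrable lborel (\<lambda>y. indicator {0..} y *\<^sub>R h y)" using assms(1) by (simp add: set_integrable_def)
  have i2: "integrable lborel (\<lambda>y. indicator {0..} y *\<^sub>R h (- y))" using assms(2) by (simp add: set_integrable_def)
  have i2': "integrable lborel (\<lambda>y. indicator {0..} (- y) *\<^sub>R h y)"
    using lborel_integrable_real_affine[OF i2, of "-1" 0] by simp
  have i2'': "integrable lborel (\<lambda>y. indicator {..<0} y *\<^sub>R h y)"
  proof -
    have "set_integrable lborel {..0} h" using i2' by (simp add: set_integrable_def indicator_def)
    hence "set_integrable lborel {..<0} h" by (rule set_integrable_subset) auto
    thus ?thesis by (simp add: set_integrable_def)
  qed
  have e: "h y = indicator {0..} y *\<^sub>R h y + indicator {..<0} y *\<^sub>R h y" for y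
    by (auto simp: indicator_def)
  show "integrable lborel h"
    using Bochner_Integration.integrable_add[OF i1 i2''] unfolding e[symmetric] .
  have "(LINT y|lborel. h y) = (LINT y|lborel. indicator {0..} y *\<^sub>R h y + indicator {..<0} y *\<^sub>R h y)"
    by (simp only: e[symmetric])
  also have "\<dots> = (LINT y|lborel. indicator {0..} y *\<^sub>R h y) + (LINT y|lborel. indicator {..<0} y *\<^sub>R h y)"
    by (rule Bochner_Integration.integral_add[OF i1 i2''])
  also have "(LINT y|lborel. indicator {..<0} y *\<^sub>R h y) = (LINT y|lborel. indicator {0..} (- y) *\<^sub>R h y)"
    using i2' i2'' by (intro integral_cong_AE) (auto simp: indicator_def intro!: AE_I[of _ _ "{0}"])
  also have "\<dots> = (LINT y|lborel. indicator {0..} y *\<^sub>R h (- y))"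
    using lborel_integral_real_affine[of "-1" "\<lambda>y. indicator {0..} y *\<^sub>R h (- y)" 0] by simp
  finally show "(LINT y|lborel. h y) = (LINT y:{0..}|lborel. h y) + (LINT y:{0..}|lborel. h (- y))"
    by (simp add: set_lebesgue_integral_def)
qed

text \<open>Meant for the restriction of a function of two variables to a complex line, parametrised
  so that the increment is 1. With \<open>\<rho>\<close> the reciprocal of the increment's length,
  the bounds are quadratic and linear in that length.\<close>

lemma taylor_remainder_2:
  fixes f :: "complex \<Rightarrow> complex"
  assumes f: "f holomorphic_on UNIV" and \<rho>: "\<rho> \<ge> 2" and b: "\<And>z. norm z \<le> \<rho> \<Longrightarrow> norm (f z) \<le> M"
  shows "norm (f 1 - f 0 - deriv f 0) \<le> 2 * M / \<rho>\<^sup>2" "norm (deriv f 0) \<le> M / \<rho>"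
proof -
  define a where "a n = (deriv ^^ n) f 0 / fact n" for n
  have "((\<lambda>n. (deriv ^^ n) f 0 / fact n * (1 - 0) ^ n) sums f 1)"
    by (rule holomorphic_power_series[of f 0 2]) (auto intro: holomorphic_on_subset[OF f])
  hence s: "(\<lambda>n. a n) sums f 1" by (simp add: a_def)
  have a: "norm (a n) \<le> M / \<rho> ^ n" for n
  proof -
    have "norm ((deriv ^^ n) f 0) \<le> fact n * M / \<rho> ^ n"
      using \<rho> b f by (intro Cauchy_inequality)
        (auto intro: holomorphic_on_subset holomorphic_on_imp_continuous_on)
    thus ?thesis by (simp add: a_def norm_divide field_simps)
  qed
  have M: "M \<ge> 0" by (rule order_trans[OF norm_ge_zero b[of 0]]) (use \<rho> in simp)
  show "norm (deriv f 0) \<le> M / \<rho>" using a[of 1] by (simp add: a_def)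
  have "(\<lambda>n. a (n + 2)) sums (f 1 - (\<Sum>n<2. a n))" using s by (subst sums_iff_shift) simp
  moreover have "(\<Sum>n<2. a n) = f 0 + deriv f 0" by (simp add: numeral_2_eq_2 a_def)
  ultimately have "(\<lambda>n. a (n + 2)) sums (f 1 - f 0 - deriv f 0)" by (simp only: diff_diff_eq)
  hence "f 1 - f 0 - deriv f 0 = (\<Sum>n. a (n + 2))" by (simp add: sums_iff)
  moreover have "norm (\<Sum>n. a (n + 2)) \<le> (\<Sum>n. (M / \<rho>\<^sup>2) * (1/2) ^ n)"
  proof (rule norm_suminf_le)
    show "norm (a (n + 2)) \<le> (M / \<rho>\<^sup>2) * (1/2) ^ n" for n
    proof -
      have "(1 / \<rho>) ^ n \<le> (1/2) ^ n" using \<rho> by (intro power_mono) (auto simp: field_simps)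
      hence "(M / \<rho>\<^sup>2) * (1 / \<rho>) ^ n \<le> (M / \<rho>\<^sup>2) * (1/2) ^ n" using M by (intro mult_left_mono) auto
      thus ?thesis using a[of "n+2"] by (simp add: power_one_over power_add field_simps power2_eq_square)
    qed
    show "summable (\<lambda>n. (M / \<rho>\<^sup>2) * (1/2) ^ n)" by (intro summable_mult summable_geometric) simp
  qed
  moreover have "(\<Sum>n. (M / \<rho>\<^sup>2) * (1/2) ^ n) = (M / \<rho>\<^sup>2) * 2"
    by (subst suminf_mult) (auto simp: suminf_geometric)
  ultimately show "norm (f 1 - f 0 - deriv f 0) \<le> 2 * M / \<rho>\<^sup>2" by (simp add: mult.commute)
qed

section \<open>Entire functions of two variables\<close>

text \<open>A locally uniform integrable majorant of \<open>g\<close> alone suffices: on complex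
  lines Cauchy's estimates bound both the derivative and the second-order remainder by that
  majorant, so no majorant of the derivatives has to be supplied.\<close>

lemma entire2_param_integral:
  fixes g :: "real \<Rightarrow> complex \<Rightarrow> complex \<Rightarrow> complex"
  assumes meas: "\<And>w s. (\<lambda>y. g y w s) \<in> borel_measurable lborel"
    and der: "\<And>y w s h k. ((\<lambda>z. g y (w + z * h) (s + z * k)) has_field_derivative (a y w s * h + b y w s * k)) (at 0)"
    and dom: "\<And>R. \<exists>M. integrable lborel M \<and> (\<forall>y w s. norm w \<le> R \<longrightarrow> norm s \<le> R \<longrightarrow> norm (g y w s) \<le> M y)"
  shows "entire2 (\<lambda>w s. LINT y|lborel. g y w s)"
  unfolding entire2_def
proof (intro allI)
  fix w s :: complex
  \<comment> \<open>The additional 1 keeps increments of length up to 1 inside the region where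
    \<open>M\<close> dominates.\<close>
  define R where "R = norm w + norm s + 1"
  obtain M where M: "integrable lborel M" "\<And>y w s. norm w \<le> R \<Longrightarrow> norm s \<le> R \<Longrightarrow> norm (g y w s) \<le> M y"
    using dom[of R] by blast
  have int: "integrable lborel (\<lambda>y. g y w' s')" if "norm w' \<le> R" "norm s' \<le> R" for w' s'
    by (rule Bochner_Integration.integrable_bound[OF M(1)])
       (use M(2)[OF that] meas in \<open>auto intro: order_trans[OF _ abs_ge_self]\<close>)
  have M0: "M y \<ge> 0" for y by (rule order_trans[OF norm_ge_zero M(2)[of 0 0]]) (simp_all add: R_def)
  have line: "((\<lambda>z. g y (w + z * h) (s + z * k)) has_field_derivative
       (a y (w + z0 * h) (s + z0 * k) * h + b y (w + z0 * h) (s + z0 * k) * k)) (at z0)" for y h k z0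
    using der[where w = "w + z0 * h" and s = "s + z0 * k" and h = h and k = k and y = y]
      DERIV_shift[of "\<lambda>z. g y (w + z * h) (s + z * k)" _ 0 z0]
    by (simp add: algebra_simps)
  have hol: "(\<lambda>z. g y (w + z * h) (s + z * k)) holomorphic_on UNIV" for y h k
    unfolding holomorphic_on_def field_differentiable_def using line by blast
  have d0: "deriv (\<lambda>z. g y (w + z * h) (s + z * k)) 0 = a y w s * h + b y w s * k" for y h k
    using line[of y h k 0] by (simp add: DERIV_imp_deriv)
  have bnd: "norm (g y (w + z * h) (s + z * k)) \<le> M y" if "norm z * norm (h, k) \<le> 1" for y z h k
  proof (rule M(2))
    have "norm h \<le> norm (h, k)" "norm k \<le> norm (h, k)" using norm_fst_le[of h k] norm_snd_le[of k h] by simp_all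
    hence "norm z * norm h \<le> 1" "norm z * norm k \<le> 1"
      using that by (meson mult_left_mono norm_ge_zero order_trans)+
    thus "norm (w + z * h) \<le> R" "norm (s + z * k) \<le> R"
      unfolding R_def by (auto intro!: norm_triangle_le simp: norm_mult add_increasing)
  qed
  have rem: "norm (g y (w + h) (s + k) - g y w s - (a y w s * h + b y w s * k)) \<le> 2 * M y * (norm (h, k))\<^sup>2"
    "norm (a y w s * h + b y w s * k) \<le> M y * norm (h, k)"
    if "norm (h, k) \<le> 1 / 2" "norm (h, k) > 0" for y h k
  proof -
    have \<rho>: "1 / norm (h, k) \<ge> 2" using that by (simp add: field_simps)
    have b: "norm (g y (w + z * h) (s + z * k)) \<le> M y" if "norm z \<le> 1 / norm (h, k)" for z
      using that \<open>norm (h, k) > 0\<close> by (intro bnd) (simp add: field_simps)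
    show "norm (g y (w + h) (s + k) - g y w s - (a y w s * h + b y w s * k)) \<le> 2 * M y * (norm (h, k))\<^sup>2"
      using taylor_remainder_2(1)[OF hol \<rho> b] unfolding d0 by (simp add: power_divide)
    show "norm (a y w s * h + b y w s * k) \<le> M y * norm (h, k)"
      using taylor_remainder_2(2)[OF hol \<rho> b] unfolding d0 by simp
  qed
  \<comment> \<open>Measurability of the directional derivative: it is the pointwise limit of
    difference quotients along the steps 1/(n+1).\<close>
  have ab: "(\<lambda>y. a y w s * h + b y w s * k) \<in> borel_measurable lborel" for h k
  proof (rule borel_measurable_LIMSEQ_metric)
    show "(\<lambda>y. (g y (w + of_real (1 / Suc n) * h) (s + of_real (1 / Suc n) * k) - g y w s) / of_real (1 / Suc n))
            \<in> borel_measurable lborel" for n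
      by (intro borel_measurable_divide borel_measurable_diff meas) auto
    fix y
    have "(\<lambda>z. (g y (w + z * h) (s + z * k) - g y w s) / z) \<midarrow>0\<rightarrow> a y w s * h + b y w s * k"
      using line[of y h k 0] by (simp add: DERIV_def)
    moreover have "filterlim (\<lambda>n. complex_of_real (1 / Suc n)) (at 0) sequentially"
    proof (rule filterlim_atI)
      have "(\<lambda>n. complex_of_real (1 / Suc n)) \<longlonglongrightarrow> of_real 0"
        by (intro tendsto_of_real LIMSEQ_Suc lim_1_over_n)
      thus "(\<lambda>n. complex_of_real (1 / Suc n)) \<longlonglongrightarrow> 0" by (simp only: of_real_0)
      show "\<forall>\<^sub>F n in sequentially. complex_of_real (1 / Suc n) \<noteq> 0"
        by (intro always_eventually allI) (simp only: of_real_eq_0_iff, simp)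
    qed
    ultimately show "(\<lambda>n. (g y (w + of_real (1 / Suc n) * h) (s + of_real (1 / Suc n) * k) - g y w s) / of_real (1 / Suc n))
       \<longlonglongrightarrow> a y w s * h + b y w s * k"
      by (rule filterlim_compose)
  qed
  have abi: "integrable lborel (\<lambda>y. a y w s * h + b y w s * k)" if "norm (h, k) \<le> 1 / 2" "norm (h, k) > 0" for h k
    by (rule Bochner_Integration.integrable_bound[OF integrable_mult_left[OF M(1), of "norm (h, k)"]])
       (use rem(2)[OF that] ab M0 in \<open>auto simp: abs_mult\<close>)
  \<comment> \<open>The increments (1/2, 0) and (0, 1/2) separate the two partial
    derivatives.\<close>
  have ai: "integrable lborel (\<lambda>y. a y w s)"
    using integrable_mult_left[OF abi[of "1/2" 0], of 2] by (simp add: norm_Pair)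
  have bi: "integrable lborel (\<lambda>y. b y w s)"
    using integrable_mult_left[OF abi[of 0 "1/2"], of 2] by (simp add: norm_Pair)
  define A B where "A = (LINT y|lborel. a y w s)" and "B = (LINT y|lborel. b y w s)"
  let ?F = "\<lambda>w s. LINT y|lborel. g y w s"
  have "((\<lambda>(x, y). ?F x y) has_derivative (\<lambda>(h, k). A * h + B * k)) (at (w, s))"
  proof (rule has_derivativeI_sandwich[where e = "1/2" and H = "\<lambda>p. 2 * (LINT y|lborel. M y) * norm (p - (w, s))"])
    show "bounded_linear (\<lambda>(h, k). A * h + B * k)"
      unfolding split_beta by (intro bounded_linear_intros)
    have "((\<lambda>p. 2 * (LINT y|lborel. M y) * norm (p - (w, s))) \<longlongrightarrow> 2 * (LINT y|lborel. M y) * norm ((w, s) - (w, s))) (at (w, s))"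
      by (intro tendsto_intros)
    thus "((\<lambda>p. 2 * (LINT y|lborel. M y) * norm (p - (w, s))) \<longlongrightarrow> 0) (at (w, s))" by simp
    fix p :: "complex \<times> complex" assume p: "p \<noteq> (w, s)" "dist p (w, s) < 1 / 2"
    define h k where "h = fst p - w" and "k = snd p - s"
    have pe: "p = (w + h, s + k)" "p - (w, s) = (h, k)" by (cases p, simp add: h_def k_def)+
    have n: "norm (h, k) \<le> 1/2" "norm (h, k) > 0"
      using p unfolding pe(2)[symmetric] by (auto simp: dist_norm)
    have "norm h \<le> norm (h, k)" "norm k \<le> norm (h, k)" using norm_fst_le[of h k] norm_snd_le[of k h] by simp_all
    hence i1: "integrable lborel (\<lambda>y. g y (w + h) (s + k))"
      using n by (intro int; unfold R_def; intro norm_triangle_le) (auto simp: add_increasing add_increasing2)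
    have i2: "integrable lborel (\<lambda>y. g y w s)" by (intro int) (auto simp: R_def)
    have "?F (w + h) (s + k) - ?F w s - (A * h + B * k) =
       (LINT y|lborel. g y (w + h) (s + k) - g y w s - (a y w s * h + b y w s * k))"
      unfolding A_def B_def using i1 i2 ai bi by simp
    also have "norm \<dots> \<le> (LINT y|lborel. 2 * M y * (norm (h, k))\<^sup>2)"
    proof (rule order_trans[OF integral_norm_bound], rule integral_mono)
      show "integrable lborel (\<lambda>y. norm (g y (w + h) (s + k) - g y w s - (a y w s * h + b y w s * k)))"
        using i1 i2 abi[OF n] by (intro integrable_norm Bochner_Integration.integrable_diff)
      show "integrable lborel (\<lambda>y. 2 * M y * (norm (h, k))\<^sup>2)" using M(1) by simp
    qed (use rem(1)[OF n] in auto)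
    also have "\<dots> = 2 * (LINT y|lborel. M y) * norm (h, k) * norm (h, k)" by (simp add: power2_eq_square)
    finally show "norm ((case p of (x, y) \<Rightarrow> ?F x y) - (case (w, s) of (x, y) \<Rightarrow> ?F x y) - (case p - (w, s) of (h, k) \<Rightarrow> A * h + B * k)) / norm (p - (w, s))
       \<le> 2 * (LINT y|lborel. M y) * norm (p - (w, s))"
      unfolding pe(2) using n(2) by (simp add: pe(1) field_simps)
  qed simp
  thus "\<exists>a b. ((\<lambda>(x, y). ?F x y) has_derivative (\<lambda>(h, k). a * h + b * k)) (at (w, s))" by blast
qed

lemma entire2_slices:
  assumes "entire2 F"
  shows "F w holomorphic_on UNIV" "(\<lambda>w. F w s) holomorphic_on UNIV"
proof -
  have "\<exists>a b. ((\<lambda>(x, y). F x y) has_derivative (\<lambda>(h, k). a * h + b * k)) (at (w, s))" for w s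
    using assms by (simp add: entire2_def)
  then obtain a b where d: "\<And>w s. ((\<lambda>(x, y). F x y) has_derivative (\<lambda>(h, k). a w s * h + b w s * k)) (at (w, s))"
    by metis
  have "(F w has_field_derivative b w s) (at s)" for w s
  proof -
    have "((\<lambda>s. (w, s)) has_derivative (\<lambda>k. (0, k))) (at s)" by (auto intro!: derivative_eq_intros)
    from has_derivative_compose[OF this d] show ?thesis by (simp add: has_field_derivative_def mult_commute_abs)
  qed
  thus "F w holomorphic_on UNIV" by (auto simp: holomorphic_on_def field_differentiable_def intro: DERIV_subset)
  have "((\<lambda>w. F w s) has_field_derivative a w s) (at w)" for w s
  proof -
    have "((\<lambda>w. (w, s)) has_derivative (\<lambda>k. (k, 0))) (at w)" by (auto intro!: derivative_eq_intros)
    from has_derivative_compose[OF this d] show ?thesis by (simp add: has_field_derivative_def mult_commute_abs)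
  qed
  thus "(\<lambda>w. F w s) holomorphic_on UNIV" by (auto simp: holomorphic_on_def field_differentiable_def intro: DERIV_subset)
qed

text \<open>The one-variable identity theorem, twice. For Re w < 0 the condition Re w < Re s < 0
  cuts out a non-empty strip, which settles all s; the half plane Re w < 0 then settles all
  w.\<close>

lemma entire2_unique:
  assumes F: "entire2 F" and G: "entire2 G"
    and eq: "\<And>w s. Re w < Re s \<Longrightarrow> Re s < 0 \<Longrightarrow> F w s = G w s"
  shows "F = G"
proof (intro ext)
  fix w s
  have 1: "F w s = G w s" if w: "Re w < 0" for w s
  proof (rule analytic_continuation_open[of "{s. Re w < Re s} \<inter> {s. Re s < 0}" UNIV "F w" "G w"])
    show "open ({s. Re w < Re s} \<inter> {s. Re s < 0})"
      by (intro open_Int open_halfspace_Re_gt open_halfspace_Re_lt)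
    have "of_real (Re w / 2) \<in> {s. Re w < Re s} \<inter> {s. Re s < 0}" using w by auto
    thus "{s. Re w < Re s} \<inter> {s. Re s < 0} \<noteq> {}" by blast
  qed (use entire2_slices(1) F G eq in auto)
  show "F w s = G w s"
  proof (rule analytic_continuation_open[of "{w. Re w < 0}" UNIV "\<lambda>w. F w s" "\<lambda>w. G w s"])
    have "-1 \<in> {w. Re w < 0}" by simp
    thus "{w. Re w < 0} \<noteq> {}" by blast
  qed (use entire2_slices(2) F G 1 open_halfspace_Re_lt in auto)
qed

section \<open>The continuation of the zeta integral\<close>

lemma theta_bounds:
  assumes "t \<ge> 1"
  shows "1 \<le> theta t" "theta t \<le> 1 + 4 * exp (- pi * t)"
proof -
  define x where "x = exp (- pi * t)"
  have "x \<le> exp (- 1)"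
    unfolding x_def using assms pi_gt3 mult_mono[of 1 pi 1 t] by simp
  also have "\<dots> \<le> 1 / 2" using exp_ge_add_one_self[of 1] by (simp add: exp_minus field_simps)
  finally have x: "0 < x" "x \<le> 1 / 2" by (auto simp: x_def)
  have s: "summable (\<lambda>k. exp (- pi * (real (Suc k))\<^sup>2 * t))" using assms by (intro sum_gauss_summable) auto
  have "0 \<le> (\<Sum>k. exp (- pi * (real (Suc k))\<^sup>2 * t))" by (intro suminf_nonneg s) auto
  thus "1 \<le> theta t" using assms by (simp add: theta_eq_suminf)
  have "(\<Sum>k. exp (- pi * (real (Suc k))\<^sup>2 * t)) \<le> (\<Sum>k. x * (1/2) ^ k)"
  proof (rule suminf_le[OF _ s])
    fix k
    have "real (Suc k) \<le> (real (Suc k))\<^sup>2" by (simp add: power2_eq_square)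
    hence "pi * t * real (Suc k) \<le> pi * t * (real (Suc k))\<^sup>2"
      using assms by (intro mult_left_mono) auto
    hence "exp (- pi * (real (Suc k))\<^sup>2 * t) \<le> exp (real (Suc k) * (- pi * t))"
      by (simp add: algebra_simps del: of_nat_Suc)
    also have "\<dots> = x ^ Suc k" unfolding x_def by (rule exp_of_nat_mult)
    also have "\<dots> \<le> x * (1/2) ^ k" using x by (simp add: power_mono mult_left_mono)
    finally show "exp (- pi * (real (Suc k))\<^sup>2 * t) \<le> x * (1/2) ^ k" .
  qed (intro summable_mult summable_geometric, simp)
  also have "\<dots> = 2 * x" by (subst suminf_mult) (auto simp: suminf_geometric)
  finally show "theta t \<le> 1 + 4 * exp (- pi * t)" using assms by (simp add: theta_eq_suminf x_def)
qed

section \<open>Theta on the logarithmic scale, and the explicit continuation\<close>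

definition Phi :: "real \<Rightarrow> real" where "Phi y = theta (exp (2 * y))"

lemma Phi_measurable [measurable]: "Phi \<in> borel_measurable borel"
proof -
  have "Phi = (\<lambda>y. 1 + 2 * (\<Sum>k. exp (- pi * (real (Suc k))\<^sup>2 * exp (2 * y))))"
    by (simp add: Phi_def theta_eq_suminf fun_eq_iff)
  also have "\<dots> \<in> borel_measurable borel" by measurable
  finally show ?thesis .
qed

lemma Phi_bounds:
  assumes "y \<ge> 0"
  shows "1 \<le> Phi y" "ln (Phi y) \<ge> 0" "ln (Phi y) \<le> 4 * exp (- pi * exp (2 * y))" "ln (Phi y) \<le> 4"
proof -
  have e: "exp (2 * y) \<ge> 1" using assms by simp
  show 1: "1 \<le> Phi y" unfolding Phi_def by (rule theta_bounds(1)[OF e])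
  thus "ln (Phi y) \<ge> 0" by simp
  have "ln (Phi y) \<le> Phi y - 1" using 1 by (intro ln_le_minus_one) auto
  also have "\<dots> \<le> 4 * exp (- pi * exp (2 * y))" using theta_bounds(2)[OF e] by (simp add: Phi_def)
  finally show "ln (Phi y) \<le> 4 * exp (- pi * exp (2 * y))" .
  also have "\<dots> \<le> 4 * 1" by (intro mult_left_mono) auto
  finally show "ln (Phi y) \<le> 4" by simp
qed

lemma Phi_minus: "Phi (- y) = exp y * Phi y"
proof -
  have "Phi (- y) = theta (1 / exp (2 * y))" by (simp add: Phi_def exp_minus inverse_eq_divide)
  also have "\<dots> = sqrt (exp (2 * y)) * theta (exp (2 * y))" by (rule theta_functional_equation) simp
  also have "sqrt (exp (2 * y)) = exp y" by (simp add: exp_double real_sqrt_unique)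
  finally show ?thesis by (simp add: Phi_def)
qed

lemma Phi_pos: "Phi y > 0"
proof (cases "y \<ge> 0")
  case True thus ?thesis using Phi_bounds(1)[of y] by simp
next
  case False
  hence "Phi (- y) > 0" using Phi_bounds(1)[of "- y"] by simp
  thus ?thesis by (simp add: Phi_minus zero_less_mult_iff)
qed

definition expq :: "complex \<Rightarrow> complex" where
  "expq z = (if z = 0 then 1 else (exp z - 1) / z)"

lemma expq_holomorphic: "expq holomorphic_on UNIV"
proof -
  have "(\<lambda>z. if z = 0 then deriv exp 0 else (exp z - exp 0) / (z - 0)) holomorphic_on UNIV"
    by (rule pole_lemma_open) (auto intro!: holomorphic_intros)
  moreover have "deriv exp (0::complex) = 1" by (simp add: DERIV_imp_deriv[OF DERIV_exp])
  ultimately show ?thesis by (simp add: expq_def[abs_def] cong: if_cong)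
qed

lemma expq_measurable [measurable]:
  "expq \<in> borel_measurable borel"
  by (intro borel_measurable_continuous_onI holomorphic_on_imp_continuous_on expq_holomorphic)

lemma mult_expq: "z * expq z = exp z - 1" by (simp add: expq_def)

lemma norm_expq_le: "norm (expq z) \<le> exp (norm z)"
proof (cases "z = 0")
  case False
  have "norm (exp z - 1) \<le> norm z * max 1 (exp (Re z))" by (rule norm_exp_minus_1_le)
  also have "\<dots> \<le> norm z * exp (norm z)"
    using complex_Re_le_cmod[of z] by (intro mult_left_mono) auto
  finally show ?thesis using False by (simp add: expq_def norm_divide field_simps)
qed (simp add: expq_def)

(* The function (theta^w - 1) / w, continued analytically to w = 0, times exp (c y) on the half line. *)
definition half_kernel :: "complex \<Rightarrow> complex \<Rightarrow> real \<Rightarrow> complex" where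
  "half_kernel w c y = indicator {0..} y *\<^sub>R
     (of_real (ln (Phi y)) * expq (w * of_real (ln (Phi y))) * exp (c * of_real y))"

definition Xi_integrand :: "real \<Rightarrow> complex \<Rightarrow> complex \<Rightarrow> complex" where
  "Xi_integrand y w s = half_kernel w (w - s) y + half_kernel w s y"

text \<open>The summand 1/2 is what the factor s (s - w) / (2 w) makes of the polar terms -1/(w - s)
  - 1/s of the zeta integral; the division by w has gone into \<open>half_kernel\<close>.\<close>

definition Xi :: "complex \<Rightarrow> complex \<Rightarrow> complex" where
  "Xi w s = 1 / 2 + s * (s - w) / 2 * (LINT y|lborel. Xi_integrand y w s)"

lemma half_kernel_measurable [measurable]: "half_kernel w c \<in> borel_measurable borel"
  unfolding half_kernel_def[abs_def] by measurable

lemma Xi_integrand_measurable [measurable]: "(\<lambda>y. Xi_integrand y w s) \<in> borel_measurable borel"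
  unfolding Xi_integrand_def by measurable

lemma kernel_integrable:
  assumes "A > 0"
  shows "integrable lborel (\<lambda>y. exp (A * y - pi * exp (2 * y)))"
proof -
  have "integrable lborel (\<lambda>y. norm (exp (complex_of_real A * of_real y - of_real (pi * exp (2*y)))))"
    by (intro integrable_norm Mellin_gaussian) (use assms in auto)
  thus ?thesis by simp
qed

text \<open>For y \<ge> 0, \<open>ln (Phi y)\<close> is at most 4 and doubly exponentially small.
  The kernel therefore beats every factor exp(c y), which is why the integrals over it are entire in
  both variables.\<close>

lemma norm_half_kernel_le:
  assumes "Re c \<le> A"
  shows "norm (half_kernel w c y) \<le> 4 * exp (4 * norm w) * exp (A * y - pi * exp (2 * y))"
proof (cases "y \<ge> 0")
  case True
  let ?l = "ln (Phi y)"
  note b = Phi_bounds[OF True]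
  have "norm (of_real ?l * expq (w * of_real ?l)) \<le> (4 * exp (- pi * exp (2 * y))) * exp (4 * norm w)"
    unfolding norm_mult
  proof (intro mult_mono)
    have "norm (expq (w * of_real ?l)) \<le> exp (norm w * ?l)" using norm_expq_le[of "w * of_real ?l"] b by (simp add: norm_mult)
    also have "\<dots> \<le> exp (4 * norm w)" using mult_left_mono[OF b(4), of "norm w"] by (simp add: mult.commute)
    finally show "norm (expq (w * of_real ?l)) \<le> exp (4 * norm w)" .
  qed (use b in auto)
  moreover have "norm (exp (c * of_real y)) \<le> exp (A * y)"
    using mult_right_mono[OF assms True] by simp
  ultimately have "norm (of_real ?l * expq (w * of_real ?l)) * norm (exp (c * of_real y))
     \<le> ((4 * exp (- pi * exp (2 * y))) * exp (4 * norm w)) * exp (A * y)"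
    by (intro mult_mono) auto
  also have "\<dots> = 4 * exp (4 * norm w) * exp (A * y - pi * exp (2 * y))"
    by (simp add: exp_diff exp_minus field_simps)
  finally show ?thesis using True by (simp add: half_kernel_def norm_mult)
qed (simp add: half_kernel_def)

lemma half_kernel_integrable: "integrable lborel (half_kernel w c)"
proof -
  define A where "A = \<bar>Re c\<bar> + 1"
  have "integrable lborel (\<lambda>y. 4 * exp (4 * norm w) * exp (A * y - pi * exp (2 * y)))"
    by (intro integrable_mult_right kernel_integrable) (auto simp: A_def)
  thus ?thesis
    by (rule Bochner_Integration.integrable_bound)
       (use norm_half_kernel_le[of c A w] in \<open>auto simp: A_def abs_mult\<close>)
qed

lemma norm_Xi_integrand_le:
  assumes "\<bar>Re (w - s)\<bar> \<le> A" "\<bar>Re s\<bar> \<le> A"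
  shows "norm (Xi_integrand y w s) \<le> 8 * exp (4 * norm w) * exp (A * y - pi * exp (2 * y))"
proof -
  have "norm (Xi_integrand y w s) \<le> 4 * exp (4 * norm w) * exp (A * y - pi * exp (2 * y))
          + 4 * exp (4 * norm w) * exp (A * y - pi * exp (2 * y))"
    unfolding Xi_integrand_def by (intro norm_triangle_mono norm_half_kernel_le) (use assms in auto)
  thus ?thesis by simp
qed

lemma Xi_integrand_integrable: "integrable lborel (\<lambda>y. Xi_integrand y w s)"
  unfolding Xi_integrand_def by (intro Bochner_Integration.integrable_add half_kernel_integrable)

lemma Xi_entire2: "entire2 Xi"
proof -
  \<comment> \<open>\<open>a\<close> and \<open>b\<close> are the partial derivatives of
    \<open>Xi_integrand\<close> in w and in s.\<close>
  define a where "a y w s = indicator {0..} y *\<^sub>R (of_real (ln (Phi y)) *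
     (deriv expq (w * of_real (ln (Phi y))) * of_real (ln (Phi y)) * (exp ((w - s) * of_real y) + exp (s * of_real y)) +
      expq (w * of_real (ln (Phi y))) * exp ((w - s) * of_real y) * of_real y))" for y w s
  define b where "b y w s = indicator {0..} y *\<^sub>R (of_real (ln (Phi y)) *
     expq (w * of_real (ln (Phi y))) * (exp (s * of_real y) - exp ((w - s) * of_real y)) * of_real y)" for y w s
  have I: "entire2 (\<lambda>w s. LINT y|lborel. Xi_integrand y w s)"
  proof (rule entire2_param_integral[where a = a and b = b])
    fix y w s h k
    let ?l = "of_real (ln (Phi y)) :: complex"
    have E: "(expq has_field_derivative deriv expq z) (at z)" for z
      by (rule holomorphic_derivI[OF expq_holomorphic]) auto
    have D: "((\<lambda>z. expq ((w + z * h) * ?l)) has_field_derivative deriv expq (w * ?l) * (h * ?l)) (at 0)"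
      by (rule DERIV_chain2[where f = expq]) (use E[of "w * ?l"] in \<open>auto intro!: derivative_eq_intros\<close>)
    show "((\<lambda>z. Xi_integrand y (w + z * h) (s + z * k)) has_field_derivative (a y w s * h + b y w s * k)) (at 0)"
      unfolding Xi_integrand_def half_kernel_def a_def b_def
      by (rule derivative_eq_intros D refl | simp add: scaleR_conv_of_real algebra_simps)+
  next
    fix R :: real
    define A where "A = 2 * \<bar>R\<bar> + 1"
    have "norm (Xi_integrand y w s) \<le> 8 * exp (4 * \<bar>R\<bar>) * exp (A * y - pi * exp (2 * y))"
      if "norm w \<le> R" "norm s \<le> R" for y w s
    proof -
      have r: "\<bar>Re w\<bar> \<le> R" "\<bar>Re s\<bar> \<le> R" using abs_Re_le_cmod order_trans that by blast+
      have "norm (Xi_integrand y w s) \<le> 8 * exp (4 * norm w) * exp (A * y - pi * exp (2 * y))"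
        by (rule norm_Xi_integrand_le) (use r in \<open>auto simp: A_def\<close>)
      also have "\<dots> \<le> 8 * exp (4 * \<bar>R\<bar>) * exp (A * y - pi * exp (2 * y))"
        using that by (intro mult_right_mono mult_left_mono) auto
      finally show ?thesis .
    qed
    moreover have "integrable lborel (\<lambda>y. 8 * exp (4 * \<bar>R\<bar>) * exp (A * y - pi * exp (2 * y)))"
      by (intro integrable_mult_right kernel_integrable) (auto simp: A_def)
    ultimately show "\<exists>M. integrable lborel M \<and> (\<forall>y w s. norm w \<le> R \<longrightarrow> norm s \<le> R \<longrightarrow> norm (Xi_integrand y w s) \<le> M y)"
      by blast
  qed simp
  show ?thesis unfolding entire2_def
  proof (intro allI)
    fix w s
    define J where "J w s = (LINT y|lborel. Xi_integrand y w s)" for w s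
    obtain A B where AB: "((\<lambda>(x, y). J x y) has_derivative (\<lambda>(h, k). A * h + B * k)) (at (w, s))"
      using I unfolding entire2_def J_def by blast
    have AB': "((\<lambda>p. J (fst p) (snd p)) has_derivative (\<lambda>p. A * fst p + B * snd p)) (at (w, s))"
      using AB unfolding case_prod_unfold .
    have "((\<lambda>p. 1 / 2 + snd p * (snd p - fst p) / 2 * J (fst p) (snd p)) has_derivative
       (\<lambda>p. (s * (s - w) / 2 * A - s / 2 * J w s) * fst p + (s * (s - w) / 2 * B + (2 * s - w) / 2 * J w s) * snd p)) (at (w, s))"
      by (rule derivative_eq_intros AB' refl | simp)+ (auto simp: fun_eq_iff field_simps)
    hence "((\<lambda>(x, y). Xi x y) has_derivative (\<lambda>(h, k). (s * (s - w) / 2 * A - s / 2 * J w s) * h + (s * (s - w) / 2 * B + (2 * s - w) / 2 * J w s) * k)) (at (w, s))"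
      unfolding case_prod_unfold Xi_def J_def .
    thus "\<exists>a b. ((\<lambda>(x, y). Xi x y) has_derivative (\<lambda>(h, k). a * h + b * k)) (at (w, s))" by blast
  qed
qed

lemma Xi_functional_equation: "Xi w (w - s) = Xi w s"
proof -
  have "Xi_integrand y w (w - s) = Xi_integrand y w s" for y by (simp add: Xi_integrand_def add.commute)
  moreover have "(w - s) * (w - s - w) = s * (s - w)" by (simp add: algebra_simps)
  ultimately show ?thesis by (simp add: Xi_def)
qed

text \<open>The integral is bounded on each vertical strip, so only the factor s (s - w) grows. How
  \<open>C\<close> depends on \<open>w\<close> is left open: the bound serves as the a priori growth
  condition of Phragmen-Lindelof, and there the constant drops out.\<close>

lemma Xi_growth:
  "\<exists>C. \<forall>s. \<bar>Re s\<bar> \<le> A \<longrightarrow> norm (Xi w s) \<le> C * (1 + norm s)\<^sup>2"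
proof -
  define B where "B = \<bar>A\<bar> + \<bar>Re w\<bar> + 1"
  define K where "K = (LINT y|lborel. 8 * exp (4 * norm w) * exp (B * y - pi * exp (2 * y)))"
  have i: "integrable lborel (\<lambda>y. 8 * exp (4 * norm w) * exp (B * y - pi * exp (2 * y)))"
    by (intro integrable_mult_right kernel_integrable) (auto simp: B_def)
  have K: "K \<ge> 0" unfolding K_def by (intro integral_nonneg_AE) auto
  have "norm (Xi w s) \<le> (1 / 2 + (1 + norm w) * K) * (1 + norm s)\<^sup>2" if s: "\<bar>Re s\<bar> \<le> A" for s
  proof -
    have "norm (LINT y|lborel. Xi_integrand y w s) \<le> K"
      unfolding K_def
    proof (rule order_trans[OF integral_norm_bound], rule integral_mono[OF integrable_norm[OF Xi_integrand_integrable] i])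
      fix y
      show "norm (Xi_integrand y w s) \<le> 8 * exp (4 * norm w) * exp (B * y - pi * exp (2 * y))"
        by (rule norm_Xi_integrand_le) (use s in \<open>auto simp: B_def\<close>)
    qed
    moreover have "norm (s * (s - w) / 2) \<le> norm s * (norm s + norm w) / 2"
      unfolding norm_mult norm_divide
      using mult_left_mono[OF norm_triangle_ineq4[of s w], of "norm s"] by simp
    ultimately have "norm (s * (s - w) / 2 * (LINT y|lborel. Xi_integrand y w s)) \<le> norm s * (norm s + norm w) / 2 * K"
      unfolding norm_mult[of "s * (s - w) / 2"] by (intro mult_mono) auto
    hence "norm (Xi w s) \<le> 1 / 2 + norm s * (norm s + norm w) / 2 * K"
      unfolding Xi_def by (intro norm_triangle_mono) auto
    also have "\<dots> \<le> 1 / 2 * (1 + norm s)\<^sup>2 + (1 + norm w) * (1 + norm s)\<^sup>2 * K"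
    proof (intro add_mono mult_right_mono K)
      have 1: "(1 + norm s)\<^sup>2 = 1 + 2 * norm s + norm s * norm s" by (simp add: power2_eq_square algebra_simps)
      show "1 / 2 \<le> 1 / 2 * (1 + norm s)\<^sup>2" unfolding 1 by simp
      have "norm s * (norm s + norm w) / 2 \<le> norm s * (norm s + norm w)" by simp
      also have "\<dots> \<le> (1 + norm s) * ((1 + norm w) * (1 + norm s))"
      proof (rule mult_mono)
        show "norm s + norm w \<le> (1 + norm w) * (1 + norm s)" by (simp add: algebra_simps)
      qed auto
      finally show "norm s * (norm s + norm w) / 2 \<le> (1 + norm w) * (1 + norm s)\<^sup>2"
        by (simp add: power2_eq_square algebra_simps)
    qed
    finally show ?thesis by (simp add: algebra_simps)
  qed
  thus ?thesis by blast
qed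

text \<open>Writing theta^w as 1 + w times (theta^w - 1)/w separates the pole -1/c from a part that
  is entire in c.\<close>

lemma exp_half_line_kernel:
  assumes "Re c < 0"
  shows "set_integrable lborel {0..} (\<lambda>y. exp (w * of_real (ln (Phi y)) + c * of_real y))"
    and "(LINT y:{0..}|lborel. exp (w * of_real (ln (Phi y)) + c * of_real y)) =
           - 1 / c + w * (LINT y|lborel. half_kernel w c y)"
proof -
  have e: "indicator {0..} y *\<^sub>R exp (w * of_real (ln (Phi y)) + c * of_real y) =
     indicator {0..} y *\<^sub>R exp (c * of_real y) + w * half_kernel w c y" for y
  proof -
    have "exp (w * of_real (ln (Phi y))) = 1 + w * of_real (ln (Phi y)) * expq (w * of_real (ln (Phi y)))"
      unfolding mult_expq by simp
    thus ?thesis by (auto simp: half_kernel_def exp_add algebra_simps indicator_def)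
  qed
  note i = exp_half_line_integral(1)[OF assms, unfolded set_integrable_def]
  note i2 = integrable_mult_right[OF half_kernel_integrable, of w w c]
  show "set_integrable lborel {0..} (\<lambda>y. exp (w * of_real (ln (Phi y)) + c * of_real y))"
    unfolding set_integrable_def e by (rule Bochner_Integration.integrable_add[OF i i2])
  show "(LINT y:{0..}|lborel. exp (w * of_real (ln (Phi y)) + c * of_real y)) =
           - 1 / c + w * (LINT y|lborel. half_kernel w c y)"
    unfolding set_lebesgue_integral_def e Bochner_Integration.integral_add[OF i i2]
    using exp_half_line_integral(2)[OF assms] by (simp add: set_lebesgue_integral_def)
qed

section \<open>The zeta integral, and its counterpart to the right of its poles\<close>

lemma ln_Phi_minus: "ln (Phi (- y)) = y + ln (Phi y)"
  using Phi_pos[of y] by (simp add: Phi_minus ln_mult)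

text \<open>With t = exp y, the transformation law turns the integrand into theta^w times exp((w -
  s) y). Folding the line at 0 gives the exponents w - s and s on the half line, and the hypotheses
  say exactly that both have negative real part.\<close>

lemma Z_integral_eq:
  assumes "Re w < Re s" "Re s < 0"
  shows "Z_integral w s = w * (LINT y|lborel. Xi_integrand y w s) - 1 / (w - s) - 1 / s"
proof -
  define h where "h y = exp (w * of_real (ln (Phi y)) + (w - s) * of_real y)" for y
  define f where "f t = indicator {0<..} t *\<^sub>R (h (ln t) / complex_of_real t)" for t
  have hm [measurable]: "h \<in> borel_measurable borel" unfolding h_def[abs_def] by measurable
  have fm: "f \<in> borel_measurable borel" unfolding f_def[abs_def] by measurable
  have fe: "(\<lambda>y. exp y *\<^sub>R f (exp y)) = h"
    by (simp add: f_def fun_eq_iff scaleR_conv_of_real)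
  have hn: "h (- y) = exp (w * of_real (ln (Phi y)) + s * of_real y)" for y
    by (simp add: h_def ln_Phi_minus algebra_simps)
  have i1: "set_integrable lborel {0..} h"
    unfolding h_def by (rule exp_half_line_kernel(1)) (use assms in simp)
  have i2: "set_integrable lborel {0..} (\<lambda>y. h (- y))"
    unfolding hn by (rule exp_half_line_kernel(1)) (use assms in simp)
  note hi = integral_split_reflect[OF i1 i2]
  have "Z_integral w s = (LINT t:{0<..}|lborel. f t)"
    unfolding Z_integral_def
  proof (rule set_lebesgue_integral_cong, simp, intro allI impI)
    fix t :: real assume "t \<in> {0<..}"
    hence t: "t > 0" by simp
    define y where "y = ln t"
    have ty: "t = exp y" using t by (simp add: y_def)
    have 1: "theta (t\<^sup>2) = Phi y" by (simp add: Phi_def ty exp_double)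
    have 2: "theta (1 / t\<^sup>2) = Phi (- y)" by (simp add: Phi_def ty exp_double exp_minus inverse_eq_divide)
    have pw: "complex_of_real x powr a = exp (a * of_real (ln x))" if "x > 0" for x a
      using that by (simp add: powr_def Ln_of_real')
    have "complex_of_real (theta (t\<^sup>2)) powr s * complex_of_real (theta (1 / t\<^sup>2)) powr (w - s) = h y"
      unfolding 1 2 pw[OF Phi_pos] ln_Phi_minus h_def exp_add[symmetric]
      by (simp add: algebra_simps)
    thus "complex_of_real (theta (t\<^sup>2)) powr s * complex_of_real (theta (1 / t\<^sup>2)) powr (w - s) / complex_of_real t = f t"
      using t by (simp add: f_def y_def)
  qed
  also have "\<dots> = (LINT y|lborel. h y)"
    using exp_substitution[OF fm] hi(1) unfolding fe by simp
  also have "\<dots> = (LINT y:{0..}|lborel. h y) + (LINT y:{0..}|lborel. h (- y))" by (rule hi(2))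
  also have "(LINT y:{0..}|lborel. h y) = - 1 / (w - s) + w * (LINT y|lborel. half_kernel w (w - s) y)"
    unfolding h_def by (rule exp_half_line_kernel(2)) (use assms in simp)
  also have "(LINT y:{0..}|lborel. h (- y)) = - 1 / s + w * (LINT y|lborel. half_kernel w s y)"
    unfolding hn by (rule exp_half_line_kernel(2)) (use assms in simp)
  finally show ?thesis
    unfolding Xi_integrand_def by (simp add: Bochner_Integration.integral_add half_kernel_integrable algebra_simps)
qed

theorem xi_Q_eq_Xi: "xi_Q = Xi"
  unfolding xi_Q_def
proof (rule the_equality)
  have eq: "Xi w s = s * (s - w) / (2 * w) * Z_integral w s" if "Re w < Re s" "Re s < 0" for w s
  proof -
    have nz: "w \<noteq> 0" "s \<noteq> 0" "s - w \<noteq> 0" "w - s \<noteq> 0" using that by auto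
    have gen: "1 / 2 + s * (s - w) / 2 * I = s * (s - w) / (2 * w) * (w * I - 1 / (w - s) - 1 / s)" for I
      using nz by (simp add: divide_simps) (simp add: algebra_simps)
    show ?thesis unfolding Z_integral_eq[OF that] Xi_def by (rule gen)
  qed
  show *: "entire2 Xi \<and> (\<forall>w s. Re w < Re s \<and> Re s < 0 \<longrightarrow> Xi w s = s * (s - w) / (2 * w) * Z_integral w s)"
    using Xi_entire2 eq by blast
  show "F = Xi" if "entire2 F \<and> (\<forall>w s. Re w < Re s \<and> Re s < 0 \<longrightarrow> F w s = s * (s - w) / (2 * w) * Z_integral w s)" for F
    by (rule entire2_unique) (use that * in auto)
qed

text \<open>Subtracting 1 from theta^w makes the integrand decay at plus infinity for every s, so
  the integral converges to the right of 0 and w. On the reflected half line the subtracted term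
  integrates to 1/s, and this restores the polar term -1/s of \<open>Z_integral_eq\<close>; the
  closed form is the same.\<close>

lemma Xi_eq_full_line_integral:
  assumes "Re w < Re s" "Re s > 0" "w \<noteq> 0"
  shows "Xi w s = s * (s - w) / (2 * w) *
    (LINT y|lborel. (exp (w * of_real (ln (Phi y))) - 1) * exp (s * of_real y))"
proof -
  define h where "h y = (exp (w * of_real (ln (Phi y))) - 1) * exp (s * of_real y)" for y
  have hp: "indicator {0..} y *\<^sub>R h y = w * half_kernel w s y" for y
    unfolding h_def half_kernel_def mult_expq[of "w * of_real (ln (Phi y))", symmetric]
    by (simp add: indicator_def)
  have hn: "h (- y) = exp (w * of_real (ln (Phi y)) + (w - s) * of_real y) - exp (- s * of_real y)" for y
    by (simp add: h_def ln_Phi_minus left_diff_distrib exp_add[symmetric] algebra_simps)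
  have c: "Re (w - s) < 0" "Re (- s) < 0" using assms by auto
  have i1: "set_integrable lborel {0..} h"
    unfolding set_integrable_def hp by (rule integrable_mult_right[OF half_kernel_integrable])
  have i2: "set_integrable lborel {0..} (\<lambda>y. h (- y))"
    unfolding hn by (intro set_integral_diff(1) exp_half_line_kernel(1) exp_half_line_integral(1) c)
  have "(LINT y|lborel. h y) = (LINT y:{0..}|lborel. h y) + (LINT y:{0..}|lborel. h (- y))"
    by (rule integral_split_reflect[OF i1 i2])
  also have "(LINT y:{0..}|lborel. h y) = w * (LINT y|lborel. half_kernel w s y)"
    unfolding set_lebesgue_integral_def hp by simp
  also have "(LINT y:{0..}|lborel. h (- y)) = (- 1 / (w - s) + w * (LINT y|lborel. half_kernel w (w - s) y)) - (- 1 / (- s))"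
    unfolding hn
    by (subst set_integral_diff(2)) (simp_all only: exp_half_line_kernel exp_half_line_integral c)
  finally have I: "(LINT y|lborel. h y) = w * (LINT y|lborel. Xi_integrand y w s) - 1 / (w - s) - 1 / s"
    unfolding Xi_integrand_def by (simp add: Bochner_Integration.integral_add half_kernel_integrable algebra_simps)
  have nz: "w \<noteq> 0" "s \<noteq> 0" "s - w \<noteq> 0" "w - s \<noteq> 0" using assms by auto
  have gen: "1 / 2 + s * (s - w) / 2 * I = s * (s - w) / (2 * w) * (w * I - 1 / (w - s) - 1 / s)" for I
    using nz by (simp add: divide_simps) (simp add: algebra_simps)
  show ?thesis unfolding h_def[symmetric] I Xi_def by (rule gen)
qed

text \<open>The power series of (theta^u - 1)/u in exp(-pi exp(2y)) is integrated term by term; n =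
  1 gives the 2, and \<open>E\<close> collects n \<ge> 2. As 2n \<le> n^2, the coefficients are at
  most 144 n^(2u+2), and the hypothesis on Re s brings the terms of \<open>E\<close> down to 144
  n^(-10).\<close>

lemma Xi_dirichlet:
  assumes u: "u > 0" and s: "Re s \<ge> 4 * u + 24"
  shows "\<exists>E. norm E \<le> 1 \<and>
    Xi (of_real u) s = s * (s - of_real u) / 4 * exp (- s / 2 * of_real (ln pi)) * Gamma (s / 2) * (2 + E)"
proof -
  obtain a :: "nat \<Rightarrow> complex" where a0: "a 0 = 0" and a1: "a 1 = 2"
    and ab: "\<And>n. n \<ge> 2 \<Longrightarrow> norm (a n) \<le> 144 * real n ^ 2 * (2 * real n) powr u"
    and as: "\<And>r. 0 \<le> r \<Longrightarrow> r < 1 \<Longrightarrow> (\<lambda>n. a n * of_real r ^ n) sums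
        of_real (((1 + 2 * (\<Sum>k. r ^ ((Suc k)\<^sup>2))) powr u - 1) / u)"
    using theta_power_coeffs[OF u] by blast
  define \<sigma> where "\<sigma> = Re s"
  have \<sigma>: "\<sigma> > 0" using s u by (simp add: \<sigma>_def)
  \<comment> \<open>Of n^(-10), the part n^(-8) is at most 1/256 and n^(-2) has a telescoping
    majorant with sum 1; so 144/256 = 9/16 bounds the whole tail.\<close>
  have tb: "norm (a (n+2)) * real (n+2) powr (- \<sigma> / 2) \<le> (9 / 16) * (1 / real (Suc n) - 1 / real (Suc (Suc n)))" for n
  proof -
    define x where "x = real (n + 2)"
    have x: "x \<ge> 2" by (simp add: x_def)
    have "(2 * x) powr u \<le> (x powr 2) powr u"
      using x u by (intro powr_mono2) (auto simp: power2_eq_square)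
    also have "(x powr 2) powr u = x powr (2 * u)" by (simp add: powr_powr)
    finally have pu: "144 * x ^ 2 * (2 * x) powr u \<le> 144 * x ^ 2 * x powr (2 * u)"
      by (intro mult_left_mono) auto
    have "norm (a (n+2)) \<le> 144 * x ^ 2 * (2 * x) powr u" unfolding x_def by (rule ab) simp
    also note pu
    finally have "norm (a (n+2)) * x powr (- \<sigma> / 2) \<le> 144 * x ^ 2 * x powr (2 * u) * x powr (- \<sigma> / 2)"
      by (intro mult_right_mono) auto
    also have "\<dots> = 144 * (x powr 2 * x powr (2 * u) * x powr (- \<sigma> / 2))"
      using x by simp
    also have "\<dots> = 144 * x powr (2 + 2 * u + - \<sigma> / 2)"
      by (simp only: powr_add)
    also have "\<dots> \<le> 144 * x powr (- 10)"
      using x s by (intro mult_left_mono powr_mono) (auto simp: \<sigma>_def)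
    also have "x powr (- 10) = x powr (- 8) * x powr (- 2)" by (simp add: powr_add[symmetric])
    also have "x powr (- 8) \<le> 2 powr (- 8)" using x by (intro powr_mono2') auto
    also have "(2::real) powr (- 8) = 1 / 256" by (simp add: powr_minus)
    also have "144 * (1 / 256 * x powr (- 2)) = (9 / 16) * (1 / x\<^sup>2)"
      using x by (simp add: powr_minus_divide)
    also have "1 / x\<^sup>2 \<le> 1 / (x - 1) - 1 / x"
    proof -
      have "1 / (x - 1) - 1 / x = 1 / ((x - 1) * x)" using x by (simp add: divide_simps)
      moreover have "1 / x\<^sup>2 \<le> 1 / ((x - 1) * x)"
        using x by (intro divide_left_mono) (auto simp: power2_eq_square)
      ultimately show ?thesis by simp
    qed
    also have "1 / (x - 1) - 1 / x = 1 / real (Suc n) - 1 / real (Suc (Suc n))" by (simp add: x_def)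
    finally show ?thesis by (simp add: x_def)
  qed
  have tel: "(\<lambda>n. (9 / 16) * (1 / real (Suc n) - 1 / real (Suc (Suc n)))) sums ((9/16) * (1 / real (Suc 0) - 0))"
    by (intro sums_mult telescope_sums' LIMSEQ_Suc lim_1_over_n)
  have exp_powr: "norm (exp (- s / 2 * of_real (ln x))) = x powr (- \<sigma> / 2)" if "x > 0" for x
    using that by (simp add: powr_def \<sigma>_def)
  define d where "d n = a n * exp (- s / 2 * of_real (ln (real n)))" for n
  have d2: "norm (d (n + 2)) \<le> (9 / 16) * (1 / real (Suc n) - 1 / real (Suc (Suc n)))" for n
    using tb[of n] unfolding d_def norm_mult by (subst exp_powr) auto
  have dsum: "summable (\<lambda>n. norm (d n))"
  proof -
    have "summable (\<lambda>n. norm (d (n + 2)))"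
    proof (rule summable_comparison_test'[OF sums_summable[OF tel]])
      show "norm (norm (d (n + 2))) \<le> (9 / 16) * (1 / real (Suc n) - 1 / real (Suc (Suc n)))" for n
        by (rule order_trans[OF _ d2]) simp
    qed
    thus ?thesis by (subst (asm) summable_iff_shift)
  qed
  define E where "E = (\<Sum>n. d (n + 2))"
  have E: "norm E \<le> 1"
  proof -
    have "norm E \<le> (\<Sum>n. (9 / 16) * (1 / real (Suc n) - 1 / real (Suc (Suc n))))"
      unfolding E_def by (rule norm_suminf_le[OF d2 sums_summable[OF tel]])
    also have "\<dots> = 9 / 16" using tel by (simp add: sums_iff)
    finally show ?thesis by simp
  qed
  have dE: "suminf d = 2 + E"
  proof -
    have "suminf d = (\<Sum>n. d (n + 2)) + (\<Sum>n<2. d n)"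
      by (rule suminf_split_initial_segment[OF summable_norm_cancel[OF dsum]])
    moreover have "(\<Sum>n<2. d n) = 2" using a1 by (simp add: numeral_2_eq_2 d_def a0)
    ultimately show ?thesis by (simp add: E_def)
  qed
  define f where "f n y = a n * exp (s * of_real y - of_real (pi * real n * exp (2 * y)))" for n y
  have fi: "integrable lborel (\<lambda>y. f n y)" for n
  proof (cases "n = 0")
    case False
    thus ?thesis unfolding f_def using Mellin_gaussian(1)[of s "pi * real n"] \<sigma> by (auto simp: \<sigma>_def)
  qed (simp add: f_def a0)
  define G where "G = Gamma (s / 2) / 2 * exp (- s / 2 * of_real (ln pi))"
  have fint: "(LINT y|lborel. f n y) = G * d n" for n
  proof (cases "n = 0")
    case False
    have "(LINT y|lborel. f n y) = a n * (Gamma (s/2) / 2 * exp (- s / 2 * of_real (ln (pi * real n))))"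
      unfolding f_def using Mellin_gaussian[of s "pi * real n"] \<sigma> False by (simp add: \<sigma>_def)
    also have "ln (pi * real n) = ln pi + ln (real n)" using False by (simp add: ln_mult)
    also have "exp (- s / 2 * of_real (ln pi + ln (real n))) = exp (- s / 2 * of_real (ln pi)) * exp (- s / 2 * of_real (ln (real n)))"
      by (simp add: exp_add[symmetric] algebra_simps)
    finally show ?thesis by (simp add: G_def d_def)
  qed (simp add: f_def d_def a0)
  \<comment> \<open>The absolute value of a term is the same Mellin integral at the real point
    \<open>\<sigma>\<close>. The integrals of absolute values are thus at most a constant times
    \<open>norm (d n)\<close>, and \<open>dsum\<close> justifies exchanging sum and
    integral.\<close>
  define Gr where "Gr = norm (Gamma (complex_of_real \<sigma> / 2) / 2 * exp (- complex_of_real \<sigma> / 2 * of_real (ln pi)))"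
  have fn: "(LINT y|lborel. norm (f n y)) \<le> Gr * norm (d n)" for n
  proof (cases "n = 0")
    case False
    have "(LINT y|lborel. norm (f n y)) = norm (a n) * (LINT y|lborel. exp (\<sigma> * y - pi * real n * exp (2 * y)))"
      by (simp add: f_def norm_mult \<sigma>_def)
    also have "(LINT y|lborel. exp (\<sigma> * y - pi * real n * exp (2 * y))) \<le> norm (complex_of_real (LINT y|lborel. exp (\<sigma> * y - pi * real n * exp (2 * y))))"
      by simp
    also have "complex_of_real (LINT y|lborel. exp (\<sigma> * y - pi * real n * exp (2 * y))) =
        (LINT y|lborel. exp (of_real \<sigma> * of_real y - of_real (pi * real n * exp (2*y))))"
      by (subst integral_complex_of_real[symmetric]) (simp add: exp_of_real[symmetric] del: exp_of_real)
    also have "\<dots> = Gamma (of_real \<sigma> / 2) / 2 * exp (- of_real \<sigma> / 2 * of_real (ln (pi * real n)))"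
      using Mellin_gaussian(2)[of "of_real \<sigma>" "pi * real n"] \<sigma> False by simp
    also have "ln (pi * real n) = ln pi + ln (real n)" using False by (simp add: ln_mult)
    also have "exp (- of_real \<sigma> / 2 * complex_of_real (ln pi + ln (real n))) =
       exp (- of_real \<sigma> / 2 * of_real (ln pi)) * exp (- of_real \<sigma> / 2 * of_real (ln (real n)))"
      by (simp add: exp_add[symmetric] algebra_simps)
    finally have "(LINT y|lborel. norm (f n y)) \<le> norm (a n) * (Gr * norm (exp (- complex_of_real \<sigma> / 2 * of_real (ln (real n)))))"
      by (simp add: Gr_def norm_mult mult_left_mono)
    also have "norm (exp (- complex_of_real \<sigma> / 2 * of_real (ln (real n)))) = norm (exp (- s / 2 * of_real (ln (real n))))"
      by (simp add: \<sigma>_def)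
    finally show ?thesis by (simp add: d_def norm_mult mult_ac)
  qed (simp add: f_def d_def a0)
  have fs: "(\<lambda>n. f n y) sums ((exp (of_real u * of_real (ln (Phi y))) - 1) * exp (s * of_real y) / of_real u)" for y
  proof -
    define r where "r = exp (- pi * exp (2 * y))"
    have r: "0 \<le> r" "r < 1" by (auto simp: r_def)
    have "r ^ ((Suc k)\<^sup>2) = exp (- pi * (real (Suc k))\<^sup>2 * exp (2 * y))" for k
      unfolding r_def exp_of_nat_mult[symmetric] by (simp add: algebra_simps)
    hence "1 + 2 * (\<Sum>k. r ^ ((Suc k)\<^sup>2)) = Phi y" by (simp add: Phi_def theta_eq_suminf)
    hence "(\<lambda>n. a n * of_real r ^ n) sums of_real ((Phi y powr u - 1) / u)" using as[OF r] by simp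
    also have "complex_of_real ((Phi y powr u - 1) / u) = (exp (of_real u * of_real (ln (Phi y))) - 1) / of_real u"
      using Phi_pos[of y] by (simp add: powr_def exp_of_real[symmetric] del: exp_of_real)
    finally have "(\<lambda>n. a n * of_real r ^ n * exp (s * of_real y)) sums
       ((exp (of_real u * of_real (ln (Phi y))) - 1) / of_real u * exp (s * of_real y))"
      by (rule sums_mult2)
    moreover have "a n * of_real r ^ n * exp (s * of_real y) = f n y" for n
    proof -
      have "complex_of_real r ^ n = exp (- of_real (pi * real n * exp (2 * y)))"
        unfolding r_def by (simp add: exp_of_nat_mult[symmetric] exp_of_real[symmetric] mult_ac del: exp_of_real)
      thus ?thesis by (simp add: f_def exp_diff exp_minus field_simps)
    qed
    ultimately show ?thesis by simp
  qed
  have fns: "summable (\<lambda>n. norm (f n y))" for y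
  proof -
    define r where "r = exp (- pi * exp (2 * y))"
    have r: "0 \<le> r" "r < 1" by (auto simp: r_def)
    \<comment> \<open>Convergence at a radius beyond \<open>r\<close> gives absolute convergence at
      \<open>r\<close>.\<close>
    define r' where "r' = (r + 1) / 2"
    have r': "0 \<le> r'" "r' < 1" "r < r'" using r by (auto simp: r'_def)
    have "summable (\<lambda>n. norm (a n * of_real r ^ n))"
      by (rule powser_insidea[of a "of_real r'"]) (use as[OF r'(1,2)] r r' in \<open>auto simp: sums_iff\<close>)
    hence "summable (\<lambda>n. norm (a n * of_real r ^ n) * norm (exp (s * of_real y)))" by (rule summable_mult2)
    moreover have "norm (a n * of_real r ^ n) * norm (exp (s * of_real y)) = norm (f n y)" for n
    proof -
      have "complex_of_real r ^ n = exp (- of_real (pi * real n * exp (2 * y)))"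
        unfolding r_def by (simp add: exp_of_nat_mult[symmetric] exp_of_real[symmetric] mult_ac del: exp_of_real)
      hence "a n * of_real r ^ n * exp (s * of_real y) = f n y"
        by (simp add: f_def exp_diff exp_minus field_simps)
      thus ?thesis by (simp only: norm_mult[symmetric])
    qed
    ultimately show ?thesis by simp
  qed
  have swap: "(LINT y|lborel. (\<Sum>n. f n y)) = (\<Sum>n. LINT y|lborel. f n y)"
  proof (rule integral_suminf)
    show "summable (\<lambda>n. LINT y|lborel. norm (f n y))"
      by (rule summable_comparison_test'[OF summable_mult[OF dsum], of 0]) (use fn in \<open>auto simp: integral_nonneg_AE\<close>)
  qed (use fi fns in auto)
  have "(LINT y|lborel. (exp (of_real u * of_real (ln (Phi y))) - 1) * exp (s * of_real y)) =
     (LINT y|lborel. of_real u * (\<Sum>n. f n y))"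
    using fs u by (intro Bochner_Integration.integral_cong refl) (simp add: sums_iff)
  also have "\<dots> = of_real u * (G * (2 + E))"
    unfolding dE[symmetric] by (simp add: swap fint suminf_mult[OF summable_norm_cancel[OF dsum]])
  finally have I: "(LINT y|lborel. (exp (of_real u * of_real (ln (Phi y))) - 1) * exp (s * of_real y)) = of_real u * (G * (2 + E))" .
  have "Xi (of_real u) s = s * (s - of_real u) / (2 * of_real u) * (of_real u * (G * (2 + E)))"
    unfolding I[symmetric] by (rule Xi_eq_full_line_integral) (use u s in auto)
  also have "\<dots> = s * (s - of_real u) / 4 * exp (- s / 2 * of_real (ln pi)) * Gamma (s / 2) * (2 + E)"
    using u by (simp add: G_def field_simps)
  finally show ?thesis using E by blast
qed

section \<open>Variation of the argument\<close>

text \<open>Seen from x, a horizontal segment subtends an angle of at most pi. If its height differs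
  from that of x, the principal branch works; otherwise the segment lies on one side of x, and a
  sign e = 1 or -1 turns it away from the branch cut.\<close>

lemma inverse_primitive_horizontal:
  fixes s0 s1 x :: complex
  assumes "Im s1 = Im s0" "x \<notin> closed_segment s0 s1"
  obtains F where "\<And>z. z \<in> closed_segment s0 s1 \<Longrightarrow> (F has_field_derivative 1 / (z - x)) (at z)"
    "\<bar>Im (F s1 - F s0)\<bar> \<le> pi"
proof -
  note result = that
  have Im_z: "Im z = Im s0" if "z \<in> closed_segment s0 s1" for z
    using that assms(1) by (auto simp: closed_segment_same_Im)
  have endpoints: "s0 \<in> closed_segment s0 s1" "s1 \<in> closed_segment s0 s1" by auto
  have pos: thesis if P: "\<And>z. z \<in> closed_segment s0 s1 \<Longrightarrow> e * (z - x) \<notin> \<real>\<^sub>\<le>\<^sub>0"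
    and sgn: "(Im (e * (s0 - x)) \<ge> 0 \<and> Im (e * (s1 - x)) \<ge> 0) \<or> (Im (e * (s0 - x)) \<le> 0 \<and> Im (e * (s1 - x)) \<le> 0)"
    and e: "e \<noteq> 0" for e :: complex
  proof (rule result[of "\<lambda>z. Ln (e * (z - x))"])
    fix z assume z: "z \<in> closed_segment s0 s1"
    have "z \<noteq> x" using assms z by auto
    thus "((\<lambda>z. Ln (e * (z - x))) has_field_derivative 1 / (z - x)) (at z)"
      using P[OF z] e by (auto intro!: derivative_eq_intros simp: field_simps)
  next
    have nz: "e * (s0 - x) \<noteq> 0" "e * (s1 - x) \<noteq> 0" using P endpoints by fastforce+
    from sgn show "\<bar>Im (Ln (e * (s1 - x)) - Ln (e * (s0 - x)))\<bar> \<le> pi"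
    proof
      assume "Im (e * (s0 - x)) \<ge> 0 \<and> Im (e * (s1 - x)) \<ge> 0"
      hence "0 \<le> Im (Ln (e * (s0 - x)))" "0 \<le> Im (Ln (e * (s1 - x)))"
        using Im_Ln_pos_le[OF nz(1)] Im_Ln_pos_le[OF nz(2)] by auto
      thus ?thesis using Im_Ln_le_pi[OF nz(1)] Im_Ln_le_pi[OF nz(2)] by (simp add: abs_le_iff)
    next
      assume *: "Im (e * (s0 - x)) \<le> 0 \<and> Im (e * (s1 - x)) \<le> 0"
      have np: "e * (s0 - x) \<notin> \<real>\<^sub>\<le>\<^sub>0" "e * (s1 - x) \<notin> \<real>\<^sub>\<le>\<^sub>0" using P endpoints by auto
      have "Im (Ln v) \<le> 0" if "Im v \<le> 0" "v \<notin> \<real>\<^sub>\<le>\<^sub>0" "v \<noteq> 0" for v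
      proof (cases "Im v = 0")
        case True
        hence "Re v > 0" using that by (auto simp: complex_nonpos_Reals_iff)
        thus ?thesis using True Im_Ln_eq_0[OF that(3)] by simp
      next
        case False
        hence "Im v < 0" using that by simp
        thus ?thesis using Im_Ln_pos_le[OF that(3)] Im_Ln_le_pi[OF that(3)] by auto
      qed
      hence "Im (Ln (e * (s0 - x))) \<le> 0" "Im (Ln (e * (s1 - x))) \<le> 0" using * np nz by auto
      thus ?thesis using mpi_less_Im_Ln[OF nz(1)] mpi_less_Im_Ln[OF nz(2)] by (simp add: abs_le_iff)
    qed
  qed
  show thesis
  proof (cases "Im s0 = Im x")
    case False
    show thesis
    proof (rule pos[of 1])
      fix z assume "z \<in> closed_segment s0 s1"
      hence "Im z = Im s0" by (rule Im_z)
      thus "1 * (z - x) \<notin> \<real>\<^sub>\<le>\<^sub>0" using False by (simp add: complex_nonpos_Reals_iff)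
    next
      show "(Im (1 * (s0 - x)) \<ge> 0 \<and> Im (1 * (s1 - x)) \<ge> 0) \<or> (Im (1 * (s0 - x)) \<le> 0 \<and> Im (1 * (s1 - x)) \<le> 0)"
        using assms(1) by (cases "Im s0 \<ge> Im x") simp_all
    qed simp
  next
    case True
    have seg: "z \<in> closed_segment s0 s1 \<longleftrightarrow> Im z = Im s0 \<and> Re z \<in> closed_segment (Re s0) (Re s1)" for z
      using assms(1) by (auto simp: closed_segment_same_Im)
    have "Re x \<notin> closed_segment (Re s0) (Re s1)" using assms(2) True seg by auto
    hence "(\<forall>y \<in> closed_segment (Re s0) (Re s1). y > Re x) \<or> (\<forall>y \<in> closed_segment (Re s0) (Re s1). y < Re x)"
      by (auto simp: closed_segment_eq_real_ivl split: if_splits)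
    thus thesis
    proof
      assume *: "\<forall>y \<in> closed_segment (Re s0) (Re s1). y > Re x"
      show thesis
      proof (rule pos[of "1"])
        fix z assume "z \<in> closed_segment s0 s1"
        hence "Im z = Im x \<and> Re z \<in> closed_segment (Re s0) (Re s1)" using seg True by simp
        thus "1 * (z - x) \<notin> \<real>\<^sub>\<le>\<^sub>0" using * by (simp add: complex_nonpos_Reals_iff not_le)
      qed (use True assms(1) in simp_all)
    next
      assume *: "\<forall>y \<in> closed_segment (Re s0) (Re s1). y < Re x"
      show thesis
      proof (rule pos[of "-1"])
        fix z assume "z \<in> closed_segment s0 s1"
        hence "Im z = Im x \<and> Re z \<in> closed_segment (Re s0) (Re s1)" using seg True by simp
        thus "-1 * (z - x) \<notin> \<real>\<^sub>\<le>\<^sub>0" using * by (simp add: complex_nonpos_Reals_iff not_le)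
      qed (use True assms(1) in simp_all)
    qed
  qed
qed

text \<open>Primitives of logarithmic derivatives add up over the factors, and each linear factor
  costs at most pi.\<close>

lemma log_primitive_product:
  fixes s0 s1 :: complex and g h :: "complex \<Rightarrow> complex"
  assumes "Im s1 = Im s0" "g holomorphic_on UNIV"
    and "\<And>z. z \<in> closed_segment s0 s1 \<Longrightarrow> g z \<noteq> 0"
    and "\<And>z. z \<in> closed_segment s0 s1 \<Longrightarrow> (h has_field_derivative deriv g z / g z) (at z)"
    and "set xs \<inter> closed_segment s0 s1 = {}"
    and "f = (\<lambda>z. prod_list (map (\<lambda>x. z - x) xs) * g z)"
  shows "\<exists>H. (\<forall>z\<in>closed_segment s0 s1. (H has_field_derivative deriv f z / f z) (at z)) \<and>
           \<bar>Im (H s1 - H s0)\<bar> \<le> pi * length xs + \<bar>Im (h s1 - h s0)\<bar>"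
  using assms(5,6)
proof (induction xs arbitrary: f)
  case Nil
  thus ?case using assms by (intro exI[of _ h]) auto
next
  case (Cons x xs)
  define k where "k = (\<lambda>z. prod_list (map (\<lambda>x. z - x) xs) * g z)"
  obtain H where H: "\<And>z. z \<in> closed_segment s0 s1 \<Longrightarrow> (H has_field_derivative deriv k z / k z) (at z)"
    "\<bar>Im (H s1 - H s0)\<bar> \<le> pi * length xs + \<bar>Im (h s1 - h s0)\<bar>"
    using Cons.IH[OF _ k_def] Cons.prems by auto
  have x: "x \<notin> closed_segment s0 s1" using Cons.prems by auto
  obtain F where F: "\<And>z. z \<in> closed_segment s0 s1 \<Longrightarrow> (F has_field_derivative 1 / (z - x)) (at z)"
    "\<bar>Im (F s1 - F s0)\<bar> \<le> pi"
    using inverse_primitive_horizontal[OF assms(1) x] by blast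
  have kh: "k holomorphic_on UNIV"
  proof -
    have "(\<lambda>z. prod_list (map (\<lambda>x. z - x) ys)) holomorphic_on UNIV" for ys :: "complex list"
      by (induction ys) (auto intro!: holomorphic_intros)
    thus ?thesis unfolding k_def by (intro holomorphic_intros assms)
  qed
  have fk: "f = (\<lambda>z. (z - x) * k z)" using Cons.prems by (simp add: k_def mult.assoc)
  have D: "((\<lambda>z. F z + H z) has_field_derivative deriv f z / f z) (at z)" if z: "z \<in> closed_segment s0 s1" for z
  proof -
    have nz: "z - x \<noteq> 0" using x z by auto
    have kz: "k z \<noteq> 0"
    proof -
      have "prod_list (map (\<lambda>x. z - x) xs) \<noteq> 0" using Cons.prems z by (auto simp: prod_list_zero_iff)
      thus ?thesis using assms(3)[OF z] by (simp add: k_def)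
    qed
    have "(k has_field_derivative deriv k z) (at z)" by (rule holomorphic_derivI[OF kh]) auto
    hence "(f has_field_derivative (k z + (z - x) * deriv k z)) (at z)"
      unfolding fk by (auto intro!: derivative_eq_intros)
    hence "deriv f z = k z + (z - x) * deriv k z" by (rule DERIV_imp_deriv)
    hence "deriv f z / f z = 1 / (z - x) + deriv k z / k z"
      using nz kz by (simp add: fk field_simps)
    thus ?thesis using F(1)[OF z] H(1)[OF z] by (auto intro!: derivative_eq_intros)
  qed
  have "\<bar>Im ((F s1 + H s1) - (F s0 + H s0))\<bar> \<le> \<bar>Im (F s1 - F s0)\<bar> + \<bar>Im (H s1 - H s0)\<bar>" by simp
  also have "\<dots> \<le> pi * length (x # xs) + \<bar>Im (h s1 - h s0)\<bar>" using F(2) H(2) by (simp add: algebra_simps)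
  finally show ?case using D by (intro exI[of _ "\<lambda>z. F z + H z"]) auto
qed

text \<open>Zeros in the disc of radius 2r are split off, at most M of them by a Jensen-type
  estimate. The zero-free cofactor has a logarithm there, whose variation
  \<open>Borel_Caratheodory\<close> bounds by 2(M+1). The zeros contribute at most pi M \<le> 4M,
  which makes 6M + 2 in total.\<close>

theorem arg_variation_horizontal:
  fixes f :: "complex \<Rightarrow> complex"
  assumes hf: "f holomorphic_on UNIV" and r: "r > 0" and nz: "f s0 \<noteq> 0"
    and bound: "\<And>s. norm (s - s0) \<le> 8 * r \<Longrightarrow> norm (f s) \<le> exp M * norm (f s0)"
    and s1: "norm (s1 - s0) \<le> r" "Im s1 = Im s0"
    and nzs: "\<And>z. z \<in> closed_segment s0 s1 \<Longrightarrow> f z \<noteq> 0"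
  shows "\<bar>Im (contour_integral (linepath s0 s1) (\<lambda>z. deriv f z / f z))\<bar> \<le> 6 * M + 2"
proof -
  have M: "M \<ge> 0"
  proof -
    have "1 * norm (f s0) \<le> exp M * norm (f s0)" using bound[of s0] r by simp
    hence "1 \<le> exp M" using nz by (simp only: mult_le_cancel_right) auto
    thus ?thesis by simp
  qed
  define P where "P xs g \<longleftrightarrow> set xs \<subseteq> cball s0 (2*r) \<and> g holomorphic_on UNIV \<and>
      f = (\<lambda>z. prod_list (map (\<lambda>x. z - x) xs) * g z)" for xs and g :: "complex \<Rightarrow> complex"
  \<comment> \<open>On the circle of radius 8r each linear factor has modulus at least 6r, and at
    \<open>s0\<close> at most 2r. By the maximum principle every zero gains a factor 1/3 for the
    cofactor; exp 1 \<le> 3 then gives the bound M for their number.\<close>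
  have g_bound: "norm (g z) \<le> exp M * norm (g s0) \<and> real (length xs) \<le> M"
    if P: "P xs g" and z: "norm (z - s0) \<le> 8 * r" for xs g z
  proof -
    define n where "n = length xs"
    have fe: "f z = prod_list (map (\<lambda>x. z - x) xs) * g z" for z using P by (simp add: P_def)
    have gh: "g holomorphic_on UNIV" using P by (simp add: P_def)
    have xs: "norm (x - s0) \<le> 2 * r" if "x \<in> set xs" for x
      using that P by (auto simp: P_def dist_norm norm_minus_commute)
    have lower: "(6 * r) ^ n \<le> norm (prod_list (map (\<lambda>x. y - x) xs))" if y: "norm (y - s0) = 8 * r" for y
      unfolding n_def using xs
    proof (induction xs)
      case (Cons x xs)
      have "8 * r \<le> norm (y - x) + norm (x - s0)" using norm_triangle_ineq[of "y - x" "x - s0"] y by simp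
      hence "6 * r \<le> norm (y - x)" using Cons.prems[of x] by simp
      moreover have "(6 * r) ^ length xs \<le> norm (prod_list (map (\<lambda>x. y - x) xs))" by (rule Cons.IH) (use Cons.prems in auto)
      ultimately show ?case using r by (simp add: norm_mult mult_mono)
    qed simp
    have upper: "norm (prod_list (map (\<lambda>x. s0 - x) xs)) \<le> (2 * r) ^ n"
      unfolding n_def using xs
    proof (induction xs)
      case (Cons x xs)
      have "norm (s0 - x) \<le> 2 * r" using Cons.prems[of x] by (simp add: norm_minus_commute)
      moreover have "norm (prod_list (map (\<lambda>x. s0 - x) xs)) \<le> (2 * r) ^ length xs" by (rule Cons.IH) (use Cons.prems in auto)
      ultimately show ?case using r by (simp add: norm_mult mult_mono)
    qed simp
    have gs0: "g s0 \<noteq> 0" using nz fe by auto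
    have mm: "norm (g y) \<le> exp M * norm (f s0) / (6 * r) ^ n" if y: "norm (y - s0) \<le> 8 * r" for y
    proof (rule maximum_modulus_frontier[of g "cball s0 (8 * r)"])
      show "g holomorphic_on interior (cball s0 (8 * r))" "continuous_on (closure (cball s0 (8 * r))) g"
        using gh by (auto intro: holomorphic_on_subset holomorphic_on_imp_continuous_on)
      show "y \<in> cball s0 (8 * r)" using y by (simp add: dist_norm norm_minus_commute)
      fix z assume "z \<in> frontier (cball s0 (8 * r))"
      hence zr: "norm (z - s0) = 8 * r" using r by (simp add: dist_norm norm_minus_commute)
      have "(6 * r) ^ n * norm (g z) \<le> norm (f z)" unfolding fe norm_mult by (intro mult_right_mono lower zr) auto
      also have "\<dots> \<le> exp M * norm (f s0)" by (rule bound) (use zr in simp)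
      finally show "norm (g z) \<le> exp M * norm (f s0) / (6 * r) ^ n" using r by (simp add: field_simps)
    qed simp
    have fs0: "norm (f s0) \<le> (2 * r) ^ n * norm (g s0)" unfolding fe norm_mult by (intro mult_right_mono upper) auto
    have "exp M * norm (f s0) / (6 * r) ^ n \<le> exp M * ((2 * r) ^ n * norm (g s0)) / (6 * r) ^ n"
      using fs0 r by (intro divide_right_mono mult_left_mono) auto
    also have "\<dots> = exp M * norm (g s0) * ((2 * r) ^ n / (6 * r) ^ n)" by simp
    also have "(2 * r) ^ n / (6 * r) ^ n = (1/3) ^ n" using r by (simp add: power_divide[symmetric])
    finally have key: "norm (g y) \<le> exp M * norm (g s0) * (1/3) ^ n" if "norm (y - s0) \<le> 8 * r" for y
      using mm[OF that] by linarith
    have "1 * norm (g s0) \<le> (exp M * (1/3) ^ n) * norm (g s0)" using key[of s0] r by (simp add: mult_ac)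
    hence "1 \<le> exp M * (1/3) ^ n" using gs0 by (simp only: mult_le_cancel_right) auto
    hence "3 ^ n \<le> exp M" by (simp add: power_one_over field_simps)
    moreover have "exp (real n) \<le> 3 ^ n"
      using power_mono[OF exp_le, of n] by (simp add: exp_of_nat_mult[symmetric])
    ultimately have "exp (real n) \<le> exp M" by linarith
    hence "real n \<le> M" by simp
    moreover have "exp M * norm (g s0) * (1/3) ^ n \<le> exp M * norm (g s0) * 1"
      by (intro mult_left_mono power_le_one) auto
    hence "norm (g z) \<le> exp M * norm (g s0)" using key[OF z] by linarith
    ultimately show ?thesis by (simp add: n_def)
  qed
  (* Splitting off n zeros costs a factor 3^n in the maximum modulus, so that n <= M and a maximal
     choice of zeros leaves a cofactor without zeros. *)
  define Q where "Q n \<longleftrightarrow> (\<exists>xs g. P xs g \<and> length xs = n)" for n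
  have "Q 0" unfolding Q_def P_def using hf by (intro exI[of _ "[]"] exI[of _ f]) auto
  moreover have "\<forall>n. Q n \<longrightarrow> n \<le> nat \<lceil>M\<rceil>"
    using g_bound[of _ _ s0] r M unfolding Q_def by (force simp: le_nat_iff le_ceiling_iff)
  ultimately obtain n where n: "Q n" "\<And>m. Q m \<Longrightarrow> m \<le> n"
    using GreatestI_nat[of Q 0] Greatest_le_nat[of Q] by metis
  from n(1) obtain xs g where P: "P xs g" and len: "length xs = n" unfolding Q_def by blast
  have gh: "g holomorphic_on UNIV" and fe: "f = (\<lambda>z. prod_list (map (\<lambda>x. z - x) xs) * g z)"
    using P by (auto simp: P_def)
  have gnz: "g x \<noteq> 0" if x: "x \<in> cball s0 (2*r)" for x
  proof
    assume gx: "g x = 0"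
    define g' where "g' z = (if z = x then deriv g x else (g z - g x) / (z - x))" for z
    have "g' holomorphic_on UNIV" unfolding g'_def by (rule pole_lemma_open[OF gh]) auto
    moreover have "g z = (z - x) * g' z" for z using gx by (simp add: g'_def)
    ultimately have "P (x # xs) g'" using P x by (auto simp: P_def mult_ac)
    hence "Q (Suc n)" unfolding Q_def using len by (intro exI[of _ "x # xs"] exI[of _ g']) auto
    thus False using n(2) by force
  qed
  have seg: "closed_segment s0 s1 \<subseteq> cball s0 r"
    by (rule closed_segment_subset) (use r s1 in \<open>auto simp: dist_norm norm_minus_commute\<close>)
  obtain h where h: "h holomorphic_on ball s0 (2*r)" "\<And>z. z \<in> ball s0 (2*r) \<Longrightarrow> exp (h z) = g z"
    using holomorphic_logarithm_exists[of "ball s0 (2*r)" g s0] gnz r holomorphic_on_subset[OF gh]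
    by (metis (no_types, lifting) ball_subset_cball centre_in_ball convex_ball mult_pos_pos open_ball subsetD subset_UNIV zero_less_numeral)
  have hd: "(h has_field_derivative deriv g z / g z) (at z)" if "z \<in> ball s0 (2*r)" for z
  proof -
    have d: "(h has_field_derivative deriv h z) (at z)" by (rule holomorphic_derivI[OF h(1) open_ball that])
    hence "((\<lambda>z. exp (h z)) has_field_derivative exp (h z) * deriv h z) (at z)"
      by (auto intro!: derivative_eq_intros)
    hence "(g has_field_derivative exp (h z) * deriv h z) (at z)"
      by (rule has_field_derivative_transform_within_open[where S = "ball s0 (2*r)"]) (use that h(2) in auto)
    hence "deriv g z = exp (h z) * deriv h z" by (rule DERIV_imp_deriv)
    thus ?thesis using d h(2)[OF that] gnz[of z] that by (simp add: field_simps)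
  qed
  have "norm ((\<lambda>w. h (s0 + w) - h s0) (s1 - s0)) \<le> 2 * norm (s1 - s0) * (M + 1) / (2 * r - norm (s1 - s0))"
  proof (rule Borel_Caratheodory)
    have "(h \<circ> (\<lambda>w. s0 + w)) holomorphic_on ball 0 (2 * r)"
      by (rule holomorphic_on_compose_gen[OF _ h(1)]) (auto intro!: holomorphic_intros simp: dist_norm)
    thus "(\<lambda>w. h (s0 + w) - h s0) holomorphic_on ball 0 (2 * r)"
      by (intro holomorphic_intros) (simp add: o_def)
    fix z :: complex assume z: "norm z < 2 * r"
    have "norm (g (s0 + z)) \<le> exp M * norm (g s0)" using g_bound[OF P, of "s0 + z"] z r by auto
    moreover have "norm (g (s0 + z)) = exp (Re (h (s0 + z)))" "norm (g s0) = exp (Re (h s0))"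
      using h(2)[of "s0 + z"] h(2)[of s0] z r by (auto simp: dist_norm norm_exp_eq_Re[symmetric])
    ultimately have "exp (Re (h (s0 + z))) \<le> exp (M + Re (h s0))" by (simp add: exp_add)
    \<comment> \<open>\<open>Borel_Caratheodory\<close> asks for a strict bound of the real part,
      hence M + 1.\<close>
    thus "Re (h (s0 + z) - h s0) < M + 1" by simp
  qed (use s1 r in auto)
  also have "\<dots> \<le> 2 * r * (M + 1) / r"
    using s1 r M by (intro frac_le mult_mono) auto
  finally have hb: "\<bar>Im (h s1 - h s0)\<bar> \<le> 2 * (M + 1)"
    using abs_Im_le_cmod[of "h s1 - h s0"] r by simp
  have "set xs \<inter> closed_segment s0 s1 = {}"
  proof (rule ccontr)
    assume "set xs \<inter> closed_segment s0 s1 \<noteq> {}"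
    then obtain x where x: "x \<in> set xs" "x \<in> closed_segment s0 s1" by blast
    have "prod_list (map (\<lambda>y. x - y) xs) = 0" using x by (force simp: prod_list_zero_iff)
    thus False using nzs[OF x(2)] fe by simp
  qed
  from log_primitive_product[OF s1(2) gh _ _ this fe, of h]
  obtain H where H: "\<forall>z\<in>closed_segment s0 s1. (H has_field_derivative deriv f z / f z) (at z)"
    "\<bar>Im (H s1 - H s0)\<bar> \<le> pi * length xs + \<bar>Im (h s1 - h s0)\<bar>"
    using gnz hd seg r by (fastforce simp: subset_iff)
  have "((\<lambda>z. deriv f z / f z) has_contour_integral (H (pathfinish (linepath s0 s1)) - H (pathstart (linepath s0 s1)))) (linepath s0 s1)"
    by (rule contour_integral_primitive[where S = "closed_segment s0 s1"]) (use H(1) in \<open>auto intro: DERIV_subset\<close>)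
  hence "contour_integral (linepath s0 s1) (\<lambda>z. deriv f z / f z) = H s1 - H s0"
    by (simp add: contour_integral_unique)
  moreover have "pi * length xs \<le> 4 * M"
    using g_bound[OF P, of s0] r pi_less_4 by (intro mult_mono) auto
  ultimately show ?thesis using H(2) hb by simp
qed

section \<open>Stirling's formula\<close>

text \<open>Both z and 1 + 1/z lie in the right half plane, so their principal logarithms add; what
  remains is the linear approximation of Ln(1 + w) for |w| \<le> 1/2.\<close>

lemma Ln_Suc_bound:
  assumes "Re z \<ge> 2"
  shows "norm (Ln (z + 1) - Ln z - 1 / z) \<le> 2 / (norm z)\<^sup>2"
proof -
  have nz: "norm z \<ge> 2" using assms complex_Re_le_cmod[of z] by linarith
  hence z: "z \<noteq> 0" by auto
  have w: "norm (1 / z) \<le> 1 / 2" using nz frac_le[of 1 1 2 "norm z"] by (simp add: norm_divide)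
  have Re1: "Re (1 + 1 / z) > 0"
    using abs_Re_le_cmod[of "1 / z"] w by simp
  hence z1: "1 + 1 / z \<noteq> 0" by (metis less_irrefl zero_complex.sel(1))
  have "Ln (z * (1 + 1 / z)) = Ln z + Ln (1 + 1 / z)"
  proof (rule Ln_times_simple[OF z z1])
    have "\<bar>Im (Ln z)\<bar> < pi / 2" "\<bar>Im (Ln (1 + 1 / z))\<bar> < pi / 2"
      using Re_Ln_pos_lt[OF z] Re_Ln_pos_lt[OF z1] assms Re1 by simp_all
    thus "- pi < Im (Ln z) + Im (Ln (1 + 1 / z))" "Im (Ln z) + Im (Ln (1 + 1 / z)) \<le> pi"
      unfolding abs_less_iff by linarith+
  qed
  moreover have "z * (1 + 1 / z) = z + 1" using z by (simp add: field_simps)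
  ultimately have "Ln (z + 1) - Ln z - 1 / z = Ln (1 + 1 / z) - 1 / z" by simp
  also have "norm \<dots> \<le> (norm (1 / z))\<^sup>2 / (1 - norm (1 / z))" by (rule Ln_approx_linear) (use w in simp)
  also have "\<dots> \<le> (norm (1 / z))\<^sup>2 / (1 / 2)" using w by (intro divide_left_mono) auto
  also have "\<dots> = 2 / (norm z)\<^sup>2" by (simp add: norm_divide power_divide)
  finally show ?thesis .
qed

text \<open>Digamma is the limit of ln m minus a partial sum of the 1/(z+n). Telescoping Ln(z+m) -
  Ln z along unit steps reduces the comparison to \<open>Ln_Suc_bound\<close>.\<close>

lemma Digamma_Ln_bound:
  assumes "Re z \<ge> 2"
  shows "norm (Digamma z - Ln z) \<le> 8 / norm z"
proof -
  have nz: "norm z \<ge> 2" using assms complex_Re_le_cmod[of z] by linarith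
  hence z: "z \<noteq> 0" by auto
  have partial: "norm (Ln (z + of_nat m) - Ln z - (\<Sum>n<m. inverse (z + of_nat n))) \<le> 8 / norm z" for m
  proof -
    have "Ln (z + of_nat m) - Ln z - (\<Sum>n<m. inverse (z + of_nat n)) =
        (\<Sum>n<m. Ln (z + of_nat n + 1) - Ln (z + of_nat n) - 1 / (z + of_nat n))"
      by (induction m) (simp_all add: algebra_simps inverse_eq_divide)
    also have "norm \<dots> \<le> (\<Sum>n<m. 4 / (norm z + real n - 1) - 4 / (norm z + real (Suc n) - 1))"
    proof (rule sum_norm_le)
      fix n
      let ?x = "norm z + real n"
      have "norm (Ln (z + of_nat n + 1) - Ln (z + of_nat n) - 1 / (z + of_nat n)) \<le> 2 / (norm (z + of_nat n))\<^sup>2"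
        by (rule Ln_Suc_bound) (use assms in simp)
      \<comment> \<open>As Re z \<ge> 0, the squared modulus is at least |z|^2 + n^2, hence at least
        half of (|z| + n)^2, whatever the argument of z. Lowering one factor by 1 afterwards makes
        the majorant telescope.\<close>
      also have "(norm (z + of_nat n))\<^sup>2 \<ge> ?x\<^sup>2 / 2"
      proof -
        have "(norm (z + of_nat n))\<^sup>2 = (norm z)\<^sup>2 + 2 * Re z * real n + (real n)\<^sup>2"
          unfolding cmod_power2 by (simp add: power2_eq_square algebra_simps)
        moreover have "2 * Re z * real n \<ge> 0" using assms by simp
        moreover have "(norm z + real n)\<^sup>2 \<le> 2 * ((norm z)\<^sup>2 + (real n)\<^sup>2)"
          using zero_le_power2[of "norm z - real n"] by (simp add: power2_eq_square algebra_simps)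
        ultimately show ?thesis by simp
      qed
      hence "2 / (norm (z + of_nat n))\<^sup>2 \<le> 2 / (?x\<^sup>2 / 2)"
        using nz by (intro divide_left_mono mult_pos_pos zero_less_power) (auto simp: add_pos_nonneg intro!: less_le_trans[of _ "?x\<^sup>2 / 2"])
      also have "2 / (?x\<^sup>2 / 2) = 4 / ?x\<^sup>2" by simp
      also have "\<dots> \<le> 4 / ((?x - 1) * ?x)"
        using nz by (intro divide_left_mono) (auto simp: power2_eq_square intro!: mult_right_mono mult_pos_pos add_pos_nonneg)
      also have "\<dots> = 4 / (?x - 1) - 4 / ?x" using nz by (simp add: divide_simps) 
      finally show "norm (Ln (z + of_nat n + 1) - Ln (z + of_nat n) - 1 / (z + of_nat n))
          \<le> 4 / (norm z + real n - 1) - 4 / (norm z + real (Suc n) - 1)" by simp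
    qed
    also have "\<dots> = 4 / (norm z - 1) - 4 / (norm z + real m - 1)" by (induction m) simp_all
    also have "\<dots> \<le> 4 / (norm z - 1)" using nz by simp
    also have "\<dots> \<le> 4 / (norm z / 2)" using nz by (intro divide_left_mono mult_pos_pos) auto
    also have "\<dots> = 8 / norm z" by simp
    finally show ?thesis .
  qed
  have "(\<lambda>m. (of_real (ln (real m)) - (\<Sum>n<m. inverse (z + of_nat n))) - Ln z + Ln (1 + z / of_nat m)) \<longlonglongrightarrow> Digamma z - Ln z + Ln (1 + 0)"
  proof -
    have "(\<lambda>m. z * (1 / of_nat m)) \<longlonglongrightarrow> z * 0" by (intro tendsto_intros lim_1_over_n)
    hence "(\<lambda>m. z / of_nat m) \<longlonglongrightarrow> 0" by simp
    hence "(\<lambda>m. Ln (1 + z / of_nat m)) \<longlonglongrightarrow> Ln (1 + 0)"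
      by (intro tendsto_Ln tendsto_add tendsto_const) auto
    thus ?thesis by (intro tendsto_add tendsto_diff tendsto_const Digamma_LIMSEQ z)
  qed
  hence A: "(\<lambda>m. (of_real (ln (real m)) - (\<Sum>n<m. inverse (z + of_nat n))) - Ln z + Ln (1 + z / of_nat m)) \<longlonglongrightarrow> Digamma z - Ln z"
    by simp
  have B: "\<forall>\<^sub>F m in sequentially. (of_real (ln (real m)) - (\<Sum>n<m. inverse (z + of_nat n))) - Ln z + Ln (1 + z / of_nat m)
      = Ln (z + of_nat m) - Ln z - (\<Sum>n<m. inverse (z + of_nat n))"
    using eventually_gt_at_top[of 0]
  proof eventually_elim
    case (elim m)
    have nz1: "1 + z / of_nat m \<noteq> 0"
    proof
      assume "1 + z / of_nat m = 0"
      hence "Re (1 + z / of_nat m) = 0" by simp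
      moreover have "Re z / real m \<ge> 0" using assms by simp
      ultimately show False by simp
    qed
    have "Ln (of_real (real m) * (1 + z / of_nat m)) = of_real (ln (real m)) + Ln (1 + z / of_nat m)"
      using Ln_times_of_real[of "real m" "1 + z / of_nat m"] Ln_of_real[of "real m"] elim nz1 by simp
    moreover have "of_real (real m) * (1 + z / of_nat m) = z + of_nat m" using elim by (simp add: field_simps)
    ultimately show ?case by simp
  qed
  show ?thesis
    by (rule Lim_norm_ubound[OF _ Lim_transform_eventually[OF A B]]) (use partial in auto)
qed

lemma norm_Digamma_le:
  assumes "Re z \<ge> 2"
  shows "norm (Digamma z) \<le> ln (norm z) + 8"
proof -
  have nz: "norm z \<ge> 2" using assms complex_Re_le_cmod[of z] by linarith
  hence z: "z \<noteq> 0" by auto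
  have "norm (Ln z) \<le> \<bar>Re (Ln z)\<bar> + \<bar>Im (Ln z)\<bar>" by (rule cmod_le)
  also have "\<dots> \<le> ln (norm z) + pi"
    using Im_Ln_le_pi[OF z] mpi_less_Im_Ln[OF z] nz by (simp add: Re_Ln[OF z] abs_le_iff)
  finally have "norm (Ln z) \<le> ln (norm z) + pi" .
  moreover have "norm (Digamma z) \<le> norm (Ln z) + norm (Digamma z - Ln z)"
    using norm_triangle_ineq[of "Ln z" "Digamma z - Ln z"] by simp
  moreover have "8 / norm z \<le> 8 / 2" using nz by (intro divide_left_mono) auto
  ultimately show ?thesis using Digamma_Ln_bound[OF assms] pi_less_4 by linarith
qed

text \<open>Mean value inequality for \<open>ln_Gamma\<close>, whose derivative is Digamma, on the
  convex set Re z \<ge> 2, |z| \<le> X. It takes the place of Stirling's formula for the modulus of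
  Gamma.\<close>

lemma norm_Gamma_ratio_le:
  assumes a: "Re a \<ge> 2" "norm a \<le> X" and b: "Re b \<ge> 2" "norm b \<le> X"
  shows "norm (Gamma a) \<le> norm (Gamma b) * exp (norm (a - b) * (ln X + 8))"
proof -
  let ?S = "{z. Re z \<ge> 2} \<inter> cball 0 X"
  have conv: "convex ?S" by (intro convex_Int convex_halfspace_Re_ge convex_cball)
  have nn: "z \<notin> \<real>\<^sub>\<le>\<^sub>0" "z \<notin> \<int>\<^sub>\<le>\<^sub>0" if "Re z \<ge> 2" for z
    using that by (auto simp: complex_nonpos_Reals_iff dest!: nonpos_Ints_subset_nonpos_Reals[THEN subsetD])
  have "norm (ln_Gamma a - ln_Gamma b) \<le> (ln X + 8) * norm (a - b)"
  proof (rule field_differentiable_bound[OF conv, of ln_Gamma Digamma])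
    fix z assume z: "z \<in> ?S"
    show "(ln_Gamma has_field_derivative Digamma z) (at z within ?S)"
      using z by (intro has_field_derivative_at_within[OF has_field_derivative_ln_Gamma_complex] nn) auto
    have "norm (Digamma z) \<le> ln (norm z) + 8" using z by (intro norm_Digamma_le) auto
    also have "ln (norm z) \<le> ln X"
      using z complex_Re_le_cmod[of z] by (intro ln_mono) auto
    finally show "norm (Digamma z) \<le> ln X + 8" by simp
  qed (use a b in auto)
  hence "\<bar>Re (ln_Gamma a - ln_Gamma b)\<bar> \<le> norm (a - b) * (ln X + 8)"
    using abs_Re_le_cmod[of "ln_Gamma a - ln_Gamma b"] by (simp add: mult.commute)
  hence "Re (ln_Gamma a) \<le> Re (ln_Gamma b) + norm (a - b) * (ln X + 8)" by simp
  hence "exp (Re (ln_Gamma a)) \<le> exp (Re (ln_Gamma b)) * exp (norm (a - b) * (ln X + 8))"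
    by (simp add: exp_add[symmetric])
  thus ?thesis
    using Gamma_complex_altdef[of a] Gamma_complex_altdef[of b] nn(2)[OF a(1)] nn(2)[OF b(1)] by simp
qed

text \<open>Along Re z = x the imaginary part has derivative Re Digamma, which is close to ln |z|;
  the sign \<open>e\<close> treats both half lines at once. The error is linear in x, hence O(u + 1)
  on the right edge of the rectangle.\<close>

lemma Im_ln_Gamma_asymp:
  assumes x: "x \<ge> 2" and Y: "Y \<ge> 0" and e: "e \<in> {1, -1}"
  shows "\<bar>e * Im (ln_Gamma (Complex x (e * Y))) - (Y * ln Y - Y)\<bar> \<le> 3 * x + 16 * ln (x + Y)"
proof -
  \<comment> \<open>The subtracted function is an antiderivative of ln |x + i y| vanishing at 0. So
    the derivative of \<open>D\<close> is Re (Digamma - Ln), of order 1/(x+y), and \<open>D\<close>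
    grows only logarithmically.\<close>
  define D where "D y = e * Im (ln_Gamma (Complex x (e * y))) - (y / 2 * ln (x\<^sup>2 + y\<^sup>2) - y + x * arctan (y / x))" for y
  have D0: "D 0 = 0"
  proof -
    have "ln_Gamma (Complex x 0) = of_real (ln_Gamma x)"
      using ln_Gamma_complex_of_real[of x] x by (simp add: complex_of_real_def)
    thus ?thesis by (simp add: D_def)
  qed
  have D': "(D has_real_derivative (Re (Digamma (Complex x (e * y)) - Ln (Complex x (e * y))))) (at y)" for y
  proof -
    let ?z = "Complex x (e * y)"
    have z0: "?z \<noteq> 0" using x by (auto simp: complex_eq_iff)
    have nn: "?z \<notin> \<real>\<^sub>\<le>\<^sub>0" using x by (auto simp: complex_nonpos_Reals_iff)
    have "((\<lambda>y. Complex x (e * y)) has_vector_derivative (of_real e * \<i>)) (at y)"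
      by (auto intro!: derivative_eq_intros simp: Complex_eq)
    hence "((ln_Gamma \<circ> (\<lambda>y. Complex x (e * y))) has_vector_derivative (of_real e * \<i>) * Digamma ?z) (at y)"
      by (rule field_vector_diff_chain_at) (rule has_field_derivative_ln_Gamma_complex[OF nn])
    hence "((\<lambda>y. Im (ln_Gamma (Complex x (e * y)))) has_vector_derivative Im ((of_real e * \<i>) * Digamma ?z)) (at y)"
      using bounded_linear.has_vector_derivative[OF bounded_linear_Im] by (force simp: o_def)
    hence 1: "((\<lambda>y. e * Im (ln_Gamma (Complex x (e * y)))) has_real_derivative e * Im ((of_real e * \<i>) * Digamma ?z)) (at y)"
      unfolding has_real_derivative_iff_has_vector_derivative[symmetric] by (rule DERIV_cmult)
    have eq: "e * Im ((of_real e * \<i>) * Digamma ?z) = Re (Digamma ?z)" using e by auto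
    from 1 have 1: "((\<lambda>y. e * Im (ln_Gamma (Complex x (e * y)))) has_real_derivative Re (Digamma ?z)) (at y)"
      unfolding eq .
    have pos: "x\<^sup>2 + y\<^sup>2 > 0" using x by (simp add: add_pos_nonneg)
    have alg: "L / 2 + y / 2 * (2 * y / (x\<^sup>2 + y\<^sup>2)) - 1 + x * (1 / (1 + (y / x)\<^sup>2) * (1 / x)) = L / 2" for L
    proof -
      have "1 + (y / x)\<^sup>2 = (x\<^sup>2 + y\<^sup>2) / x\<^sup>2" using x by (simp add: power_divide field_simps)
      hence "x * (1 / (1 + (y / x)\<^sup>2) * (1 / x)) = x\<^sup>2 / (x\<^sup>2 + y\<^sup>2)" using x by simp
      moreover have "y / 2 * (2 * y / (x\<^sup>2 + y\<^sup>2)) = y\<^sup>2 / (x\<^sup>2 + y\<^sup>2)" by (simp add: power2_eq_square)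
      moreover have "y\<^sup>2 / (x\<^sup>2 + y\<^sup>2) + x\<^sup>2 / (x\<^sup>2 + y\<^sup>2) = 1" 
        using pos unfolding add_divide_distrib[symmetric] by (metis add.commute divide_self less_irrefl)
      ultimately show ?thesis by linarith
    qed
    have "((\<lambda>y. y / 2 * ln (x\<^sup>2 + y\<^sup>2) - y + x * arctan (y / x)) has_real_derivative
        ln (x\<^sup>2 + y\<^sup>2) / 2 + y / 2 * (2 * y / (x\<^sup>2 + y\<^sup>2)) - 1 + x * (1 / (1 + (y / x)\<^sup>2) * (1 / x))) (at y)"
    proof -
      have A: "((\<lambda>y. y / 2 * ln (x\<^sup>2 + y\<^sup>2) - y) has_real_derivative
         ln (x\<^sup>2 + y\<^sup>2) / 2 + y / 2 * (2 * y / (x\<^sup>2 + y\<^sup>2)) - 1) (at y)"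
      proof -
        have "((\<lambda>y. ln (x\<^sup>2 + y\<^sup>2)) has_real_derivative (1 / (x\<^sup>2 + y\<^sup>2)) * (2 * y)) (at y)"
          by (rule DERIV_chain2[where f = ln and g = "\<lambda>y. x\<^sup>2 + y\<^sup>2", OF DERIV_ln_divide[OF pos]])
             (auto intro!: derivative_eq_intros)
        from DERIV_diff[OF DERIV_mult[OF DERIV_cdivide[OF DERIV_ident, of 2] this] DERIV_ident] show ?thesis
          by (simp add: algebra_simps)
      qed
      have "((\<lambda>y. y / x) has_real_derivative 1 / x) (at y)" by (rule DERIV_cdivide[OF DERIV_ident])
      from DERIV_cmult[OF DERIV_chain2[where f = arctan and g = "\<lambda>y. y / x", OF DERIV_arctan this], of x]
      have B: "((\<lambda>y. x * arctan (y / x)) has_real_derivative x * (1 / (1 + (y / x)\<^sup>2) * (1 / x))) (at y)"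
        by (simp add: inverse_eq_divide)
      show ?thesis using DERIV_add[OF A B] by simp
    qed
    hence 2: "((\<lambda>y. y / 2 * ln (x\<^sup>2 + y\<^sup>2) - y + x * arctan (y / x)) has_real_derivative ln (x\<^sup>2 + y\<^sup>2) / 2) (at y)"
      unfolding alg .
    have "Re (Ln ?z) = ln (sqrt (x\<^sup>2 + y\<^sup>2))" using z0 e by (auto simp: Re_Ln cmod_def)
    also have "\<dots> = ln (x\<^sup>2 + y\<^sup>2) / 2" using pos by (simp add: ln_sqrt)
    finally have eq: "Re (Digamma ?z - Ln ?z) = Re (Digamma ?z) - ln (x\<^sup>2 + y\<^sup>2) / 2" by simp
    show ?thesis unfolding D_def eq by (rule DERIV_diff[OF 1 2])
  qed
  have D'b: "\<bar>Re (Digamma (Complex x (e * y)) - Ln (Complex x (e * y)))\<bar> \<le> 16 / (x + y)" if y: "y \<ge> 0" for y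
  proof -
    have "\<bar>Re (Digamma (Complex x (e * y)) - Ln (Complex x (e * y)))\<bar> \<le> 8 / norm (Complex x (e * y))"
      by (rule order_trans[OF abs_Re_le_cmod Digamma_Ln_bound]) (use x in simp)
    also have "norm (Complex x (e * y)) \<ge> (x + y) / 2"
    proof -
      have "x \<le> norm (Complex x (e * y))" using complex_Re_le_cmod[of "Complex x (e * y)"] by simp
      moreover have "y \<le> norm (Complex x (e * y))" using abs_Im_le_cmod[of "Complex x (e * y)"] e y by (auto simp: abs_mult)
      ultimately show ?thesis by simp
    qed
    hence "8 / norm (Complex x (e * y)) \<le> 8 / ((x + y) / 2)"
      using x y by (intro divide_left_mono mult_pos_pos) (auto intro: less_le_trans[of _ "(x + y) / 2"])
    finally show ?thesis by simp
  qed
  have L': "((\<lambda>y. 16 * ln (x + y)) has_real_derivative 16 / (x + y)) (at y)" if "y \<ge> 0" for y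
    using that x by (auto intro!: derivative_eq_intros)
  have up: "D Y - 16 * ln (x + Y) \<le> D 0 - 16 * ln (x + 0)"
  proof (rule DERIV_nonpos_imp_nonincreasing[OF Y])
    fix y assume "0 \<le> y" "y \<le> Y"
    thus "\<exists>d. ((\<lambda>y. D y - 16 * ln (x + y)) has_real_derivative d) (at y) \<and> d \<le> 0"
      using DERIV_diff[OF D' L'] D'b[of y] by (intro exI conjI) (assumption | force)+
  qed
  have lo: "D 0 + 16 * ln (x + 0) \<le> D Y + 16 * ln (x + Y)"
  proof (rule DERIV_nonneg_imp_nondecreasing[OF Y])
    fix y assume "0 \<le> y" "y \<le> Y"
    thus "\<exists>d. ((\<lambda>y. D y + 16 * ln (x + y)) has_real_derivative d) (at y) \<and> 0 \<le> d"
      using DERIV_add[OF D' L'] D'b[of y] by (intro exI conjI) (assumption | force)+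
  qed
  have lx: "ln x \<ge> 0" using x by simp
  have DY: "\<bar>D Y\<bar> \<le> 16 * ln (x + Y)" using up lo D0 lx by (simp add: abs_le_iff)
  \<comment> \<open>Against Y ln Y - Y, the logarithm in this antiderivative contributes at most x
    and the arc tangent at most 2x.\<close>
  define G where "G = Y / 2 * ln (x\<^sup>2 + Y\<^sup>2) - Y + x * arctan (Y / x)"
  have G: "0 \<le> G - (Y * ln Y - Y) \<and> G - (Y * ln Y - Y) \<le> 3 * x"
  proof (cases "Y = 0")
    case False
    hence Yp: "Y > 0" using Y by simp
    have "ln (x\<^sup>2 + Y\<^sup>2) - 2 * ln Y = ln (1 + (x / Y)\<^sup>2)"
    proof -
      have "1 + (x / Y)\<^sup>2 = (x\<^sup>2 + Y\<^sup>2) / Y\<^sup>2" using Yp by (simp add: power_divide field_simps)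
      moreover have "x\<^sup>2 + Y\<^sup>2 > 0" using Yp by (simp add: add_nonneg_pos)
      ultimately show ?thesis using Yp by (simp add: ln_div ln_realpow)
    qed
    hence eq: "G - (Y * ln Y - Y) = Y / 2 * ln (1 + (x / Y)\<^sup>2) + x * arctan (Y / x)"
      unfolding G_def by (simp add: algebra_simps flip: diff_divide_distrib)
    have "ln (1 + (x / Y)\<^sup>2) \<le> ln ((1 + x / Y)\<^sup>2)"
      using x Yp by (intro ln_mono) (auto simp: power2_eq_square algebra_simps add_pos_nonneg)
    also have "\<dots> = 2 * ln (1 + x / Y)" using x Yp by (simp add: ln_realpow add_pos_nonneg)
    also have "\<dots> \<le> 2 * (x / Y)" using x Yp by (intro mult_left_mono ln_add_one_self_le_self) auto
    finally have "Y / 2 * ln (1 + (x / Y)\<^sup>2) \<le> Y / 2 * (2 * (x / Y))" using Yp by (intro mult_left_mono) auto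
    hence 1: "Y / 2 * ln (1 + (x / Y)\<^sup>2) \<le> x" using Yp by simp
    have 2: "0 \<le> Y / 2 * ln (1 + (x / Y)\<^sup>2)" using Yp by simp
    have "0 \<le> arctan (Y / x)" "arctan (Y / x) \<le> 2"
      using x Yp arctan_ubound[of "Y / x"] pi_less_4 by auto
    hence "0 \<le> x * arctan (Y / x)" "x * arctan (Y / x) \<le> x * 2" using x by (auto intro: mult_left_mono)
    thus ?thesis unfolding eq using 1 2 by linarith
  qed (use x in \<open>simp add: G_def\<close>)
  have "e * Im (ln_Gamma (Complex x (e * Y))) = D Y + G" by (simp add: D_def G_def)
  thus ?thesis using G DY by linarith
qed

section \<open>Growth in vertical strips\<close>

lemma norm_le_same_Im:
  assumes "\<bar>Re a\<bar> \<le> \<bar>Re b\<bar>" "Im a = Im b"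
  shows "norm a \<le> norm b"
  unfolding cmod_def using assms by (simp add: abs_le_square_iff)

lemma not_nonpos_Ints_Re_pos: "Re z > 0 \<Longrightarrow> z \<notin> \<int>\<^sub>\<le>\<^sub>0" for z :: complex
  by (metis complex_nonpos_Reals_iff not_less nonpos_Ints_subset_nonpos_Reals subsetD)

lemma norm_Gamma_add_nat:
  assumes "Re z \<ge> 1"
  shows "norm (Gamma z) \<le> norm (Gamma (z + of_nat k))"
proof (induction k)
  case (Suc k)
  have z: "Re (z + of_nat k) \<ge> 1" using assms by simp
  hence "z + of_nat k \<notin> \<int>\<^sub>\<le>\<^sub>0" by (intro not_nonpos_Ints_Re_pos) linarith
  hence "Gamma (z + of_nat k + 1) = (z + of_nat k) * Gamma (z + of_nat k)" by (rule Gamma_plus1)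
  hence "Gamma (z + of_nat (Suc k)) = (z + of_nat k) * Gamma (z + of_nat k)" by (simp add: add_ac)
  moreover have "1 \<le> norm (z + of_nat k)" using z complex_Re_le_cmod order_trans by blast
  ultimately have "1 * norm (Gamma (z + of_nat k)) \<le> norm (Gamma (z + of_nat (Suc k)))"
    unfolding norm_mult by (metis mult_right_mono norm_ge_zero norm_mult)
  thus ?case using Suc by simp
qed simp

lemma Gamma_nonzero_Re_pos: "Re z > 0 \<Longrightarrow> Gamma z \<noteq> 0" for z :: complex
  by (metis Gamma_eq_zero_iff complex_nonpos_Reals_iff not_less nonpos_Ints_subset_nonpos_Reals subsetD)

text \<open>The properties of xi_Q(u, .) from which zeros are counted. The constant in
  \<open>growth\<close> may depend on u and on A; the uniformity in u comes from
  \<open>dirichlet\<close> and \<open>feq\<close>.\<close>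

locale xi_like =
  fixes u :: real and f :: "complex \<Rightarrow> complex"
  assumes u: "u > 0"
    and holo: "f holomorphic_on UNIV"
    and feq: "f (of_real u - s) = f s"
    and growth: "\<exists>C. \<forall>s. \<bar>Re s\<bar> \<le> A \<longrightarrow> norm (f s) \<le> C * (1 + norm s)\<^sup>2"
    and dirichlet: "Re s \<ge> 4 * u + 24 \<Longrightarrow> \<exists>E. norm E \<le> 1 \<and>
      f s = s * (s - of_real u) / 4 * exp (- s / 2 * of_real (ln pi)) * Gamma (s / 2) * (2 + E)"
begin

lemma bounds_right:
  assumes "Re s \<ge> 4 * u + 24"
  shows "norm (f s) \<le> norm s * norm (s - of_real u) * exp (- Re s / 2 * ln pi) * norm (Gamma (s / 2))"
    and "norm s * norm (s - of_real u) / 4 * exp (- Re s / 2 * ln pi) * norm (Gamma (s / 2)) \<le> norm (f s)"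
    and "f s \<noteq> 0"
proof -
  obtain E where E: "norm E \<le> 1" and fs: "f s = s * (s - of_real u) / 4 * exp (- s / 2 * of_real (ln pi)) * Gamma (s / 2) * (2 + E)"
    using dirichlet[OF assms] by blast
  define Q where "Q = norm s * norm (s - of_real u) / 4 * exp (- Re s / 2 * ln pi) * norm (Gamma (s / 2))"
  have n: "norm (f s) = Q * norm (2 + E)" unfolding fs norm_mult norm_divide Q_def by simp
  have Q0: "Q \<ge> 0" by (simp add: Q_def)
  have E3: "norm (2 + E) \<le> 3" using norm_triangle_ineq[of 2 E] E by simp
  have E1: "1 \<le> norm (2 + E)" using norm_diff_ineq[of 2 E] E by simp
  have "norm (f s) \<le> Q * 4" unfolding n using E3 Q0 by (intro mult_left_mono) auto
  thus "norm (f s) \<le> norm s * norm (s - of_real u) * exp (- Re s / 2 * ln pi) * norm (Gamma (s / 2))"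
    by (simp add: Q_def)
  have "Q * 1 \<le> norm (f s)" unfolding n using E1 Q0 by (intro mult_left_mono) auto
  thus "norm s * norm (s - of_real u) / 4 * exp (- Re s / 2 * ln pi) * norm (Gamma (s / 2)) \<le> norm (f s)"
    by (simp add: Q_def)
  have "s \<noteq> 0" "s \<noteq> of_real u" using assms u by auto
  moreover have "Gamma (s / 2) \<noteq> 0" using assms u by (intro Gamma_nonzero_Re_pos) simp
  moreover have "2 + E \<noteq> 0" using E1 by auto
  ultimately show "f s \<noteq> 0" unfolding fs by simp
qed

text \<open>The quotient of f by (s+a)^2 pi^(-s/2) Gamma(s/2 + k) is at most 1 in modulus on both
  edges of the strip, on the right by the Dirichlet series and on the left by the functional
  equation. Hence the bound carries no unspecified constant.\<close>

lemma Phragmen_Lindelof_bound: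
  fixes k :: nat
  assumes k: "real k \<ge> 4 * u + 24" and s: "\<bar>Re s - u / 2\<bar> \<le> real k"
  shows "norm (f s) \<le> (norm (s + of_real (u + 2 * k)))\<^sup>2 * exp (- Re s / 2 * ln pi) * norm (Gamma (s / 2 + of_nat k))"
proof -
  define \<sigma> where "\<sigma> = u / 2 + real k"
  \<comment> \<open>Large enough for |s| and |s - u| to be at most |s + a| on either edge.\<close>
  define a where "a = u + 2 * real k"
  define G where "G s = (s + of_real a)\<^sup>2 * exp (- s / 2 * of_real (ln pi)) * Gamma (s / 2 + of_nat k)" for s :: complex
  define strip where "strip = {s. \<bar>Re s - u / 2\<bar> \<le> real k}"
  have Res: "u - \<sigma> \<le> Re s" "Re s \<le> \<sigma>" if "s \<in> strip" for s
    using that unfolding strip_def \<sigma>_def by (auto simp: abs_le_iff)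
  have Re12: "Re (s / 2 + of_nat k) \<ge> 12" if "s \<in> strip" for s
    using Res[OF that] k u by (simp add: \<sigma>_def)
  have Rea: "Re (s + of_real a) \<ge> 24" if "s \<in> strip" for s
    using Res[OF that] k u by (simp add: \<sigma>_def a_def)
  have Gnz: "G s \<noteq> 0" if "s \<in> strip" for s
  proof -
    have "s + of_real a \<noteq> 0" using Rea[OF that] by (metis zero_complex.sel(1) not_numeral_le_zero)
    moreover have "Gamma (s / 2 + of_nat k) \<noteq> 0" using Re12[OF that] by (intro Gamma_nonzero_Re_pos) simp
    ultimately show ?thesis by (simp add: G_def)
  qed
  define g where "g s = f s / G s" for s
  have nG: "norm (G s) = (norm (s + of_real a))\<^sup>2 * exp (- Re s / 2 * ln pi) * norm (Gamma (s / 2 + of_nat k))" for s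
    unfolding G_def norm_mult norm_power by simp
  have g_holo: "g holomorphic_on interior S" "continuous_on S g" if "S \<subseteq> strip" for S
  proof -
    have "(Gamma \<circ> (\<lambda>s. s / 2 + of_nat k)) holomorphic_on strip"
      by (rule holomorphic_on_compose_gen[OF _ holomorphic_Gamma[of "{z. Re z > 0}"]])
         (use Re12 not_nonpos_Ints_Re_pos in \<open>force intro!: holomorphic_intros\<close>)+
    hence Gh: "(\<lambda>s. Gamma (s / 2 + of_nat k)) holomorphic_on strip" by (simp add: o_def)
    have h: "(\<lambda>s. G s) holomorphic_on strip" unfolding G_def
      by (intro holomorphic_on_mult Gh) (auto intro!: holomorphic_intros)
    have "g holomorphic_on strip" unfolding g_def
      by (intro holomorphic_on_divide holomorphic_on_subset[OF holo] h Gnz) auto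
    hence "g holomorphic_on S" by (rule holomorphic_on_subset) (use that in auto)
    thus "g holomorphic_on interior S" "continuous_on S g"
      using interior_subset holomorphic_on_subset holomorphic_on_imp_continuous_on by blast+
  qed
  have edge: "norm (g s) \<le> 1" if "Re s = \<sigma> \<or> Re s = u - \<sigma>" for s
    using that
  proof
    assume R: "Re s = \<sigma>"
    have st: "s \<in> strip" using R by (simp add: strip_def \<sigma>_def)
    have "norm (f s) \<le> norm s * norm (s - of_real u) * exp (- Re s / 2 * ln pi) * norm (Gamma (s / 2))"
      using R k u by (intro bounds_right) (simp add: \<sigma>_def)
    also have "\<dots> \<le> (norm (s + of_real a) * norm (s + of_real a)) * exp (- Re s / 2 * ln pi) * norm (Gamma (s / 2 + of_nat k))"
    proof (intro mult_mono)
      show "norm s \<le> norm (s + of_real a)" "norm (s - of_real u) \<le> norm (s + of_real a)"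
        using R u by (auto intro!: norm_le_same_Im simp: a_def \<sigma>_def)
      show "norm (Gamma (s / 2)) \<le> norm (Gamma (s / 2 + of_nat k))"
        using R k u by (intro norm_Gamma_add_nat) (simp add: \<sigma>_def)
    qed auto
    also have "\<dots> = norm (G s)" by (simp add: nG power2_eq_square)
    finally show ?thesis using Gnz[OF st] by (simp add: g_def norm_divide)
  next
    assume R: "Re s = u - \<sigma>"
    have st: "s \<in> strip" using R by (simp add: strip_def \<sigma>_def)
    let ?s = "of_real u - s"
    have "norm (f s) = norm (f ?s)" by (simp add: feq)
    also have "\<dots> \<le> norm ?s * norm (?s - of_real u) * exp (- Re ?s / 2 * ln pi) * norm (Gamma (?s / 2))"
      using R k u by (intro bounds_right) (simp add: \<sigma>_def)
    also have "\<dots> \<le> (norm (s + of_real a) * norm (s + of_real a)) * exp (- Re s / 2 * ln pi) * norm (Gamma (s / 2 + of_nat k))"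
    proof (intro mult_mono)
      have "norm (s - of_real u) \<le> norm (s + of_real a)"
        using R u by (intro norm_le_same_Im) (auto simp: a_def \<sigma>_def)
      thus "norm ?s \<le> norm (s + of_real a)" by (simp add: norm_minus_commute)
      have "norm s \<le> norm (s + of_real a)"
        using R u by (intro norm_le_same_Im) (auto simp: a_def \<sigma>_def)
      thus "norm (?s - of_real u) \<le> norm (s + of_real a)" by simp
      have "Re s * ln pi \<le> Re ?s * ln pi" using R u pi_gt3 by (intro mult_right_mono) (auto simp: \<sigma>_def)
      thus "exp (- Re ?s / 2 * ln pi) \<le> exp (- Re s / 2 * ln pi)" by (simp add: algebra_simps)
      (* The shift by k is chosen to make this an equality on the left edge. *)
      have "s / 2 + of_nat k = cnj (?s / 2)" using R by (simp add: complex_eq_iff \<sigma>_def field_simps)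
      thus "norm (Gamma (?s / 2)) \<le> norm (Gamma (s / 2 + of_nat k))"
        by (simp only: cnj_Gamma[symmetric] complex_mod_cnj)
    qed auto
    also have "\<dots> = norm (G s)" by (simp add: nG power2_eq_square)
    finally show ?thesis using Gnz[OF st] by (simp add: g_def norm_divide)
  qed
  \<comment> \<open>The largest real part of s/2 + k in the strip, a reference point for bounding
    Gamma from below.\<close>
  define x2 where "x2 = u / 4 + 3 * real k / 2"
  obtain C where C: "\<And>s. \<bar>Re s\<bar> \<le> u + real k \<Longrightarrow> norm (f s) \<le> C * (1 + norm s)\<^sup>2"
    using growth[of "u + real k"] by blast
  have C0: "C \<ge> 0" using order_trans[OF norm_ge_zero C[of 0]] u by simp
  define Gx where "Gx = norm (Gamma (complex_of_real x2))"
  have Gx: "Gx > 0" unfolding Gx_def using u k Gamma_nonzero_Re_pos[of "complex_of_real x2"] by (simp add: x2_def)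
  \<comment> \<open>A priori growth of order exp(O(T log T)), with an uncontrolled constant; it only
    has to lose against exp(-\<epsilon> T^2).\<close>
  define B where "B T = 4 * C * exp (\<sigma> / 2 * ln pi) / Gx * exp ((T / 2 + x2) * (ln (T / 2 + x2) + 8))" for T
  have crude: "norm (g s) \<le> B \<bar>Im s\<bar>" if st: "s \<in> strip" for s
  proof -
    define T where "T = \<bar>Im s\<bar>"
    define z where "z = s / 2 + of_nat k"
    have Rz: "12 \<le> Re z" "Re z \<le> x2" using Re12[OF st] Res[OF st] by (auto simp: z_def x2_def \<sigma>_def)
    have Iz: "\<bar>Im z\<bar> = T / 2" by (simp add: z_def T_def)
    have "norm z \<le> \<bar>Re z\<bar> + \<bar>Im z\<bar>" by (rule cmod_le)
    hence nz: "norm z \<le> T / 2 + x2" using Rz Iz by simp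
    have "norm (of_real x2 - z) \<le> \<bar>Re (of_real x2 - z)\<bar> + \<bar>Im (of_real x2 - z)\<bar>" by (rule cmod_le)
    hence nd: "norm (of_real x2 - z) \<le> T / 2 + x2" using Rz Iz by simp
    have T0: "T \<ge> 0" by (simp add: T_def)
    have "Gx \<le> norm (Gamma z) * exp (norm (of_real x2 - z) * (ln (T / 2 + x2) + 8))"
      unfolding Gx_def using Rz nz T0 by (intro norm_Gamma_ratio_le) auto
    also have "\<dots> \<le> norm (Gamma z) * exp ((T / 2 + x2) * (ln (T / 2 + x2) + 8))"
      using nd Rz T0 by (intro mult_left_mono iffD2[OF exp_le_cancel_iff] mult_right_mono) (auto intro: add_nonneg_nonneg)
    finally have Gz: "Gx \<le> norm (Gamma z) * exp ((T / 2 + x2) * (ln (T / 2 + x2) + 8))" .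
    have sa: "1 \<le> norm (s + of_real a)" using Rea[OF st] complex_Re_le_cmod[of "s + of_real a"] by linarith
    have sb: "norm s \<le> norm (s + of_real a)"
      using Res[OF st] u k by (intro norm_le_same_Im) (auto simp: a_def \<sigma>_def abs_le_iff)
    have "norm (f s) \<le> C * (1 + norm s)\<^sup>2" using Res[OF st] u by (intro C) (auto simp: \<sigma>_def abs_le_iff)
    also have "\<dots> \<le> C * (2 * norm (s + of_real a))\<^sup>2" using sa sb C0 by (intro mult_left_mono power_mono) auto
    also have "\<dots> = (4 * C) * (norm (s + of_real a))\<^sup>2" by (simp add: power_mult_distrib)
    also have "\<dots> \<le> (4 * C) * (norm (s + of_real a))\<^sup>2 * (exp (\<sigma> / 2 * ln pi) * exp (- Re s / 2 * ln pi))"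
    proof -
      have "Re s * ln pi \<le> \<sigma> * ln pi" using Res[OF st] pi_gt3 by (intro mult_right_mono) auto
      hence "1 \<le> exp (\<sigma> / 2 * ln pi) * exp (- Re s / 2 * ln pi)" by (simp add: exp_add[symmetric])
      thus ?thesis using C0 mult_left_mono[of 1 "exp (\<sigma> / 2 * ln pi) * exp (- Re s / 2 * ln pi)" "(4 * C) * (norm (s + of_real a))\<^sup>2"] by simp
    qed
    also have "\<dots> \<le> (4 * C) * (norm (s + of_real a))\<^sup>2 * (exp (\<sigma> / 2 * ln pi) * exp (- Re s / 2 * ln pi)) *
        (norm (Gamma z) * exp ((T / 2 + x2) * (ln (T / 2 + x2) + 8)) / Gx)"
    proof -
      have "1 \<le> norm (Gamma z) * exp ((T / 2 + x2) * (ln (T / 2 + x2) + 8)) / Gx" using Gz Gx by simp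
      moreover have "0 \<le> (4 * C) * (norm (s + of_real a))\<^sup>2 * (exp (\<sigma> / 2 * ln pi) * exp (- Re s / 2 * ln pi))"
        using C0 by simp
      ultimately show ?thesis using mult_left_mono[of 1] by fastforce
    qed
    also have "\<dots> = B T * norm (G s)" by (simp add: B_def nG z_def)
    finally show ?thesis using Gnz[OF st] by (simp add: g_def norm_divide T_def divide_le_eq)
  qed
  have main: "norm (g s) \<le> exp (\<epsilon> * ((real k)\<^sup>2 - Re ((s - of_real (u / 2))\<^sup>2)))" if st: "s \<in> strip" and eps: "\<epsilon> > 0" for s \<epsilon>
  proof -
    \<comment> \<open>The additional factor has modulus exp(\<epsilon> ((Re s - u/2)^2 - (Im s)^2)).
      It tames the horizontal sides of a tall rectangle and costs at most exp(\<epsilon> k^2) on the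
      vertical ones.\<close>
    define H where "H s = g s * exp (of_real \<epsilon> * (s - of_real (u / 2))\<^sup>2)" for s
    have nH: "norm (H s) = norm (g s) * exp (\<epsilon> * ((Re s - u / 2)\<^sup>2 - (Im s)\<^sup>2))" for s
      by (simp add: H_def norm_mult power2_eq_square)
    have "((\<lambda>T. B T * exp (\<epsilon> * (real k)\<^sup>2 - \<epsilon> * T\<^sup>2)) \<longlongrightarrow> 0) at_top"
      unfolding B_def using eps by real_asymp
    hence "eventually (\<lambda>T. B T * exp (\<epsilon> * (real k)\<^sup>2 - \<epsilon> * T\<^sup>2) < 1) at_top"
      by (rule order_tendstoD) simp
    then obtain T0 where T0: "\<And>T. T \<ge> T0 \<Longrightarrow> B T * exp (\<epsilon> * (real k)\<^sup>2 - \<epsilon> * T\<^sup>2) < 1"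
      by (auto simp: eventually_at_top_linorder)
    define T1 where "T1 = max 1 (max T0 \<bar>Im s\<bar>)"
    define S where "S = cbox (Complex (u - \<sigma>) (- T1)) (Complex \<sigma> T1)"
    have Sstrip: "S \<subseteq> strip" by (auto simp: S_def strip_def in_cbox_complex_iff \<sigma>_def abs_le_iff)
    have "norm (H s) \<le> exp (\<epsilon> * (real k)\<^sup>2)"
    proof (rule maximum_modulus_frontier[of H S])
      show "H holomorphic_on interior S" unfolding H_def by (intro holomorphic_intros g_holo Sstrip)
      have "closure S = S" by (simp add: S_def)
      thus "continuous_on (closure S) H" unfolding H_def by (auto intro!: continuous_intros g_holo Sstrip)
      show "bounded S" by (simp add: S_def)
      show "s \<in> S" using Res[OF st] by (auto simp: S_def in_cbox_complex_iff T1_def)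
      fix z assume "z \<in> frontier S"
      hence z: "z \<in> S" "z \<notin> box (Complex (u - \<sigma>) (- T1)) (Complex \<sigma> T1)" by (auto simp: S_def frontier_cbox)
      have zs: "z \<in> strip" using z Sstrip by blast
      have "\<bar>Re z - u / 2\<bar> \<le> real k" using zs by (simp add: strip_def)
      hence zr: "(Re z - u / 2)\<^sup>2 \<le> (real k)\<^sup>2" using abs_le_square_iff[of "Re z - u / 2" "real k"] by simp
      consider "Re z = \<sigma> \<or> Re z = u - \<sigma>" | "\<bar>Im z\<bar> = T1"
        using z by (force simp: S_def in_cbox_complex_iff in_box_complex_iff)
      thus "norm (H z) \<le> exp (\<epsilon> * (real k)\<^sup>2)"
      proof cases
        case 1
        have "norm (H z) \<le> 1 * exp (\<epsilon> * (real k)\<^sup>2)"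
          unfolding nH
        proof (intro mult_mono edge 1)
          have "(Re z - u / 2)\<^sup>2 - (Im z)\<^sup>2 \<le> (real k)\<^sup>2" using zr zero_le_power2[of "Im z"] by linarith
          thus "exp (\<epsilon> * ((Re z - u / 2)\<^sup>2 - (Im z)\<^sup>2)) \<le> exp (\<epsilon> * (real k)\<^sup>2)" using eps by simp
        qed auto
        thus ?thesis by simp
      next
        case 2
        have Im2: "(Im z)\<^sup>2 = T1\<^sup>2" using 2 by (metis power2_abs)
        have "norm (H z) \<le> B T1 * exp (\<epsilon> * (real k)\<^sup>2 - \<epsilon> * T1\<^sup>2)"
          unfolding nH
        proof (intro mult_mono)
          show "norm (g z) \<le> B T1" using crude[OF zs] 2 by simp
          show "exp (\<epsilon> * ((Re z - u / 2)\<^sup>2 - (Im z)\<^sup>2)) \<le> exp (\<epsilon> * (real k)\<^sup>2 - \<epsilon> * T1\<^sup>2)"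
            using zr eps by (simp add: Im2 algebra_simps)
          show "0 \<le> B T1" unfolding B_def using C0 Gx by simp
        qed auto
        also have "\<dots> \<le> 1" using T0[of T1] by (intro less_imp_le) (auto simp: T1_def)
        also have "1 \<le> exp (\<epsilon> * (real k)\<^sup>2)" using eps by simp
        finally show ?thesis .
      qed
    qed
    hence "norm (g s) * exp (\<epsilon> * ((Re s - u / 2)\<^sup>2 - (Im s)\<^sup>2)) \<le> exp (\<epsilon> * (real k)\<^sup>2)" by (simp only: nH)
    hence "norm (g s) \<le> exp (\<epsilon> * (real k)\<^sup>2) / exp (\<epsilon> * ((Re s - u / 2)\<^sup>2 - (Im s)\<^sup>2))"
      by (simp add: le_divide_eq)
    also have "\<dots> = exp (\<epsilon> * (real k)\<^sup>2 - \<epsilon> * ((Re s - u / 2)\<^sup>2 - (Im s)\<^sup>2))" by (rule exp_diff[symmetric])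
    also have "\<epsilon> * (real k)\<^sup>2 - \<epsilon> * ((Re s - u / 2)\<^sup>2 - (Im s)\<^sup>2) = \<epsilon> * ((real k)\<^sup>2 - Re ((s - of_real (u / 2))\<^sup>2))"
      by (simp add: power2_eq_square algebra_simps)
    finally show ?thesis .
  qed
  have st: "s \<in> strip" using s by (simp add: strip_def)
  define c where "c = (real k)\<^sup>2 - Re ((s - of_real (u / 2))\<^sup>2)"
  \<comment> \<open>For fixed s, letting \<epsilon> tend to 0 removes the damping; the constant
    \<open>C\<close> influenced only the height of the rectangle.\<close>
  have "((\<lambda>\<epsilon>. exp (\<epsilon> * c)) \<longlongrightarrow> exp (0 * c)) (at_right 0)" by (intro tendsto_intros)
  moreover have "eventually (\<lambda>\<epsilon>. norm (g s) \<le> exp (\<epsilon> * c)) (at_right 0)"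
    using eventually_at_right_less[of 0] by eventually_elim (use main[OF st] c_def in auto)
  ultimately have "norm (g s) \<le> exp (0 * c)" by (intro tendsto_lowerbound) auto
  hence "norm (f s) \<le> norm (G s)" using Gnz[OF st] by (simp add: g_def norm_divide)
  thus ?thesis by (simp add: nG a_def)
qed

end

section \<open>Counting zeros\<close>

context xi_like
begin

(* All zeros lie in the strip |Re s - u / 2| < m. *)
definition m :: nat where "m = nat \<lceil>4 * u\<rceil> + 24"

text \<open>Abscissa of the right edge; the left edge \<open>u - \<sigma>\<close> is its mirror
  image under s -> u - s, and the rectangle has width 2m.\<close>

definition \<sigma> :: real where "\<sigma> = u / 2 + real m"

lemma m_bounds: "4 * u + 24 \<le> real m" "real m \<le> 4 * u + 25" "real m \<ge> 24" "u \<le> real m / 4"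
proof -
  have 1: "real (nat \<lceil>4 * u\<rceil>) = of_int \<lceil>4 * u\<rceil>" using u by simp
  show a: "4 * u + 24 \<le> real m" unfolding m_def of_nat_add 1 by simp
  show "real m \<le> 4 * u + 25" unfolding m_def of_nat_add 1 by (simp, linarith)
  show "real m \<ge> 24" "u \<le> real m / 4" using a u by linarith+
qed

lemma \<sigma>_ge: "\<sigma> \<ge> 4 * u + 24" "\<sigma> > 4 * u + 24" "\<sigma> \<le> 2 * real m"
  using m_bounds u by (auto simp: \<sigma>_def)

lemma nonzero_right: "Re s \<ge> \<sigma> \<Longrightarrow> f s \<noteq> 0"
  using bounds_right(3)[of s] \<sigma>_ge by simp

lemma nonzero_left: "Re s \<le> u - \<sigma> \<Longrightarrow> f s \<noteq> 0"
  using nonzero_right[of "of_real u - s"] by (simp add: feq)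

text \<open>Phragmen-Lindelof bounds f(s) from above and the Dirichlet series bounds f(s0) from
  below, both through values of Gamma at points at most 25 m apart; their quotient is exp(O(m ln
  X)).\<close>

lemma local_growth:
  fixes \<tau> :: real and s :: complex
  defines "s0 \<equiv> Complex \<sigma> \<tau>" and "X \<equiv> \<bar>\<tau>\<bar> + 100 * real m"
  assumes s: "norm (s - s0) \<le> 16 * real m"
  shows "norm (f s) \<le> exp (250 * real m * ln X) * norm (f s0)"
proof -
  note mb = m_bounds
  \<comment> \<open>The disc of radius 16 m is centred at distance m from the axis Re s = u/2, so
    half-width 17 m contains it.\<close>
  define k where "k = 17 * m"
  have k: "real k = 17 * real m" by (simp add: k_def)
  have X1: "X \<ge> 2400" using mb by (simp add: X_def)
  have Re_d: "\<bar>Re s - \<sigma>\<bar> \<le> 16 * real m" using abs_Re_le_cmod[of "s - s0"] s by (simp add: s0_def)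
  have Im_d: "\<bar>Im s - \<tau>\<bar> \<le> 16 * real m" using abs_Im_le_cmod[of "s - s0"] s by (simp add: s0_def)
  have Re_s: "\<bar>Re s - u / 2\<bar> \<le> real k"
    using Re_d unfolding k \<sigma>_def by (auto simp: abs_le_iff)
  have PL: "norm (f s) \<le> (norm (s + of_real (u + 2 * k)))\<^sup>2 * exp (- Re s / 2 * ln pi) * norm (Gamma (s / 2 + of_nat k))"
    by (rule Phragmen_Lindelof_bound[OF _ Re_s]) (use mb k in linarith)
  have b1: "norm (s + of_real (u + 2 * k)) \<le> X"
  proof -
    have "norm (s + of_real (u + 2 * k)) \<le> \<bar>Re (s + of_real (u + 2 * k))\<bar> + \<bar>Im (s + of_real (u + 2 * k))\<bar>"
      by (rule cmod_le)
    also have "\<bar>Re (s + of_real (u + 2 * k))\<bar> \<le> 53 * real m"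
      using Re_d mb u k unfolding \<sigma>_def by (auto simp: abs_le_iff)
    also have "\<bar>Im (s + of_real (u + 2 * k))\<bar> \<le> \<bar>\<tau>\<bar> + 16 * real m" using Im_d by (auto simp: abs_le_iff)
    finally show ?thesis using mb by (simp add: X_def)
  qed
  have Res0: "Re s0 = \<sigma>" "Im s0 = \<tau>" by (simp_all add: s0_def)
  have b2: "norm (Gamma (s / 2 + of_nat k)) \<le> norm (Gamma (s0 / 2)) * exp (norm (s / 2 + of_nat k - s0 / 2) * (ln X + 8))"
  proof (rule norm_Gamma_ratio_le)
    show "Re (s / 2 + of_nat k) \<ge> 2" using Re_s k mb u by (auto simp: abs_le_iff)
    show "Re (s0 / 2) \<ge> 2" using \<sigma>_ge u by (simp add: Res0)
    have "norm (s / 2 + of_nat k) \<le> \<bar>Re (s / 2 + of_nat k)\<bar> + \<bar>Im (s / 2 + of_nat k)\<bar>" by (rule cmod_le)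
    also have "\<bar>Re (s / 2 + of_nat k)\<bar> \<le> 27 * real m" using Re_s k mb u by (auto simp: abs_le_iff)
    also have "\<bar>Im (s / 2 + of_nat k)\<bar> \<le> \<bar>\<tau>\<bar> + 16 * real m" using Im_d by (auto simp: abs_le_iff)
    finally show "norm (s / 2 + of_nat k) \<le> X" using mb by (simp add: X_def)
    have "norm (s0 / 2) \<le> \<bar>Re (s0 / 2)\<bar> + \<bar>Im (s0 / 2)\<bar>" by (rule cmod_le)
    also have "\<dots> \<le> X" using \<sigma>_ge u mb by (simp add: Res0 X_def)
    finally show "norm (s0 / 2) \<le> X" .
  qed
  have "norm (s / 2 + of_nat k - s0 / 2) \<le> 25 * real m"
  proof -
    have "s / 2 + of_nat k - s0 / 2 = (s - s0) / 2 + of_nat k" by (simp add: diff_divide_distrib)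
    also have "norm \<dots> \<le> norm ((s - s0) / 2) + norm (of_nat k :: complex)" by (rule norm_triangle_ineq)
    finally show ?thesis using s k by (simp add: norm_divide)
  qed
  hence "exp (norm (s / 2 + of_nat k - s0 / 2) * (ln X + 8)) \<le> exp (25 * real m * (ln X + 8))"
    using X1 by (intro iffD2[OF exp_le_cancel_iff] mult_right_mono) auto
  hence b2': "norm (Gamma (s / 2 + of_nat k)) \<le> norm (Gamma (s0 / 2)) * exp (25 * real m * (ln X + 8))"
    using b2 by (meson mult_left_mono norm_ge_zero order_trans)
  have b3: "exp (- Re s / 2 * ln pi) \<le> exp (- \<sigma> / 2 * ln pi) * exp (16 * real m)"
  proof -
    have "ln pi \<le> ln (exp 2)" 
    proof (rule ln_mono)
      have "pi \<le> 4" using pi_less_4 by simp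
      also have "4 \<le> (1 + 1) * (1 + (1::real))" by simp
      also have "\<dots> \<le> exp 1 * exp 1" by (intro mult_mono exp_ge_add_one_self) auto
      also have "\<dots> = exp (2::real)" by (simp add: exp_add[symmetric])
      finally show "pi \<le> exp 2" .
    qed auto
    hence lp: "ln pi \<le> 2" "0 \<le> ln pi" using pi_gt3 by auto
    have "(\<sigma> - Re s) * ln pi \<le> 16 * real m * 2"
      using Re_d lp by (intro mult_mono) (auto simp: abs_le_iff)
    thus ?thesis by (simp add: exp_add[symmetric] algebra_simps)
  qed
  have lower: "exp (- \<sigma> / 2 * ln pi) * norm (Gamma (s0 / 2)) \<le> norm (f s0)"
  proof -
    have "24 \<le> norm s0" using complex_Re_le_cmod[of s0] \<sigma>_ge u by (simp add: Res0)
    moreover have "1 \<le> norm (s0 - of_real u)" using complex_Re_le_cmod[of "s0 - of_real u"] \<sigma>_ge u by (simp add: Res0)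
    ultimately have "24 * 1 \<le> norm s0 * norm (s0 - of_real u)" by (intro mult_mono) auto
    hence "1 \<le> norm s0 * norm (s0 - of_real u) / 4" by simp
    hence "1 * (exp (- \<sigma> / 2 * ln pi) * norm (Gamma (s0 / 2))) \<le>
       norm s0 * norm (s0 - of_real u) / 4 * (exp (- \<sigma> / 2 * ln pi) * norm (Gamma (s0 / 2)))"
      by (intro mult_right_mono) auto
    also have "\<dots> \<le> norm (f s0)" using bounds_right(2)[of s0] \<sigma>_ge by (simp add: Res0 mult.assoc)
    finally show ?thesis by simp
  qed
  have lX: "1 \<le> ln X"
  proof -
    have "exp 1 \<le> X" using exp_le X1 by linarith
    thus ?thesis using X1 by (simp add: ln_ge_iff)
  qed
  have "norm (f s) \<le> (norm (s + of_real (u + 2 * k)))\<^sup>2 * exp (- Re s / 2 * ln pi) * norm (Gamma (s / 2 + of_nat k))"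
    by (rule PL)
  also have "\<dots> \<le> X\<^sup>2 * (exp (- \<sigma> / 2 * ln pi) * exp (16 * real m)) * (norm (Gamma (s0 / 2)) * exp (25 * real m * (ln X + 8)))"
    by (intro mult_mono power_mono b1 b2' b3) auto
  also have "X\<^sup>2 = exp (2 * ln X)" using X1 by (simp add: exp_double)
  also have "exp (2 * ln X) * (exp (- \<sigma> / 2 * ln pi) * exp (16 * real m)) * (norm (Gamma (s0 / 2)) * exp (25 * real m * (ln X + 8)))
     = exp (2 * ln X + 16 * real m + 25 * real m * (ln X + 8)) * (exp (- \<sigma> / 2 * ln pi) * norm (Gamma (s0 / 2)))"
    by (simp only: exp_add mult_ac)
  also have "\<dots> \<le> exp (250 * real m * ln X) * norm (f s0)"
  proof (intro mult_mono lower)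
    \<comment> \<open>With ln X \<ge> 1 every term is a multiple of m ln X, and 1 + 16 + 25 + 200 =
      242.\<close>
    have "2 * ln X \<le> real m * ln X" using lX mb by (intro mult_right_mono) auto
    moreover have "real m * 1 \<le> real m * ln X" using lX by (intro mult_left_mono) auto
    moreover have "25 * real m * (ln X + 8) = 25 * (real m * ln X) + 200 * real m" by (simp add: algebra_simps)
    ultimately have "2 * ln X + 16 * real m + 25 * real m * (ln X + 8) \<le> 250 * (real m * ln X)"
      using lX mb by linarith
    also have "\<dots> = 250 * real m * ln X" by simp
    finally have "2 * ln X + 16 * real m + 25 * real m * (ln X + 8) \<le> 250 * real m * ln X" .
    thus "exp (2 * ln X + 16 * real m + 25 * real m * (ln X + 8)) \<le> exp (250 * real m * ln X)" by simp
  qed auto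
  finally show ?thesis .
qed

lemma horizontal_bound:
  assumes nz: "\<And>s. Im s = \<tau> \<Longrightarrow> f s \<noteq> 0"
  shows "\<bar>Im (contour_integral (linepath (Complex \<sigma> \<tau>) (Complex (u - \<sigma>) \<tau>)) (\<lambda>z. deriv f z / f z))\<bar>
           \<le> 1500 * real m * ln (\<bar>\<tau>\<bar> + 100 * real m) + 2"
proof -
  have "\<bar>Im (contour_integral (linepath (Complex \<sigma> \<tau>) (Complex (u - \<sigma>) \<tau>)) (\<lambda>z. deriv f z / f z))\<bar>
          \<le> 6 * (250 * real m * ln (\<bar>\<tau>\<bar> + 100 * real m)) + 2"
  \<comment> \<open>r = 2m is the length of the edge, and 8r = 16m is the radius in
    \<open>local_growth\<close>.\<close>
  proof (rule arg_variation_horizontal[OF holo, where r = "2 * real m"])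
    show "0 < 2 * real m" using m_bounds by simp
    show "f (Complex \<sigma> \<tau>) \<noteq> 0" by (rule nz) simp
    show "norm (f s) \<le> exp (250 * real m * ln (\<bar>\<tau>\<bar> + 100 * real m)) * norm (f (Complex \<sigma> \<tau>))"
      if "norm (s - Complex \<sigma> \<tau>) \<le> 8 * (2 * real m)" for s
      by (rule local_growth) (use that in simp)
    have "norm (Complex (u - \<sigma>) \<tau> - Complex \<sigma> \<tau>) = \<bar>u - \<sigma> - \<sigma>\<bar>"
      by (simp add: complex_diff cmod_def)
    thus "norm (Complex (u - \<sigma>) \<tau> - Complex \<sigma> \<tau>) \<le> 2 * real m" by (simp add: \<sigma>_def)
    show "f z \<noteq> 0" if "z \<in> closed_segment (Complex \<sigma> \<tau>) (Complex (u - \<sigma>) \<tau>)" for z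
      by (rule nz) (use that in \<open>auto simp: closed_segment_same_Im\<close>)
  qed simp
  thus ?thesis by simp
qed

text \<open>A logarithm of 4 f near the right edge, assembled from principal logarithms and
  \<open>ln_Gamma\<close>. The factors s, s - u and the Dirichlet series have arguments of modulus
  at most pi, which at two end points gives 6 pi; Gamma and the power of pi give the main
  term.\<close>

lemma right_log:
  obtains L where "\<And>s. Re s = \<sigma> \<Longrightarrow> (L has_field_derivative deriv f s / f s) (at s)"
    "\<And>T. T \<ge> 0 \<Longrightarrow> \<bar>Im (L (Complex \<sigma> T) - L (Complex \<sigma> (- T))) - (T * ln (T / (2 * pi)) - T)\<bar>
        \<le> 6 * pi + 3 * \<sigma> + 32 * ln (\<sigma> / 2 + T / 2)"
proof -
  define H where "H = {s. Re s > 4 * u + 24}"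
  \<comment> \<open>The Dirichlet series factor 2 + E. Its real part is at least 1, so its principal
    logarithm is holomorphic.\<close>
  define D where "D s = f s / (s * (s - of_real u) / 4 * exp (- s / 2 * of_real (ln pi)) * Gamma (s / 2))" for s
  have H: "open H" unfolding H_def by (rule open_halfspace_Re_gt)
  have nz: "s \<noteq> 0" "s \<noteq> of_real u" "Gamma (s / 2) \<noteq> 0" "f s \<noteq> 0" if "s \<in> H" for s
    using that u bounds_right(3)[of s] Gamma_nonzero_Re_pos[of "s / 2"] by (auto simp: H_def)
  have den: "s * (s - of_real u) / 4 * exp (- s / 2 * of_real (ln pi)) * Gamma (s / 2) \<noteq> 0" if "s \<in> H" for s
    using nz[OF that] by simp
  have D1: "Re (D s) \<ge> 1" if "s \<in> H" for s
  proof -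
    have s4: "Re s \<ge> 4 * u + 24" using that by (simp add: H_def)
    obtain E where E: "norm E \<le> 1" and fs: "f s = s * (s - of_real u) / 4 * exp (- s / 2 * of_real (ln pi)) * Gamma (s / 2) * (2 + E)"
      using dirichlet[OF s4] by blast
    have "D s = 2 + E" unfolding D_def fs using den[OF that] by simp
    thus ?thesis using abs_Re_le_cmod[of E] E by simp
  qed
  have "(Gamma \<circ> (\<lambda>s. s / 2)) holomorphic_on H"
    by (rule holomorphic_on_compose_gen[OF _ holomorphic_Gamma[of "{z. Re z > 0}"]])
       (use u not_nonpos_Ints_Re_pos in \<open>force simp: H_def intro!: holomorphic_intros\<close>)+
  hence "(\<lambda>s. Gamma (s / 2)) holomorphic_on H" by (simp add: o_def)
  hence "(\<lambda>s. s * (s - of_real u) / 4 * exp (- s / 2 * of_real (ln pi)) * Gamma (s / 2)) holomorphic_on H"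
    by (intro holomorphic_on_mult) (auto intro!: holomorphic_intros)
  moreover have "f holomorphic_on H" by (rule holomorphic_on_subset[OF holo]) auto
  ultimately have D_holo: "D holomorphic_on H" unfolding D_def
    using den by (intro holomorphic_on_divide)
  define L where "L s = Ln s + Ln (s - of_real u) - s / 2 * of_real (ln pi) + ln_Gamma (s / 2) + Ln (D s)" for s
  have nn: "s \<notin> \<real>\<^sub>\<le>\<^sub>0" "s - of_real u \<notin> \<real>\<^sub>\<le>\<^sub>0" "s / 2 \<notin> \<real>\<^sub>\<le>\<^sub>0" "D s \<notin> \<real>\<^sub>\<le>\<^sub>0" if "s \<in> H" for s
    using that u D1[OF that] by (auto simp: H_def complex_nonpos_Reals_iff)
  have L_holo: "L holomorphic_on H"
  proof -
    have "(ln_Gamma \<circ> (\<lambda>s. s / 2)) holomorphic_on H"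
      by (rule holomorphic_on_compose_gen[OF _ holomorphic_ln_Gamma[of "{z. Re z > 0}"]])
         (use u in \<open>auto simp: H_def complex_nonpos_Reals_iff intro!: holomorphic_intros\<close>)
    hence G: "(\<lambda>s. ln_Gamma (s / 2)) holomorphic_on H" by (simp add: o_def)
    have A: "Ln holomorphic_on H" "(\<lambda>s. Ln (s - of_real u)) holomorphic_on H" "(\<lambda>s. Ln (D s)) holomorphic_on H"
    proof -
      show "Ln holomorphic_on H" by (rule holomorphic_on_Ln) (use nn(1) in blast)
      show "(\<lambda>s. Ln (s - of_real u)) holomorphic_on H"
        by (rule holomorphic_on_Ln'[OF nn(2)]) (auto intro!: holomorphic_intros)
      show "(\<lambda>s. Ln (D s)) holomorphic_on H" by (rule holomorphic_on_Ln'[OF nn(4) D_holo])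
    qed
    show ?thesis unfolding L_def
      by (intro holomorphic_on_add holomorphic_on_diff A G) (auto intro!: holomorphic_intros)
  qed
  have expL: "exp (L s) = 4 * f s" if s: "s \<in> H" for s
  proof -
    have D0: "D s \<noteq> 0" using D1[OF s] by auto
    have "s / 2 \<notin> \<int>\<^sub>\<le>\<^sub>0" using s u by (intro not_nonpos_Ints_Re_pos) (simp add: H_def)
    hence G: "exp (ln_Gamma (s / 2)) = Gamma (s / 2)" by (simp add: Gamma_complex_altdef)
    have "L s = Ln s + Ln (s - of_real u) + (- s / 2 * of_real (ln pi)) + ln_Gamma (s / 2) + Ln (D s)" by (simp add: L_def)
    hence "exp (L s) = s * (s - of_real u) * exp (- s / 2 * of_real (ln pi)) * Gamma (s / 2) * D s"
      using nz[OF s] D0 G by (simp only: exp_add exp_Ln) (simp add: exp_Ln)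
    also have "\<dots> = 4 * f s" unfolding D_def using den[OF s] by (simp add: field_simps)
    finally show ?thesis .
  qed
  have "(L has_field_derivative deriv f s / f s) (at s)" if "Re s = \<sigma>" for s
  proof -
    have s: "s \<in> H" using that \<sigma>_ge by (simp add: H_def)
    have d: "(L has_field_derivative deriv L s) (at s)" by (rule holomorphic_derivI[OF L_holo H s])
    hence "((\<lambda>s. exp (L s)) has_field_derivative exp (L s) * deriv L s) (at s)"
      by (auto intro!: derivative_eq_intros)
    hence "((\<lambda>s. 4 * f s) has_field_derivative exp (L s) * deriv L s) (at s)"
      by (rule has_field_derivative_transform_within_open[OF _ H s]) (simp add: expL)
    hence "((\<lambda>s. (4 * f s) / 4) has_field_derivative (exp (L s) * deriv L s) / 4) (at s)"
      by (rule DERIV_cdivide)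
    hence "deriv f s = exp (L s) * deriv L s / 4" by (simp add: DERIV_imp_deriv)
    hence "deriv f s / f s = deriv L s" using expL[OF s] nz[OF s] by simp
    thus ?thesis using d by simp
  qed
  moreover have "\<bar>Im (L (Complex \<sigma> T) - L (Complex \<sigma> (- T))) - (T * ln (T / (2 * pi)) - T)\<bar>
        \<le> 6 * pi + 3 * \<sigma> + 32 * ln (\<sigma> / 2 + T / 2)" if T: "T \<ge> 0" for T
  proof -
    let ?a = "Complex \<sigma> T" and ?b = "Complex \<sigma> (- T)"
    have ab: "?a \<in> H" "?b \<in> H" using \<sigma>_ge by (auto simp: H_def)
    have LnB: "\<bar>Im (Ln v)\<bar> \<le> pi" if "v \<notin> \<real>\<^sub>\<le>\<^sub>0" for v
      using that Im_Ln_le_pi[of v] mpi_less_Im_Ln[of v] by (cases "v = 0") (auto simp: abs_le_iff)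
    define P where "P s = Im (Ln s) + Im (Ln (s - of_real u)) + Im (Ln (D s))" for s
    have P: "\<bar>P s\<bar> \<le> 3 * pi" if "s \<in> H" for s
      unfolding P_def using LnB[OF nn(1)[OF that]] LnB[OF nn(2)[OF that]] LnB[OF nn(4)[OF that]] by linarith
    have half: "?a / 2 = Complex (\<sigma> / 2) (T / 2)" "?b / 2 = Complex (\<sigma> / 2) (- (T / 2))"
      by (simp_all add: complex_eq_iff)
    have ImL: "Im (L ?a) = P ?a - T / 2 * ln pi + Im (ln_Gamma (Complex (\<sigma> / 2) (T / 2)))"
       "Im (L ?b) = P ?b + T / 2 * ln pi + Im (ln_Gamma (Complex (\<sigma> / 2) (- (T / 2))))"
      unfolding L_def P_def half by simp_all
    define Y where "Y = T / 2"
    have x2: "\<sigma> / 2 \<ge> 2" using \<sigma>_ge u by simp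
    have G: "\<bar>Im (ln_Gamma (Complex (\<sigma> / 2) Y)) - (Y * ln Y - Y)\<bar> \<le> 3 * (\<sigma> / 2) + 16 * ln (\<sigma> / 2 + Y)"
       "\<bar>- Im (ln_Gamma (Complex (\<sigma> / 2) (- Y))) - (Y * ln Y - Y)\<bar> \<le> 3 * (\<sigma> / 2) + 16 * ln (\<sigma> / 2 + Y)"
      using Im_ln_Gamma_asymp[OF x2, of Y 1] Im_ln_Gamma_asymp[OF x2, of Y "-1"] T by (simp_all add: Y_def)
    \<comment> \<open>With Y = T/2, the two ends contribute 2 (Y ln Y - Y) through Gamma and -T ln
      pi through pi^(-s/2).\<close>
    have eF: "T * ln (T / (2 * pi)) - T = 2 * (Y * ln Y - Y) - T * ln pi"
    proof (cases "T = 0")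
      case False
      hence "ln (T / (2 * pi)) = ln (Y / pi)" by (simp add: Y_def)
      also have "\<dots> = ln Y - ln pi"
      proof -
        have "Y > 0" using T False by (simp add: Y_def)
        thus ?thesis by (simp add: ln_div)
      qed
      finally have e: "ln (T / (2 * pi)) = ln Y - ln pi" .
      show ?thesis unfolding e by (simp add: Y_def algebra_simps)
    qed (simp add: Y_def)
    have eD: "Im (L ?a - L ?b) = (P ?a - P ?b) - T * ln pi + Im (ln_Gamma (Complex (\<sigma> / 2) Y)) - Im (ln_Gamma (Complex (\<sigma> / 2) (- Y)))"
      unfolding minus_complex.sel ImL Y_def by simp
    have "\<bar>D - F\<bar> \<le> 6 * p + 3 * x + 32 * l"
      if "D = (P1 - P2) - t + G1 - G2" "F = 2 * A - t" "\<bar>P1\<bar> \<le> 3 * p" "\<bar>P2\<bar> \<le> 3 * p"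
        "\<bar>G1 - A\<bar> \<le> 3 * (x / 2) + 16 * l" "\<bar>- G2 - A\<bar> \<le> 3 * (x / 2) + 16 * l"
      for D F p x l P1 P2 t G1 G2 A :: real
      using that by linarith
    from this[OF eD eF P[OF ab(1)] P[OF ab(2)] G] show ?thesis unfolding Y_def .
  qed
  ultimately show ?thesis using that by blast
qed

section \<open>The argument principle and the final estimate\<close>

definition zeros :: "real \<Rightarrow> complex set" where
  "zeros T = {\<rho>. f \<rho> = 0 \<and> \<bar>Im \<rho>\<bar> \<le> T}"

lemma zeros_strip: "\<rho> \<in> zeros T \<Longrightarrow> u - \<sigma> < Re \<rho> \<and> Re \<rho> < \<sigma>"
  using nonzero_right nonzero_left by (force simp: zeros_def not_le[symmetric])

lemma not_constant: "f \<rho> = 0 \<Longrightarrow> \<not> f constant_on UNIV"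
  using nonzero_right[of "of_real \<sigma>"] by (force simp: constant_on_def)

lemma finite_zeros: "finite (zeros T)"
proof (cases "zeros T = {}")
  case False
  then obtain \<rho> where \<rho>: "f \<rho> = 0" by (auto simp: zeros_def)
  let ?K = "cbox (Complex (u - \<sigma>) (- T)) (Complex \<sigma> T)"
  have "finite {z \<in> ?K. f z = 0}"
    by (rule holomorphic_compact_finite_zeros[OF holo _ _ compact_cbox _ not_constant[OF \<rho>]]) auto
  moreover have "zeros T \<subseteq> {z \<in> ?K. f z = 0}"
    using zeros_strip[of _ T] by (auto simp: in_cbox_complex_iff zeros_def abs_le_iff less_imp_le)
  ultimately show ?thesis by (rule rev_finite_subset)
qed simp

definition N :: "real \<Rightarrow> nat" where "N T = (\<Sum>\<rho>\<in>zeros T. nat (zorder f \<rho>))"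

lemma argument_principle_count:
  assumes T: "T > 0" and nz: "\<And>s. \<bar>Im s\<bar> = T \<Longrightarrow> f s \<noteq> 0"
  shows "contour_integral (rectpath (Complex (u - \<sigma>) (- T)) (Complex \<sigma> T)) (\<lambda>s. deriv f s / f s) = 2 * pi * \<i> * of_nat (N T)"
proof -
  let ?a = "Complex (u - \<sigma>) (- T)" and ?b = "Complex \<sigma> T"
  \<comment> \<open>An open neighbourhood of the closed rectangle; zeros in the surplus region have
    winding number 0 and drop out.\<close>
  let ?S = "box (Complex (u - \<sigma> - 1) (- T - 1)) (Complex (\<sigma> + 1) (T + 1))"
  let ?pz = "{w \<in> ?S. f w = 0}"
  have le: "Re ?a \<le> Re ?b" "Im ?a \<le> Im ?b" using T \<sigma>_ge u by auto
  have sub: "cbox ?a ?b \<subseteq> ?S" by (auto simp: in_cbox_complex_iff in_box_complex_iff)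
  have pz_sub: "?pz \<subseteq> zeros (T + 1)" by (auto simp: zeros_def in_box_complex_iff abs_le_iff)
  have fin: "finite ?pz" by (rule finite_subset[OF pz_sub finite_zeros])
  have path: "f z \<noteq> 0" if "z \<in> path_image (rectpath ?a ?b)" for z
    using that nonzero_right[of z] nonzero_left[of z] nz[of z] le T unfolding path_image_rectpath[OF le] by auto
  have "contour_integral (rectpath ?a ?b) (\<lambda>x. deriv f x * 1 / f x) =
      2 * pi * \<i> * (\<Sum>p\<in>{w \<in> ?S. f w = 0 \<or> w \<in> {}}. winding_number (rectpath ?a ?b) p * 1 * zorder f p)"
  proof (rule argument_principle)
    show "path_image (rectpath ?a ?b) \<subseteq> ?S - {w \<in> ?S. f w = 0 \<or> w \<in> {}}"
      using path path_image_rectpath_subset_cbox[OF le] sub by auto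
    show "\<forall>z. z \<notin> ?S \<longrightarrow> winding_number (rectpath ?a ?b) z = 0"
      using winding_number_rectpath_outside[OF le] sub by blast
    show "connected ?S" by (intro convex_connected convex_box)
  qed (use holo fin in \<open>auto intro: holomorphic_on_subset\<close>)
  also have "{w \<in> ?S. f w = 0 \<or> w \<in> {}} = ?pz" by simp
  also have "(\<Sum>p\<in>?pz. winding_number (rectpath ?a ?b) p * 1 * zorder f p) = (\<Sum>p\<in>zeros T. of_nat (nat (zorder f p)))"
  proof (rule sum.mono_neutral_cong_right[OF fin])
    show "zeros T \<subseteq> ?pz"
      using zeros_strip[of _ T] by (force simp: zeros_def in_box_complex_iff abs_le_iff)
    show "\<forall>p\<in>?pz - zeros T. winding_number (rectpath ?a ?b) p * 1 * of_int (zorder f p) = 0"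
    proof
      fix p assume "p \<in> ?pz - zeros T"
      hence "p \<notin> cbox ?a ?b" by (auto simp: zeros_def in_cbox_complex_iff abs_le_iff)
      hence "winding_number (rectpath ?a ?b) p = 0" by (intro winding_number_rectpath_outside le)
      thus "winding_number (rectpath ?a ?b) p * 1 * of_int (zorder f p) = 0" by simp
    qed
    fix p assume p: "p \<in> zeros T"
    hence fp: "f p = 0" "\<bar>Im p\<bar> \<le> T" by (auto simp: zeros_def)
    hence "\<bar>Im p\<bar> \<noteq> T" using nz[of p] by auto
    hence fp: "f p = 0" "\<bar>Im p\<bar> < T" using fp by auto
    have "p \<in> box ?a ?b" using zeros_strip[OF p] fp by (auto simp: in_box_complex_iff)
    hence "winding_number (rectpath ?a ?b) p = 1" by (rule winding_number_rectpath)
    moreover have "zorder f p > 0"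
      using zorder_exist_zero[OF holo, of p] nonzero_right[of "of_real \<sigma>"] fp by (auto split: if_splits)
    ultimately show "winding_number (rectpath ?a ?b) p * 1 * of_int (zorder f p) = of_nat (nat (zorder f p))"
      by simp
  qed
  finally show ?thesis by (simp add: N_def)
qed

text \<open>On the left edge \<open>L\<close> (u - s) is a primitive of f'/f by the functional
  equation, and the reflection respects the orientation. Both vertical edges therefore contribute
  the same increment, so the natural quantity is half of the count.\<close>

lemma count_generic:
  assumes T: "T > 0" and nz: "\<And>s. \<bar>Im s\<bar> = T \<Longrightarrow> f s \<noteq> 0"
  shows "\<bar>2 * pi * real (N T) - 2 * (T * ln (T / (2 * pi)) - T)\<bar>
     \<le> 2 * (6 * pi + 3 * \<sigma> + 32 * ln (\<sigma> / 2 + T / 2)) + 2 * (1500 * real m * ln (T + 100 * real m) + 2)"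
proof -
  let ?q = "\<lambda>s. deriv f s / f s"
  let ?a1 = "Complex (u - \<sigma>) (- T)" and ?a2 = "Complex \<sigma> (- T)"
  let ?a3 = "Complex \<sigma> T" and ?a4 = "Complex (u - \<sigma>) T"
  obtain L where L: "\<And>s. Re s = \<sigma> \<Longrightarrow> (L has_field_derivative ?q s) (at s)"
    "\<And>T. T \<ge> 0 \<Longrightarrow> \<bar>Im (L (Complex \<sigma> T) - L (Complex \<sigma> (- T))) - (T * ln (T / (2 * pi)) - T)\<bar>
        \<le> 6 * pi + 3 * \<sigma> + 32 * ln (\<sigma> / 2 + T / 2)"
    using right_log by blast
  have cont: "continuous_on A ?q" if "\<And>z. z \<in> A \<Longrightarrow> f z \<noteq> 0" for A
    by (intro continuous_intros holomorphic_on_imp_continuous_on holomorphic_on_subset[OF holo]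
          holomorphic_on_subset[OF holomorphic_deriv[OF holo]]) (auto dest: that)
  have seg: "f z \<noteq> 0" if "z \<in> closed_segment ?a1 ?a2 \<or> z \<in> closed_segment ?a2 ?a3 \<or> z \<in> closed_segment ?a3 ?a4 \<or> z \<in> closed_segment ?a4 ?a1" for z
    using that nz[of z] nonzero_right[of z] nonzero_left[of z] T
    by (auto simp: closed_segment_same_Im closed_segment_same_Re)
  have ci: "?q contour_integrable_on linepath ?a1 ?a2" "?q contour_integrable_on linepath ?a2 ?a3"
    "?q contour_integrable_on linepath ?a3 ?a4" "?q contour_integrable_on linepath ?a4 ?a1"
    by (intro contour_integrable_continuous_linepath cont; use seg in blast)+
  have "contour_integral (rectpath ?a1 ?a3) ?q =
     contour_integral (linepath ?a1 ?a2) ?q + contour_integral (linepath ?a2 ?a3) ?q +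
     contour_integral (linepath ?a3 ?a4) ?q + contour_integral (linepath ?a4 ?a1) ?q"
    unfolding rectpath_def Let_def using ci by (simp add: contour_integrable_joinI add.assoc)
  hence split: "2 * pi * \<i> * of_nat (N T) =
     contour_integral (linepath ?a1 ?a2) ?q + contour_integral (linepath ?a2 ?a3) ?q +
     contour_integral (linepath ?a3 ?a4) ?q + contour_integral (linepath ?a4 ?a1) ?q"
    using argument_principle_count[OF T nz] by simp
  have right: "contour_integral (linepath ?a2 ?a3) ?q = L ?a3 - L ?a2"
  proof -
    have "(?q has_contour_integral (L (pathfinish (linepath ?a2 ?a3)) - L (pathstart (linepath ?a2 ?a3)))) (linepath ?a2 ?a3)"
      by (rule contour_integral_primitive[where S = "{s. Re s = \<sigma>}"])
         (use L(1) in \<open>auto simp: closed_segment_same_Re intro: has_field_derivative_at_within\<close>)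
    thus ?thesis by (simp add: contour_integral_unique)
  qed
  have left: "contour_integral (linepath ?a4 ?a1) ?q = L ?a3 - L ?a2"
  proof -
    have d: "((\<lambda>s. L (of_real u - s)) has_field_derivative ?q s) (at s)" if s: "Re s = u - \<sigma>" for s
    proof -
      have "((\<lambda>s. f (of_real u - s)) has_field_derivative deriv f (of_real u - s) * (- 1)) (at s)"
        by (rule DERIV_chain2[where f = f]) (auto intro!: derivative_eq_intros holomorphic_derivI[OF holo])
      hence "(f has_field_derivative - deriv f (of_real u - s)) (at s)" by (simp add: feq)
      hence df: "deriv f s = - deriv f (of_real u - s)" by (rule DERIV_imp_deriv)
      have "((\<lambda>s. L (of_real u - s)) has_field_derivative ?q (of_real u - s) * (- 1)) (at s)"
        by (rule DERIV_chain2[where f = L]) (use s in \<open>auto intro!: derivative_eq_intros L(1)\<close>)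
      thus ?thesis by (simp add: df feq)
    qed
    have "(?q has_contour_integral (L (of_real u - pathfinish (linepath ?a4 ?a1)) - L (of_real u - pathstart (linepath ?a4 ?a1)))) (linepath ?a4 ?a1)"
      by (rule contour_integral_primitive[where S = "{s. Re s = u - \<sigma>}" and f = "\<lambda>s. L (of_real u - s)"])
         (use d in \<open>auto simp: closed_segment_same_Re intro: has_field_derivative_at_within\<close>)
    moreover have "of_real u - ?a1 = ?a3" "of_real u - ?a4 = ?a2" by (simp_all add: complex_eq_iff)
    ultimately show ?thesis by (simp add: contour_integral_unique)
  qed
  have top: "\<bar>Im (contour_integral (linepath ?a3 ?a4) ?q)\<bar> \<le> 1500 * real m * ln (T + 100 * real m) + 2"
    using horizontal_bound[of T] nz T by simp
  have rev: "contour_integral (linepath ?a1 ?a2) ?q = - contour_integral (linepath ?a2 ?a1) ?q"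
    by (intro contour_integral_reverse_linepath cont) (use seg in blast)
  have bottom: "\<bar>Im (contour_integral (linepath ?a1 ?a2) ?q)\<bar> \<le> 1500 * real m * ln (T + 100 * real m) + 2"
    unfolding rev using horizontal_bound[of "- T"] nz T by simp
  have "2 * pi * real (N T) = Im (2 * pi * \<i> * of_nat (N T))" by simp
  also have "\<dots> = Im (contour_integral (linepath ?a1 ?a2) ?q) + 2 * Im (L ?a3 - L ?a2) + Im (contour_integral (linepath ?a3 ?a4) ?q)"
    unfolding split right left by simp
  finally have sum: "2 * pi * real (N T) = Im (contour_integral (linepath ?a1 ?a2) ?q) + 2 * Im (L ?a3 - L ?a2) + Im (contour_integral (linepath ?a3 ?a4) ?q)" .
  have "\<bar>x - 2 * F\<bar> \<le> 2 * E + 2 * K"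
    if "x = b1 + 2 * j + b2" "\<bar>b1\<bar> \<le> K" "\<bar>b2\<bar> \<le> K" "\<bar>j - F\<bar> \<le> E" for x F E K b1 b2 j :: real
    using that by linarith
  from this[OF sum bottom top L(2)[OF less_imp_le[OF T]]] show ?thesis .
qed

lemma log_bounds:
  assumes "T \<ge> 0"
  shows "1 / 2 \<le> ln (T + u + 2)" "ln (T + 100 * real m) \<le> 13 * ln (T + u + 2)"
    "ln (\<sigma> / 2 + T / 2) \<le> 13 * ln (T + u + 2)"
proof -
  have l2: "ln 2 \<le> ln (T + u + 2)" using assms u by (intro ln_mono) auto
  have "1 / 2 \<le> ln (2::real)" using ln_le_minus_one[of "1 / 2 :: real"] by (simp add: ln_div)
  with l2 show "1 / 2 \<le> ln (T + u + 2)" by linarith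
  \<comment> \<open>100 m \<le> 400 u + 2500, which is below 4096 (u + 2).\<close>
  have "ln (T + 100 * real m) \<le> ln (2 ^ 12 * (T + u + 2))"
    using assms u m_bounds by (intro ln_mono) auto
  also have "\<dots> = 12 * ln 2 + ln (T + u + 2)"
    using assms u by (simp add: ln_mult ln_realpow del: power_numeral)
  also have "\<dots> \<le> 13 * ln (T + u + 2)" using l2 by linarith
  finally show 1: "ln (T + 100 * real m) \<le> 13 * ln (T + u + 2)" .
  have "ln (\<sigma> / 2 + T / 2) \<le> ln (T + 100 * real m)"
    using assms u \<sigma>_ge m_bounds by (intro ln_mono) auto
  with 1 show "ln (\<sigma> / 2 + T / 2) \<le> 13 * ln (T + u + 2)" by linarith
qed

lemma count_generic':
  assumes T: "T > 0" and nz: "\<And>s. \<bar>Im s\<bar> = T \<Longrightarrow> f s \<noteq> 0"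
  shows "\<bar>2 * pi * real (N T) - 2 * (T * ln (T / (2 * pi)) - T)\<bar> \<le> 40000 * (real m * ln (T + u + 2))"
proof -
  define l where "l = ln (T + u + 2)"
  note lb = log_bounds[OF less_imp_le[OF T], folded l_def]
  have ml: "real m \<le> 2 * (real m * l)" using mult_left_mono[OF lb(1), of "2 * real m"] by simp
  have l1: "l \<le> real m * l" using mult_right_mono[of 1 "real m" l] lb(1) m_bounds by simp
  have "real m * ln (T + 100 * real m) \<le> 13 * (real m * l)"
    using mult_left_mono[OF lb(2), of "real m"] by (simp add: mult_ac)
  hence a: "1500 * real m * ln (T + 100 * real m) \<le> 19500 * (real m * l)" by linarith
  have cg: "\<bar>2 * pi * real (N T) - 2 * (T * ln (T / (2 * pi)) - T)\<bar>
     \<le> 2 * (6 * pi + 3 * \<sigma> + 32 * ln (\<sigma> / 2 + T / 2)) + 2 * (1500 * real m * ln (T + 100 * real m) + 2)"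
    by (rule count_generic[OF T]) (rule nz)
  \<comment> \<open>The constants add up to 104 + 24 + 832 + 39000 = 39960.\<close>
  have "2 * (6 * p + 3 * sg + 32 * L2) + 2 * (W + 2) \<le> 40000 * ml"
    if "p < 4" "sg \<le> 2 * M" "M \<le> 2 * ml" "l \<le> ml" "1 / 2 \<le> l" "L2 \<le> 13 * l" "W \<le> 19500 * ml"
    for p sg L2 W ml M l :: real
  proof -
    have "12 * p + 4 \<le> 104 * l" using that(1,5) by linarith
    moreover have "6 * sg \<le> 24 * ml" using that(2,3) by linarith
    moreover have "64 * L2 \<le> 832 * l" using that(6) by linarith
    moreover have "2 * W \<le> 39000 * ml" using that(7) by linarith
    moreover have "l \<le> ml" "0 \<le> ml" using that(4,5) by linarith+
    ultimately show ?thesis by (simp add: algebra_simps)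
  qed
  from order_trans[OF cg this[OF pi_less_4 \<sigma>_ge(3) ml l1 lb(1) lb(3) a]] show ?thesis
    by (simp only: l_def)
qed

text \<open>The argument principle needs edges free of zeros. Stopping before the next larger
  ordinate of a zero keeps the count, and it also replaces T = 0 by a positive height.\<close>

lemma generic_height:
  assumes "T \<ge> 0"
  obtains T' where "T < T'" "T' \<le> T + 1" "zeros T' = zeros T" "\<And>s. \<bar>Im s\<bar> = T' \<Longrightarrow> f s \<noteq> 0"
proof -
  define A where "A = insert (T + 1) ((\<lambda>\<rho>. \<bar>Im \<rho>\<bar>) ` {\<rho> \<in> zeros (T + 1). \<bar>Im \<rho>\<bar> > T})"
  have fin: "finite A" unfolding A_def using finite_zeros by auto
  have gt: "T < Min A" using fin by (subst Min_gr_iff) (auto simp: A_def)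
  have le: "Min A \<le> T + 1" by (rule Min_le[OF fin]) (simp add: A_def)
  define T' where "T' = (T + Min A) / 2"
  have T': "T < T'" "T' < Min A" using gt by (auto simp: T'_def)
  have no: "f s \<noteq> 0" if "T < \<bar>Im s\<bar>" "\<bar>Im s\<bar> \<le> T'" for s
  proof
    assume "f s = 0"
    hence "\<bar>Im s\<bar> \<in> A" using that T' le by (auto simp: A_def zeros_def)
    hence "Min A \<le> \<bar>Im s\<bar>" by (rule Min_le[OF fin])
    thus False using that T' by linarith
  qed
  have "zeros T' = zeros T"
    using no T' by (auto simp: zeros_def) (meson not_le)
  thus ?thesis using that[of T'] T' le no by auto
qed

text \<open>The cost of replacing T by \<open>T'\<close> in the main term. As \<open>T'\<close> may
  be close to 0, where ln is unbounded below, d ln \<open>T'\<close> is estimated through d \<le>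
  \<open>T'\<close> and d ln d \<ge> d - 1.\<close>

lemma xlnx_increment:
  fixes T T' :: real
  assumes T: "T \<ge> 0" "T < T'" "T' \<le> T + 1"
  shows "\<bar>(T' * ln (T' / (2 * pi)) - T') - (T * ln (T / (2 * pi)) - T)\<bar> \<le> 6 + ln (T + 2)"
proof -
  define d where "d = T' - T"
  have d: "0 < d" "d \<le> 1" using T by (auto simp: d_def)
  \<comment> \<open>At t = 0 both sides vanish, whatever value \<open>ln\<close> has there.\<close>
  have ln_T: "t * ln (t / (2 * pi)) = t * ln t - t * ln (2 * pi)" if "t \<ge> 0" for t
    using that by (cases "t = 0") (auto simp: ln_div algebra_simps)
  have eq: "(T' * ln (T' / (2 * pi)) - T') - (T * ln (T / (2 * pi)) - T) =
     T * (ln T' - ln T) + d * ln T' - d * (1 + ln (2 * pi))"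
    using T unfolding d_def by (subst (1 2) ln_T) (auto simp: algebra_simps)
  have 1: "0 \<le> T * (ln T' - ln T) \<and> T * (ln T' - ln T) \<le> 1"
  proof (cases "T = 0")
    case False
    hence Tp: "T > 0" using T by simp
    have "ln T' - ln T = ln (T' / T)" using Tp T by (simp add: ln_div)
    also have "\<dots> \<le> T' / T - 1" using Tp T by (intro ln_le_minus_one) auto
    finally have "T * (ln T' - ln T) \<le> T * (T' / T - 1)" using Tp by (intro mult_left_mono) auto
    also have "\<dots> = d" using Tp by (simp add: d_def field_simps)
    finally show ?thesis using d Tp T by simp
  qed simp
  have 2: "- 1 \<le> d * ln T' \<and> d * ln T' \<le> ln (T + 2)"
  proof
    have "ln (1 / d) \<le> 1 / d - 1" using d by (intro ln_le_minus_one) auto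
    hence "- ln d \<le> 1 / d - 1" using d by (simp add: ln_div)
    moreover have "ln d \<le> ln T'" using d T by (intro ln_mono) (auto simp: d_def)
    ultimately have "d * (1 - 1 / d) \<le> d * ln T'" using d by (intro mult_left_mono) auto
    thus "- 1 \<le> d * ln T'" using d by (simp add: algebra_simps)
    have "ln T' \<le> ln (T + 2)" using T by (intro ln_mono) auto
    hence "d * ln T' \<le> d * ln (T + 2)" using d by (intro mult_left_mono) auto
    also have "\<dots> \<le> 1 * ln (T + 2)" using d T by (intro mult_right_mono) auto
    finally show "d * ln T' \<le> ln (T + 2)" by simp
  qed
  have "ln (2 * pi) \<le> ln (2 ^ 3)" using pi_less_4 by (intro ln_mono) auto
  also have "\<dots> = 3 * ln (2::real)" by (subst ln_realpow) auto
  also have "\<dots> \<le> 3 * 1" using ln_le_minus_one[of 2] by simp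
  finally have l: "ln (2 * pi) \<le> 3" by simp
  have "0 \<le> ln (2 * pi)" using pi_gt3 by simp
  hence "0 \<le> d * (1 + ln (2 * pi))" "d * (1 + ln (2 * pi)) \<le> 1 * 4"
    using d l by (intro mult_nonneg_nonneg mult_mono; simp)+
  moreover have "ln (T + 2) \<ge> 0" using T by simp
  ultimately show ?thesis unfolding eq abs_le_iff using 1 2 by linarith
qed

text \<open>Returning from \<open>T'\<close> to T costs 2 (6 + l) \<le> 26 l. Dividing by 4 pi \<ge>
  12 and using m \<le> 25 (u + 1) gives a constant below 166721; the margin up to 170000 absorbs 7/8
  \<le> 2 l.\<close>

theorem count_zeros:
  assumes T: "T \<ge> 0"
  shows "\<bar>1 / 2 * real (N T) - (T / (2 * pi) * ln (T / (2 * pi)) - T / (2 * pi) + 7 / 8)\<bar>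
           \<le> 170000 * (u + 1) * ln (T + u + 2)"
proof -
  obtain T' where T': "T < T'" "T' \<le> T + 1" "zeros T' = zeros T" "\<And>s. \<bar>Im s\<bar> = T' \<Longrightarrow> f s \<noteq> 0"
    using generic_height[OF T] by blast
  define l where "l = ln (T + u + 2)"
  define F where "F t = t * ln (t / (2 * pi)) - t" for t
  have NT: "N T' = N T" by (simp add: N_def T'(3))
  have lb: "1 / 2 \<le> l" unfolding l_def by (rule log_bounds(1)[OF T])
  have "ln (T' + u + 2) \<le> ln (2 * (T + u + 2))" using T T' u by (intro ln_mono) auto
  also have "\<dots> = ln 2 + l" unfolding l_def by (subst ln_mult) (use T u in auto)
  also have "ln 2 \<le> l" unfolding l_def using T u by (intro ln_mono) auto
  finally have l': "ln (T' + u + 2) \<le> 2 * l" by simp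
  have "\<bar>2 * pi * real (N T) - 2 * F T'\<bar> \<le> 40000 * (real m * ln (T' + u + 2))"
    using count_generic'[of T'] T' T NT by (simp add: F_def)
  also have "real m * ln (T' + u + 2) \<le> real m * (2 * l)" by (intro mult_left_mono l') auto
  finally have 1: "\<bar>2 * pi * real (N T) - 2 * F T'\<bar> \<le> 80000 * (real m * l)" by simp
  have "ln (T + 2) \<le> l" unfolding l_def using T u by (intro ln_mono) auto
  hence 2: "\<bar>F T' - F T\<bar> \<le> 6 + l"
    using xlnx_increment[OF T T'(1,2)] unfolding F_def by linarith
  have l1: "l \<le> real m * l" using mult_right_mono[of 1 "real m" l] lb m_bounds by simp
  have 3: "\<bar>2 * pi * real (N T) - 2 * F T\<bar> \<le> 80026 * (real m * l)"
    using 1 2 l1 lb unfolding abs_le_iff by linarith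
  have "1 / 2 * real (N T) - (T / (2 * pi) * ln (T / (2 * pi)) - T / (2 * pi)) = (2 * pi * real (N T) - 2 * F T) / (4 * pi)"
    by (simp add: F_def field_simps)
  also have "\<bar>\<dots>\<bar> = \<bar>2 * pi * real (N T) - 2 * F T\<bar> / (4 * pi)" by (simp add: abs_divide)
  also have "\<dots> \<le> 80026 * (real m * l) / (4 * pi)"
    using 3 by (rule divide_right_mono) simp
  also have "\<dots> \<le> 80026 * (real m * l) / 12"
    using pi_gt3 lb by (intro divide_left_mono) auto
  finally have 4: "\<bar>1 / 2 * real (N T) - (T / (2 * pi) * ln (T / (2 * pi)) - T / (2 * pi))\<bar> \<le> 80026 * (real m * l) / 12" .
  have "real m * l \<le> (25 * (u + 1)) * l" using m_bounds u lb by (intro mult_right_mono) auto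
  hence 5: "real m * l \<le> 25 * ((u + 1) * l)" by (simp only: mult.assoc)
  have "\<bar>1 / 2 * real (N T) - (T / (2 * pi) * ln (T / (2 * pi)) - T / (2 * pi) + 7 / 8)\<bar> \<le> 170000 * ((u + 1) * l)"
    using 4 5 l1 lb unfolding abs_le_iff by linarith
  thus ?thesis by (simp only: l_def mult.assoc)
qed

end

lemma xi_like_xi_Q:
  assumes "u > 0"
  shows "xi_like u (xi_Q (of_real u))"
  unfolding xi_Q_eq_Xi
proof
  show "Xi (of_real u) holomorphic_on UNIV" by (rule entire2_slices(1)[OF Xi_entire2])
qed (use assms Xi_functional_equation Xi_growth Xi_dirichlet in auto)

theorem theorem6p2:
  "\<exists>(C\<^sub>0 :: real) (S :: real \<Rightarrow> real \<Rightarrow> real).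
     \<forall>u > 0. \<forall>T \<ge> 0.
       finite (xi_zeros u T) \<and>
       1 / 2 * real (N_zeros u T)
         = T / (2 * pi) * ln (T / (2 * pi)) - T / (2 * pi) + 7 / 8 + S u T \<and>
       \<bar>S u T\<bar> \<le> C\<^sub>0 * (u + 1) * ln (T + u + 2)"
proof (rule exI[of _ 170000],
    rule exI[of _ "\<lambda>u T. 1 / 2 * real (N_zeros u T) -
      (T / (2 * pi) * ln (T / (2 * pi)) - T / (2 * pi) + 7 / 8)"], intro allI impI)
  \<comment> \<open>\<open>S\<close> has been taken as the difference of the two sides, so
    finiteness and the bound are what remains.\<close>
  fix u T :: real
  assume u: "u > 0" and T: "T \<ge> 0"
  interpret xi_like u "xi_Q (of_real u)" by (rule xi_like_xi_Q[OF u])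
  have z: "zeros T = xi_zeros u T" by (simp add: zeros_def xi_zeros_def)
  have n: "N T = N_zeros u T" by (simp add: N_def N_zeros_def z)
  have "finite (xi_zeros u T)" using finite_zeros[of T] by (simp only: z)
  moreover have "\<bar>1 / 2 * real (N_zeros u T) - (T / (2 * pi) * ln (T / (2 * pi)) - T / (2 * pi) + 7 / 8)\<bar>
      \<le> 170000 * (u + 1) * ln (T + u + 2)"
    using count_zeros[OF T] by (simp only: n)
  ultimately show "finite (xi_zeros u T) \<and>
       1 / 2 * real (N_zeros u T) = T / (2 * pi) * ln (T / (2 * pi)) - T / (2 * pi) + 7 / 8 +
         (1 / 2 * real (N_zeros u T) - (T / (2 * pi) * ln (T / (2 * pi)) - T / (2 * pi) + 7 / 8)) \<and>
       \<bar>1 / 2 * real (N_zeros u T) - (T / (2 * pi) * ln (T / (2 * pi)) - T / (2 * pi) + 7 / 8)\<bar>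
         \<le> 170000 * (u + 1) * ln (T + u + 2)"
    by linarith
qed

end
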